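(* Let $X$ be a co-bounded $\mathrm{CAT}(0)$ space, and let $G$ be a group acting on $X$ properly discontinuously (but not necessarily co-boundedly). Suppose that $G$ has an unbounded orbit in the curtain model $X_D$. Then the coarse kernel $G_X$ is virtually cyclic. Moreover, if in addition an orbit of $G$ in $X_D$ is not a quasi-line, then $G_X$ is finite.
   Context: All actions are by isometries. A metric space $X$ is co-bounded if some group acts co-boundedly on it by isometries (equivalently, $\mathrm{Isom}(X)$ has a quasi-dense orbit). An action of $G$ on $(X,d)$ is properly discontinuous if for every $x\in X$, $r>0$ only finitely many $g\in G$ satisfy $d(g\cdot x,x)\le r$. A quasi-line is a metric space quasi-isometric to $\mathbb{R}$; an orbit of $G$ in $X_D$ carries the restriction of the metric $D$. Virtually cyclic means having a cyclic (possibly finite or trivial) subgroup of finite index. Coarse kernel: for $G$ acting on $(X,d)$, $G_X := \{g\in G \mid \exists C>0 \text{ with } d(g\cdot x,x)\le C\ \forall x\in X\}$. Curtain model. Let $X$ be a $\mathrm{CAT}(0)$ space. For a geodesic $\alpha:I\to X$ ($I\subseteq\mathbb{R}$ a closed interval) with closest-point projection $\pi_\alpha$ onto $\alpha$, and $r$ with $[r-1/2,r+1/2]$ in the interior of $I$, the curtain dual to $\alpha$ at $r$ is $h=h_{\alpha,r}=\pi_\alpha^{-1}(\alpha[r-1/2,r+1/2])$. Its halfspaces are $h^-=\pi_\alpha^{-1}\alpha(I\cap(-\infty,r-1/2))$ and $h^+=\pi_\alpha^{-1}\alpha(I\cap(r+1/2,\infty))$. The curtain $h$ separates subsets $A,B\subseteq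 X$ if one lies in $h^-$ and the other in $h^+$. A set $\{h_i\}$ of curtains (indexed by consecutive integers) is a chain if $h_i$ separates $h_{i-1}$ from $h_{i+1}$ for all $i$; a chain separates $A$ from $B$ if each $h_i$ does. For $L\in\mathbb{N}$, $L\geq 1$, disjoint curtains $h,h'$ are $L$-separated if every chain all of whose members meet both $h$ and $h'$ has cardinality at most $L$. An $L$-chain is a chain of curtains in which each pair is $L$-separated. Set $d_L(x,x)=0$ and, for $x\ne y$, $d_L(x,y)=1+\max\{|c| : c \text{ is an } L\text{-chain separating } x \text{ from } y\}$. Fix a sequence $\lambda_L\in(0,1)$ with $\sum_{L\ge1}\lambda_L<\sum_{L\ge1}L\lambda_L<\sum_{L\ge1}L^2\lambda_L=\Lambda<\infty$. The curtain model is $X_D:=(X,D)$ with $D(x,y)=\sum_{L=1}^\infty\lambda_L d_L(x,y)$. Every isometry of $X$ is an isometry of $X_D$, so an action of $G$ on $X$ induces an action of $G$ on $X_D$. *)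

theory Defs
  imports "HOL-Analysis.Analysis" "HOL-Algebra.Group_Action" "HOL-Algebra.Elementary_Groups"
begin

section \<open>Group actions by isometries\<close>

definition isometric_action ::
    "('g, 'm) monoid_scheme \<Rightarrow> 'a set \<Rightarrow> ('a \<Rightarrow> 'a \<Rightarrow> real) \<Rightarrow> ('g \<Rightarrow> 'a \<Rightarrow> 'a) \<Rightarrow> bool" where
  "isometric_action G X d \<phi> \<longleftrightarrow>
     group_action G X \<phi> \<and> (\<forall>g\<in>carrier G. \<forall>x\<in>X. \<forall>y\<in>X. d (\<phi> g x) (\<phi> g y) = d x y)"

definition cobounded_action ::
    "('g, 'm) monoid_scheme \<Rightarrow> 'a set \<Rightarrow> ('a \<Rightarrow> 'a \<Rightarrow> real) \<Rightarrow> ('g \<Rightarrow> 'a \<Rightarrow> 'a) \<Rightarrow> bool" where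
  "cobounded_action G X d \<phi> \<longleftrightarrow>
     (\<exists>x\<in>X. \<exists>R. \<forall>y\<in>X. \<exists>g\<in>carrier G. d (\<phi> g x) y \<le> R)"

text \<open>
  Isometry groups are carried by the type of self-maps, so quantifying only over groups carried
  by that type loses nothing; see \<open>cobounded_spaceI\<close>.
\<close>
definition cobounded_space :: "'a set \<Rightarrow> ('a \<Rightarrow> 'a \<Rightarrow> real) \<Rightarrow> bool" where
  "cobounded_space X d \<longleftrightarrow>
     (\<exists>(H :: ('a \<Rightarrow> 'a) monoid) \<psi>. isometric_action H X d \<psi> \<and> cobounded_action H X d \<psi>)"

lemma cobounded_spaceI:
  fixes G :: "('g, 'm) monoid_scheme"
  assumes iso: "isometric_action G X d \<phi>" and cob: "cobounded_action G X d \<phi>"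
  shows "cobounded_space X d"
proof -
  interpret group_hom G "BijGroup X" \<phi>
    using iso by (simp add: isometric_action_def group_action_def)
  let ?H = "(BijGroup X)\<lparr>carrier := \<phi> ` carrier G\<rparr>"
  have sub: "subgroup (\<phi> ` carrier G) (BijGroup X)"
    by (rule img_is_subgroup)
  have "group_hom ?H (BijGroup X) (\<lambda>f. f)"
    unfolding group_hom_def group_hom_axioms_def hom_def
    using H.subgroup_imp_group[OF sub] H.is_group subgroup.subset[OF sub] by auto
  then have "isometric_action ?H X d (\<lambda>f. f)"
    using iso by (auto simp: isometric_action_def group_action_def)
  moreover have "cobounded_action ?H X d (\<lambda>f. f)"
    using cob by (simp add: cobounded_action_def)
  ultimately show ?thesis
    unfolding cobounded_space_def by blast
qed

definition properly_discontinuous ::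
    "('g, 'm) monoid_scheme \<Rightarrow> 'a set \<Rightarrow> ('a \<Rightarrow> 'a \<Rightarrow> real) \<Rightarrow> ('g \<Rightarrow> 'a \<Rightarrow> 'a) \<Rightarrow> bool" where
  "properly_discontinuous G X d \<phi> \<longleftrightarrow>
     (\<forall>x\<in>X. \<forall>r>0. finite {g \<in> carrier G. d (\<phi> g x) x \<le> r})"

definition coarse_kernel ::
    "('g, 'm) monoid_scheme \<Rightarrow> 'a set \<Rightarrow> ('a \<Rightarrow> 'a \<Rightarrow> real) \<Rightarrow> ('g \<Rightarrow> 'a \<Rightarrow> 'a) \<Rightarrow> 'g set" where
  "coarse_kernel G X d \<phi> = {g \<in> carrier G. \<exists>C>0. \<forall>x\<in>X. d (\<phi> g x) x \<le> C}"

definition virtually_cyclic :: "('g, 'm) monoid_scheme \<Rightarrow> bool" where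
  "virtually_cyclic K \<longleftrightarrow>
     group K \<and>
     (\<exists>H. subgroup H K \<and> cyclic_group (K\<lparr>carrier := H\<rparr>) \<and> finite (rcosets\<^bsub>K\<^esub> H))"


section \<open>Quasi-isometries\<close>

definition quasi_isometric ::
    "'a set \<Rightarrow> ('a \<Rightarrow> 'a \<Rightarrow> real) \<Rightarrow> 'b set \<Rightarrow> ('b \<Rightarrow> 'b \<Rightarrow> real) \<Rightarrow> bool" where
  "quasi_isometric A dA B dB \<longleftrightarrow>
     (\<exists>f K C. f \<in> A \<rightarrow> B \<and> K \<ge> 1 \<and> C \<ge> 0 \<and>
        (\<forall>x\<in>A. \<forall>y\<in>A. dA x y / K - C \<le> dB (f x) (f y) \<and> dB (f x) (f y) \<le> K * dA x y + C) \<and>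
        (\<forall>z\<in>B. \<exists>x\<in>A. dB (f x) z \<le> C))"

definition quasi_line :: "'a set \<Rightarrow> ('a \<Rightarrow> 'a \<Rightarrow> real) \<Rightarrow> bool" where
  "quasi_line A dA \<longleftrightarrow> quasi_isometric A dA (UNIV :: real set) dist"


section \<open>CAT(0) spaces\<close>

definition geodesic :: "'a set \<Rightarrow> ('a \<Rightarrow> 'a \<Rightarrow> real) \<Rightarrow> real set \<Rightarrow> (real \<Rightarrow> 'a) \<Rightarrow> bool" where
  "geodesic X d I \<alpha> \<longleftrightarrow>
     closed I \<and> is_interval I \<and> \<alpha> \<in> I \<rightarrow> X \<and> (\<forall>s\<in>I. \<forall>t\<in>I. d (\<alpha> s) (\<alpha> t) = \<bar>s - t\<bar>)"

definition geodesic_from_to ::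
    "'a set \<Rightarrow> ('a \<Rightarrow> 'a \<Rightarrow> real) \<Rightarrow> 'a \<Rightarrow> 'a \<Rightarrow> (real \<Rightarrow> 'a) \<Rightarrow> bool" where
  "geodesic_from_to X d x y \<alpha> \<longleftrightarrow>
     geodesic X d {0..d x y} \<alpha> \<and> \<alpha> 0 = x \<and> \<alpha> (d x y) = y"

text \<open>
  The comparison inequality for geodesic triangles: \<open>p'\<close>, \<open>q'\<close>, \<open>r'\<close> is a comparison triangle in
  the Euclidean plane, and \<open>x'\<close>, \<open>y'\<close> are the comparison points of \<open>\<alpha> s\<close>, \<open>\<beta> t\<close>. Any two sides
  of a triangle share a vertex, which is called \<open>p\<close>; for two points on the same side there is
  nothing to require.
\<close>
definition CAT0_space :: "'a set \<Rightarrow> ('a \<Rightarrow> 'a \<Rightarrow> real) \<Rightarrow> bool" where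
  "CAT0_space X d \<longleftrightarrow>
     Metric_space X d \<and>
     (\<forall>x\<in>X. \<forall>y\<in>X. \<exists>\<alpha>. geodesic_from_to X d x y \<alpha>) \<and>
     (\<forall>p\<in>X. \<forall>q\<in>X. \<forall>r\<in>X. \<forall>\<alpha> \<beta>. geodesic_from_to X d p q \<alpha> \<longrightarrow> geodesic_from_to X d p r \<beta> \<longrightarrow>
        (\<forall>p' q' r' :: real ^ 2.
           dist p' q' = d p q \<longrightarrow> dist p' r' = d p r \<longrightarrow> dist q' r' = d q r \<longrightarrow>
           (\<forall>s\<in>{0..d p q}. \<forall>t\<in>{0..d p r}.
              \<forall>x'\<in>closed_segment p' q'. \<forall>y'\<in>closed_segment p' r'.
                dist p' x' = s \<longrightarrow> dist p' y' = t \<longrightarrow> d (\<alpha> s) (\<beta> t) \<le> dist x' y')))"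


section \<open>Curtains\<close>

definition geodesic_proj ::
    "('a \<Rightarrow> 'a \<Rightarrow> real) \<Rightarrow> real set \<Rightarrow> (real \<Rightarrow> 'a) \<Rightarrow> 'a \<Rightarrow> 'a" where
  "geodesic_proj d I \<alpha> x = (THE p. p \<in> \<alpha> ` I \<and> (\<forall>q\<in>\<alpha> ` I. d x p \<le> d x q))"

definition curtain ::
    "'a set \<Rightarrow> ('a \<Rightarrow> 'a \<Rightarrow> real) \<Rightarrow> real set \<Rightarrow> (real \<Rightarrow> 'a) \<Rightarrow> real \<Rightarrow> 'a set" where
  "curtain X d I \<alpha> r = {x \<in> X. geodesic_proj d I \<alpha> x \<in> \<alpha> ` {r - 1/2..r + 1/2}}"

definition minus_halfspace ::
    "'a set \<Rightarrow> ('a \<Rightarrow> 'a \<Rightarrow> real) \<Rightarrow> real set \<Rightarrow> (real \<Rightarrow> 'a) \<Rightarrow> real \<Rightarrow> 'a set" where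
  "minus_halfspace X d I \<alpha> r = {x \<in> X. geodesic_proj d I \<alpha> x \<in> \<alpha> ` (I \<inter> {..<r - 1/2})}"

definition plus_halfspace ::
    "'a set \<Rightarrow> ('a \<Rightarrow> 'a \<Rightarrow> real) \<Rightarrow> real set \<Rightarrow> (real \<Rightarrow> 'a) \<Rightarrow> real \<Rightarrow> 'a set" where
  "plus_halfspace X d I \<alpha> r = {x \<in> X. geodesic_proj d I \<alpha> x \<in> \<alpha> ` (I \<inter> {r + 1/2<..})}"

definition dual_curtain ::
    "'a set \<Rightarrow> ('a \<Rightarrow> 'a \<Rightarrow> real) \<Rightarrow> real set \<Rightarrow> (real \<Rightarrow> 'a) \<Rightarrow> real \<Rightarrow> 'a set \<Rightarrow> bool" where
  "dual_curtain X d I \<alpha> r h \<longleftrightarrow>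
     geodesic X d I \<alpha> \<and> {r - 1/2..r + 1/2} \<subseteq> interior I \<and> h = curtain X d I \<alpha> r"

definition is_curtain :: "'a set \<Rightarrow> ('a \<Rightarrow> 'a \<Rightarrow> real) \<Rightarrow> 'a set \<Rightarrow> bool" where
  "is_curtain X d h \<longleftrightarrow> (\<exists>I \<alpha> r. dual_curtain X d I \<alpha> r h)"

text \<open>
  A curtain is represented by its underlying subset of \<open>X\<close>. The data \<open>(I, \<alpha>, r)\<close> need not be unique,
  but in a CAT(0) space the two halfspaces are the connected components of \<open>X - h\<close>, so they do not
  depend on these data up to exchanging them.
\<close>
definition separates ::
    "'a set \<Rightarrow> ('a \<Rightarrow> 'a \<Rightarrow> real) \<Rightarrow> 'a set \<Rightarrow> 'a set \<Rightarrow> 'a set \<Rightarrow> bool" where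
  "separates X d h A B \<longleftrightarrow>
     (\<exists>I \<alpha> r. dual_curtain X d I \<alpha> r h \<and>
        (A \<subseteq> minus_halfspace X d I \<alpha> r \<and> B \<subseteq> plus_halfspace X d I \<alpha> r \<or>
         B \<subseteq> minus_halfspace X d I \<alpha> r \<and> A \<subseteq> plus_halfspace X d I \<alpha> r))"

text \<open>
  \<open>J\<close> is a possibly empty or infinite set of consecutive integers. A chain with at most two members
  is subject to no separation condition. Requiring the members of two-element chains to be disjoint
  would only affect \<open>1\<close>-separation and would give a bi-Lipschitz equivalent curtain model.
\<close>
definition curtain_chain :: "'a set \<Rightarrow> ('a \<Rightarrow> 'a \<Rightarrow> real) \<Rightarrow> 'a set set \<Rightarrow> bool" where
  "curtain_chain X d c \<longleftrightarrow>
     (\<forall>h\<in>c. is_curtain X d h) \<and>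
     (\<exists>(J :: int set) h. (\<forall>i\<in>J. \<forall>j\<in>J. {i..j} \<subseteq> J) \<and> bij_betw h J c \<and>
        (\<forall>i. {i - 1, i, i + 1} \<subseteq> J \<longrightarrow> separates X d (h i) (h (i - 1)) (h (i + 1))))"

definition chain_separates ::
    "'a set \<Rightarrow> ('a \<Rightarrow> 'a \<Rightarrow> real) \<Rightarrow> 'a set set \<Rightarrow> 'a set \<Rightarrow> 'a set \<Rightarrow> bool" where
  "chain_separates X d c A B \<longleftrightarrow> (\<forall>h\<in>c. separates X d h A B)"

definition L_separated ::
    "'a set \<Rightarrow> ('a \<Rightarrow> 'a \<Rightarrow> real) \<Rightarrow> nat \<Rightarrow> 'a set \<Rightarrow> 'a set \<Rightarrow> bool" where
  "L_separated X d L h h' \<longleftrightarrow>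
     is_curtain X d h \<and> is_curtain X d h' \<and> h \<inter> h' = {} \<and>
     (\<forall>c. curtain_chain X d c \<longrightarrow> (\<forall>k\<in>c. k \<inter> h \<noteq> {} \<and> k \<inter> h' \<noteq> {}) \<longrightarrow>
        finite c \<and> card c \<le> L)"

definition L_chain :: "'a set \<Rightarrow> ('a \<Rightarrow> 'a \<Rightarrow> real) \<Rightarrow> nat \<Rightarrow> 'a set set \<Rightarrow> bool" where
  "L_chain X d L c \<longleftrightarrow>
     curtain_chain X d c \<and> (\<forall>h\<in>c. \<forall>h'\<in>c. h \<noteq> h' \<longrightarrow> L_separated X d L h h')"

text \<open>
  The empty set is an \<open>L\<close>-chain separating any two points, and in a CAT(0) space an \<open>L\<close>-chain
  separating \<open>x\<close> from \<open>y\<close> has at most \<open>d x y\<close> members, so the maximum is taken over a finite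
  nonempty set.
\<close>
definition d_L :: "'a set \<Rightarrow> ('a \<Rightarrow> 'a \<Rightarrow> real) \<Rightarrow> nat \<Rightarrow> 'a \<Rightarrow> 'a \<Rightarrow> nat" where
  "d_L X d L x y =
     (if x = y then 0
      else 1 + Max {card c | c. L_chain X d L c \<and> chain_separates X d c {x} {y}})"


section \<open>The curtain model\<close>

text \<open>Only the values at indices \<open>L \<ge> 1\<close> matter, hence the index shifts below.\<close>
definition curtain_weights :: "(nat \<Rightarrow> real) \<Rightarrow> bool" where
  "curtain_weights lam \<longleftrightarrow>
     (\<forall>L\<ge>1. 0 < lam L \<and> lam L < 1) \<and>
     summable (\<lambda>n. lam (Suc n)) \<and>
     summable (\<lambda>n. real (Suc n) * lam (Suc n)) \<and>
     summable (\<lambda>n. (real (Suc n))\<^sup>2 * lam (Suc n)) \<and>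
     (\<Sum>n. lam (Suc n)) < (\<Sum>n. real (Suc n) * lam (Suc n)) \<and>
     (\<Sum>n. real (Suc n) * lam (Suc n)) < (\<Sum>n. (real (Suc n))\<^sup>2 * lam (Suc n))"

definition curtain_dist ::
    "'a set \<Rightarrow> ('a \<Rightarrow> 'a \<Rightarrow> real) \<Rightarrow> (nat \<Rightarrow> real) \<Rightarrow> 'a \<Rightarrow> 'a \<Rightarrow> real" where
  "curtain_dist X d lam x y = (\<Sum>n. lam (Suc n) * real (d_L X d (Suc n) x y))"

end

theory Submission
  imports Defs
begin

text \<open>
  An \<open>L\<close>-chain is a bottleneck: if \<open>p\<close> lies on a geodesic between the second and the third of four
  pairwise \<open>L\<close>-separated curtains, then every geodesic crossing the four curtains passes within
  \<open>2 L + 2\<close> of \<open>p\<close>. Since \<open>\<Sum> L \<lambda>\<^sub>L < \<infinity>\<close>, unboundedness of \<open>X\<^sub>D\<close> yields \<open>L\<close>-chains that are long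
  compared with \<open>L\<close>, and co-boundedness of \<open>X\<close> then forces both ends of such a chain to be unbounded.

  Let \<open>w\<close> and \<open>z\<close> be points on the two ends of the chain, very far away. An element \<open>k\<close> of the coarse
  kernel hardly moves them, so \<open>k p\<close> is again a bottleneck between \<open>w\<close> and \<open>z\<close>. Hence the orbit of
  \<open>p\<close> under the coarse kernel lies coarsely on a line, with coordinate \<open>d w\<close>, and the kernel acts on it
  coarsely by translations. Proper discontinuity makes the kernel virtually cyclic. If it is
  infinite, it contains a translation \<open>c\<close>; a point far from its axis would be moved far by a power
  of \<open>c\<close>, so all of \<open>X\<close> is close to the axis, and the translates of one curtain form an \<open>L\<close>-chain
  that makes \<open>D\<close> grow linearly along it.
\<close>

section \<open>Projections in CAT(0) spaces\<close>

text \<open>The obstacle is that the bottleneck constant \<open>4 * L + 8\<close> grows with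
  \<open>L\<close>, while successive curtains are only known to be about one unit apart. Overcoming
  the error takes a number of curtains proportional to \<open>L\<close>, so the existence of long
  chains is not enough if \<open>L\<close> grows along with them. No boundary at infinity is built.
  The points \<open>w\<close> and \<open>z\<close> are found only after a finite set of kernel
  elements has been fixed, and they change with this set; all statements about the orbit hold up to
  multiples of one constant \<open>\<rho>\<close> that does not depend on the choice. No angles are
  used: a right angle is an inequality of Pythagorean type, and a straight angle is equality in the
  triangle inequality. A point outside \<open>A (i + 1)\<close> is only known to lie in
  \<open>B i\<close>, so a case distinction costs one level. Eight levels around a single point
  \<open>p\<close> leave room for all of them. A level consists of five curtains: two
  \<open>L\<close>-separated pairs, and between them the curtain that carries the bottleneck
  point.\<close>

lemma dist_real_2:
  fixes u v :: "real ^ 2"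
  shows "dist u v = sqrt ((u $ 1 - v $ 1)\<^sup>2 + (u $ 2 - v $ 2)\<^sup>2)"
  by (simp add: dist_vec_def L2_set_def sum_2 dist_real_def)

section \<open>Comparison triangles and Stewart's inequality\<close>

lemma comparison_triangle_exists:
  fixes a b c :: real
  assumes "0 \<le> a" "0 \<le> b" "0 \<le> c" "a \<le> b + c" "b \<le> a + c" "c \<le> a + b"
  obtains q r p :: "real ^ 2" where "dist q r = a" "dist q p = b" "dist r p = c"
proof (cases "a = 0")
  case True
  then have "b = c" using assms by auto
  with True that[of "vector [0, 0]" "vector [0, 0]" "vector [b, 0]"] assms show ?thesis
    by (simp add: dist_real_2)
next
  case False
  then have a: "a > 0" using assms by simp
  \<comment> \<open>Law of cosines: with \<open>q\<close> at the origin and \<open>r\<close> at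
    distance \<open>a\<close> on the first axis, this is the first coordinate of
    \<open>p\<close>.\<close>
  define x where "x = (a\<^sup>2 + b\<^sup>2 - c\<^sup>2) / (2 * a)"
  have ax: "2 * a * x = a\<^sup>2 + b\<^sup>2 - c\<^sup>2" using a by (simp add: x_def)
  have "c\<^sup>2 \<le> (a + b)\<^sup>2" using assms by (intro power_mono) auto
  moreover have "(a - b)\<^sup>2 \<le> c\<^sup>2" using assms by (intro abs_le_square_iff[THEN iffD1]) auto
  \<comment> \<open>The triangle inequalities amount to \<open>\<bar>x\<bar> \<le> b\<close>, which
    makes the height \<open>y\<close> real.\<close>
  ultimately have "\<bar>2 * a * x\<bar> \<le> 2 * a * b" unfolding ax by (simp add: abs_le_iff power2_eq_square algebra_simps)
  then have "\<bar>x\<bar> \<le> b" using a by (simp add: abs_mult)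
  then have x2: "x\<^sup>2 \<le> b\<^sup>2" using assms(2) abs_le_square_iff[of x b] by simp
  define y where "y = sqrt (b\<^sup>2 - x\<^sup>2)"
  have y: "y\<^sup>2 = b\<^sup>2 - x\<^sup>2" using x2 by (simp add: y_def)
  have "(a - x)\<^sup>2 + y\<^sup>2 = c\<^sup>2" unfolding y using ax by (simp add: power2_eq_square algebra_simps)
  with that[of "vector [0, 0]" "vector [a, 0]" "vector [x, y]"] assms y a show ?thesis
    by (simp add: dist_real_2)
qed

text \<open>Stewart's theorem, multiplied by \<open>dist q r\<close> so that it also holds for a
  degenerate segment.\<close>

lemma euclidean_stewart:
  fixes p q r :: "'b :: real_inner"
  assumes "x \<in> closed_segment q r"
  shows "dist q r * (dist p x)\<^sup>2 = (dist q r - dist q x) * (dist p q)\<^sup>2 + dist q x * (dist p r)\<^sup>2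
           - dist q x * (dist q r - dist q x) * dist q r"
proof -
  obtain u where u: "0 \<le> u" "u \<le> 1" "x = (1 - u) *\<^sub>R q + u *\<^sub>R r"
    using assms by (auto simp: closed_segment_def)
  have "q - x = u *\<^sub>R (q - r)" using u by (simp add: algebra_simps)
  then have qx: "dist q x = u * dist q r" using u by (simp add: dist_norm)
  have "p - x = (1 - u) *\<^sub>R (p - q) + u *\<^sub>R (p - r)" using u by (simp add: algebra_simps)
  moreover have "q - r = (p - r) - (p - q)" by simp
  ultimately have E: "(dist p x)\<^sup>2 = (1 - u) * (dist p q)\<^sup>2 + u * (dist p r)\<^sup>2 - u * (1 - u) * (dist q r)\<^sup>2"
    unfolding dist_norm power2_norm_eq_inner
    by (simp only: inner_simps inner_commute[of "p - r" "p - q"]) (simp add: algebra_simps power2_eq_square)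
  show ?thesis unfolding qx E by (simp add: algebra_simps power2_eq_square)
qed

locale CAT0 =
  fixes X :: "'a set" and d :: "'a \<Rightarrow> 'a \<Rightarrow> real"
  assumes CAT0: "CAT0_space X d"
begin

sublocale Metric_space X d
  using CAT0 by (simp add: CAT0_space_def)

lemma geodesic_from_to_exists:
  assumes "x \<in> X" "y \<in> X"
  obtains \<alpha> where "geodesic_from_to X d x y \<alpha>"
  using CAT0 assms unfolding CAT0_space_def by blast

text \<open>The comparison inequality is used only here, for a vertex against a point of the
  opposite side. All later uses of nonpositive curvature go through this inequality.\<close>

lemma stewart:
  assumes p: "p \<in> X" and q: "q \<in> X" and r: "r \<in> X"
    and \<alpha>: "geodesic_from_to X d q r \<alpha>" and s: "s \<in> {0..d q r}"
  shows "d q r * (d p (\<alpha> s))\<^sup>2 \<le> (d q r - s) * (d p q)\<^sup>2 + s * (d p r)\<^sup>2 - s * (d q r - s) * d q r"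
proof -
  obtain \<beta> where \<beta>: "geodesic_from_to X d q p \<beta>"
    using geodesic_from_to_exists p q by blast
  obtain q' r' p' :: "real ^ 2" where *: "dist q' r' = d q r" "dist q' p' = d q p" "dist r' p' = d r p"
  proof (rule comparison_triangle_exists[of "d q r" "d q p" "d r p"])
    show "d q r \<le> d q p + d r p" using triangle[of q p r] p q r by (simp add: commute)
    show "d q p \<le> d q r + d r p" using triangle[of q r p] p q r by (simp add: commute)
    show "d r p \<le> d q r + d q p" using triangle[of r q p] p q r by (simp add: commute)
  qed auto
  \<comment> \<open>Default \<open>0\<close> when \<open>q = r\<close>; then \<open>s = 0\<close> as
    well, and \<open>u * d q r = s\<close> still holds.\<close>
  define u where "u = (if d q r = 0 then 0 else s / d q r)"
  define x' where "x' = (1 - u) *\<^sub>R q' + u *\<^sub>R r'"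
  have u: "0 \<le> u" "u \<le> 1" using s by (auto simp: u_def divide_le_eq_1)
  have us: "u * d q r = s" using s by (auto simp: u_def)
  have x': "x' \<in> closed_segment q' r'" using u by (auto simp: x'_def closed_segment_def)
  have "q' - x' = u *\<^sub>R (q' - r')" by (simp add: x'_def algebra_simps)
  then have qx: "dist q' x' = s" using u us * by (simp add: dist_norm)
  have "d (\<alpha> s) (\<beta> (d q p)) \<le> dist x' p'"
    using CAT0 q r p \<alpha> \<beta> * s x' qx unfolding CAT0_space_def
    by (metis atLeastAtMost_iff ends_in_segment(2) nonneg order_refl)
  then have "d p (\<alpha> s) \<le> dist p' x'"
    using \<beta> by (simp add: geodesic_from_to_def commute dist_commute)
  then have "(d p (\<alpha> s))\<^sup>2 \<le> (dist p' x')\<^sup>2" by (intro power_mono) auto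
  then have "d q r * (d p (\<alpha> s))\<^sup>2 \<le> dist q' r' * (dist p' x')\<^sup>2"
    using * by (simp add: mult_left_mono)
  also have "\<dots> = (d q r - s) * (d p q)\<^sup>2 + s * (d p r)\<^sup>2 - s * (d q r - s) * d q r"
    unfolding euclidean_stewart[OF x'] using * qx by (simp add: commute dist_commute)
  finally show ?thesis .
qed

lemma geodesic_in_space: "geodesic X d I \<alpha> \<Longrightarrow> t \<in> I \<Longrightarrow> \<alpha> t \<in> X"
  by (auto simp: geodesic_def)

lemma geodesic_dist: "geodesic X d I \<alpha> \<Longrightarrow> s \<in> I \<Longrightarrow> t \<in> I \<Longrightarrow> d (\<alpha> s) (\<alpha> t) = \<bar>s - t\<bar>"
  by (auto simp: geodesic_def)

lemma geodesic_inj_on: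
  assumes "geodesic X d I \<alpha>"
  shows "inj_on \<alpha> I"
proof (rule inj_onI)
  fix s t assume "s \<in> I" "t \<in> I" "\<alpha> s = \<alpha> t"
  then show "s = t"
    using geodesic_dist[OF assms, of s t] geodesic_in_space[OF assms, of t] by simp
qed

lemma geodesic_subinterval:
  assumes "geodesic X d I \<alpha>" "s \<in> I" "u \<in> I"
  shows "{s..u} \<subseteq> I"
proof -
  have "is_interval I" using assms(1) by (simp add: geodesic_def)
  then show ?thesis using assms(2,3) unfolding is_interval_1 by (meson atLeastAtMost_iff subsetI)
qed

lemma geodesic_stewart:
  assumes \<alpha>: "geodesic X d I \<alpha>" and p: "p \<in> X" and s: "s \<in> I" and u: "u \<in> I" and t: "s \<le> t" "t \<le> u"
  shows "(u - s) * (d p (\<alpha> t))\<^sup>2 \<le>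
    (u - t) * (d p (\<alpha> s))\<^sup>2 + (t - s) * (d p (\<alpha> u))\<^sup>2 - (t - s) * (u - t) * (u - s)"
proof -
  have su: "d (\<alpha> s) (\<alpha> u) = u - s" using geodesic_dist[OF \<alpha> s u] t by simp
  have sub: "{s..u} \<subseteq> I" using geodesic_subinterval[OF \<alpha> s u] .
  have "geodesic X d {0..u - s} (\<lambda>\<tau>. \<alpha> (s + \<tau>))"
    unfolding geodesic_def using sub geodesic_in_space[OF \<alpha>] geodesic_dist[OF \<alpha>]
    by (auto simp: is_interval_cc subset_iff)
  then have "geodesic_from_to X d (\<alpha> s) (\<alpha> u) (\<lambda>\<tau>. \<alpha> (s + \<tau>))"
    unfolding geodesic_from_to_def su by simp
  from stewart[OF p geodesic_in_space[OF \<alpha> s] geodesic_in_space[OF \<alpha> u] this, of "t - s"]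
  show ?thesis unfolding su using t by (simp add: algebra_simps)
qed

section \<open>Nearest points on a geodesic\<close>

lemma dist_Lipschitz: "x \<in> X \<Longrightarrow> y \<in> X \<Longrightarrow> z \<in> X \<Longrightarrow> \<bar>d x y - d x z\<bar> \<le> d y z"
  using triangle[of x y z] triangle[of x z y] by (simp add: commute)

text \<open>Compactness comes from the closed parameter interval \<open>I\<close>, not from
  \<open>X\<close>.\<close>

lemma nearest_point_exists:
  assumes \<alpha>: "geodesic X d I \<alpha>" and x: "x \<in> X" and I: "I \<noteq> {}"
  shows "\<exists>t\<in>I. \<forall>s\<in>I. d x (\<alpha> t) \<le> d x (\<alpha> s)"
proof -
  obtain t1 where t1: "t1 \<in> I" using I by blast
  \<comment> \<open>By the triangle inequality, a parameter at distance more than \<open>r\<close>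
    from \<open>t1\<close> gives a point farther from \<open>x\<close> than
    \<open>\<alpha> t1\<close>.\<close>
  define r where "r = 2 * d x (\<alpha> t1)"
  have Lip: "\<bar>d x (\<alpha> s) - d x (\<alpha> t)\<bar> \<le> \<bar>s - t\<bar>" if "s \<in> I" "t \<in> I" for s t
    using dist_Lipschitz[of x "\<alpha> s" "\<alpha> t"] geodesic_in_space[OF \<alpha>] geodesic_dist[OF \<alpha>] that x by auto
  then have "1-lipschitz_on I (\<lambda>t. d x (\<alpha> t))"
    by (auto simp: lipschitz_on_def dist_real_def)
  then have cont: "continuous_on I (\<lambda>t. d x (\<alpha> t))"
    by (rule lipschitz_on_continuous_on)
  have "closed I" using \<alpha> by (simp add: geodesic_def)
  then have "compact (I \<inter> cball t1 r)" by (simp add: closed_Int_compact)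
  moreover have t1': "t1 \<in> I \<inter> cball t1 r" using t1 by (simp add: r_def)
  ultimately obtain t0 where t0: "t0 \<in> I" "\<forall>s \<in> I \<inter> cball t1 r. d x (\<alpha> t0) \<le> d x (\<alpha> s)"
    using continuous_attains_inf[of "I \<inter> cball t1 r" "\<lambda>t. d x (\<alpha> t)"] continuous_on_subset[OF cont]
    by auto
  have "d x (\<alpha> t0) \<le> d x (\<alpha> s)" if s: "s \<in> I" for s
  proof (cases "s \<in> cball t1 r")
    case True
    then show ?thesis using t0 s by auto
  next
    case False
    then have "\<bar>t1 - s\<bar> > r" by (simp add: dist_real_def)
    moreover have "\<bar>t1 - s\<bar> \<le> d x (\<alpha> t1) + d x (\<alpha> s)"
      using triangle[of "\<alpha> t1" x "\<alpha> s"] geodesic_in_space[OF \<alpha>] geodesic_dist[OF \<alpha> t1 s] t1 s x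
      by (simp add: commute)
    moreover have "d x (\<alpha> t0) \<le> d x (\<alpha> t1)" using t0 t1' by blast
    ultimately show ?thesis by (simp add: r_def)
  qed
  then show ?thesis using t0 by blast
qed

text \<open>The projection is recorded by its parameter, so that curtains and halfspaces become
  preimages of intervals under a real function. The choice is unique by
  \<open>nearest_unique\<close>.\<close>

definition nearest :: "real set \<Rightarrow> (real \<Rightarrow> 'a) \<Rightarrow> 'a \<Rightarrow> real" where
  "nearest I \<alpha> x = (SOME t. t \<in> I \<and> (\<forall>s\<in>I. d x (\<alpha> t) \<le> d x (\<alpha> s)))"

lemma nearest:
  assumes "geodesic X d I \<alpha>" "x \<in> X" "I \<noteq> {}"
  shows nearest_in: "nearest I \<alpha> x \<in> I"
    and nearest_le: "s \<in> I \<Longrightarrow> d x (\<alpha> (nearest I \<alpha> x)) \<le> d x (\<alpha> s)"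
proof -
  have "\<exists>t. t \<in> I \<and> (\<forall>s\<in>I. d x (\<alpha> t) \<le> d x (\<alpha> s))"
    using nearest_point_exists[OF assms] by blast
  from someI_ex[OF this] show "nearest I \<alpha> x \<in> I" "s \<in> I \<Longrightarrow> d x (\<alpha> (nearest I \<alpha> x)) \<le> d x (\<alpha> s)"
    unfolding nearest_def by auto
qed

text \<open>The angle at the foot is at least right. Stewart's inequality at the point
  \<open>m\<close>, a fraction \<open>\<mu>\<close> of the way from \<open>t0\<close> to
  \<open>t\<close>, compared with minimality at \<open>t0\<close>, gives the claim with a factor
  \<open>1 - \<mu>\<close>; then \<open>\<mu>\<close> tends to 0.\<close>

lemma nearest_pythagoras:
  assumes \<alpha>: "geodesic X d I \<alpha>" and x: "x \<in> X" and t0: "t0 \<in> I" and t: "t \<in> I"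
    and min: "\<And>s. s \<in> I \<Longrightarrow> d x (\<alpha> t0) \<le> d x (\<alpha> s)"
  shows "(d x (\<alpha> t0))\<^sup>2 + (t - t0)\<^sup>2 \<le> (d x (\<alpha> t))\<^sup>2"
proof (cases "t = t0")
  case False
  define f where "f = (\<lambda>t. (d x (\<alpha> t))\<^sup>2)"
  have key: "(1 - \<mu>) * (t - t0)\<^sup>2 \<le> f t - f t0" if l: "0 < \<mu>" "\<mu> < 1" for \<mu>
  proof -
    define m where "m = t0 + \<mu> * (t - t0)"
    have btw: "t0 \<le> m \<and> m \<le> t \<or> t \<le> m \<and> m \<le> t0"
    proof (cases "t0 \<le> t")
      case True
      then have "0 \<le> \<mu> * (t - t0)" "\<mu> * (t - t0) \<le> t - t0"
        using l mult_right_mono[of \<mu> 1 "t - t0"] by auto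
      then show ?thesis by (simp add: m_def)
    next
      case False
      then have "0 \<le> \<mu> * (t0 - t)" "\<mu> * (t0 - t) \<le> t0 - t"
        using l mult_right_mono[of \<mu> 1 "t0 - t"] by auto
      then show ?thesis by (simp add: m_def algebra_simps)
    qed
    have mI: "m \<in> I" using btw geodesic_subinterval[OF \<alpha> t0 t] geodesic_subinterval[OF \<alpha> t t0]
      by auto
    then have "f t0 \<le> f m" unfolding f_def using min by (intro power_mono) auto
    have tm: "t - m = (1 - \<mu>) * (t - t0)" "m - t0 = \<mu> * (t - t0)" "t0 - m = - \<mu> * (t - t0)"
      by (auto simp: m_def algebra_simps)
    have "\<bar>t - t0\<bar> * f m \<le> \<bar>t - t0\<bar> * ((1 - \<mu>) * f t0 + \<mu> * f t - \<mu> * (1 - \<mu>) * (t - t0)\<^sup>2)"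
    proof (cases "t0 \<le> t")
      case True
      then have "t0 \<le> m" "m \<le> t" using btw False by auto
      from geodesic_stewart[OF \<alpha> x t0 t this] True show ?thesis
        unfolding f_def tm by (simp add: algebra_simps power2_eq_square)
    next
      case F: False
      then have "t \<le> m" "m \<le> t0" using btw by auto
      from geodesic_stewart[OF \<alpha> x t t0 this] F show ?thesis
        unfolding f_def tm minus_diff_eq[of t m, symmetric] by (simp add: algebra_simps power2_eq_square)
    qed
    then have "f m \<le> (1 - \<mu>) * f t0 + \<mu> * f t - \<mu> * (1 - \<mu>) * (t - t0)\<^sup>2"
      using False by simp
    with \<open>f t0 \<le> f m\<close> have "0 \<le> \<mu> * (f t - f t0 - (1 - \<mu>) * (t - t0)\<^sup>2)"
      by (simp add: algebra_simps)
    then show ?thesis using l by (simp add: zero_le_mult_iff)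
  qed
  have "((\<lambda>\<mu>. (1 - \<mu>) * (t - t0)\<^sup>2) \<longlongrightarrow> (1 - 0) * (t - t0)\<^sup>2) (at_right 0)"
    by (intro tendsto_intros)
  moreover have "\<forall>\<^sub>F \<mu> in at_right 0. (1 - \<mu>) * (t - t0)\<^sup>2 \<le> f t - f t0"
    using eventually_at_right_less[of 0] eventually_at_right_real[of 0 1]
    by (auto elim!: eventually_mono intro: key)
  ultimately have "(1 - 0) * (t - t0)\<^sup>2 \<le> f t - f t0"
    by (intro tendsto_upperbound) auto
  then show ?thesis by (simp add: f_def)
qed simp

lemma nearest_unique:
  assumes \<alpha>: "geodesic X d I \<alpha>" and x: "x \<in> X" and t0: "t0 \<in> I"
    and min: "\<And>s. s \<in> I \<Longrightarrow> d x (\<alpha> t0) \<le> d x (\<alpha> s)"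
  shows "nearest I \<alpha> x = t0"
proof -
  have I: "I \<noteq> {}" using t0 by blast
  note n = nearest_in[OF \<alpha> x I]
  have "d x (\<alpha> (nearest I \<alpha> x)) = d x (\<alpha> t0)"
    using min[OF n] nearest_le[OF \<alpha> x I t0] by simp
  then have "(nearest I \<alpha> x - t0)\<^sup>2 \<le> 0"
    using nearest_pythagoras[OF \<alpha> x t0 n min] by simp
  then show ?thesis by simp
qed

lemma geodesic_proj_eq:
  assumes \<alpha>: "geodesic X d I \<alpha>" and x: "x \<in> X" and I: "I \<noteq> {}"
  shows "geodesic_proj d I \<alpha> x = \<alpha> (nearest I \<alpha> x)"
  unfolding geodesic_proj_def
proof (rule the_equality)
  show "\<alpha> (nearest I \<alpha> x) \<in> \<alpha> ` I \<and> (\<forall>q\<in>\<alpha> ` I. d x (\<alpha> (nearest I \<alpha> x)) \<le> d x q)"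
    using nearest[OF assms] by blast
next
  fix p assume p: "p \<in> \<alpha> ` I \<and> (\<forall>q\<in>\<alpha> ` I. d x p \<le> d x q)"
  then obtain t where "t \<in> I" "p = \<alpha> t" by blast
  with p nearest_unique[OF \<alpha> x, of t] show "p = \<alpha> (nearest I \<alpha> x)" by auto
qed

lemma geodesic_proj_in_image_iff:
  assumes \<alpha>: "geodesic X d I \<alpha>" and x: "x \<in> X" and "I \<noteq> {}" and J: "J \<subseteq> I"
  shows "geodesic_proj d I \<alpha> x \<in> \<alpha> ` J \<longleftrightarrow> nearest I \<alpha> x \<in> J"
  unfolding geodesic_proj_eq[OF assms(1-3)]
  using inj_on_image_mem_iff[OF geodesic_inj_on[OF \<alpha>] nearest_in[OF assms(1-3)] J] .

text \<open>The CN inequality of Bruhat and Tits, cleared of denominators.\<close>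

lemma midpoint_inequality:
  assumes "x \<in> X" "y \<in> X"
  obtains m where "m \<in> X" "\<And>p. p \<in> X \<Longrightarrow> 4 * (d p m)\<^sup>2 \<le> 2 * (d p x)\<^sup>2 + 2 * (d p y)\<^sup>2 - (d x y)\<^sup>2"
proof (cases "x = y")
  case True
  then show ?thesis using that[of x] assms by simp
next
  case False
  then have pos: "d x y > 0" using assms by simp
  obtain \<alpha> where \<alpha>: "geodesic_from_to X d x y \<alpha>" using geodesic_from_to_exists[OF assms] .
  let ?m = "\<alpha> (d x y / 2)"
  have "?m \<in> X" using \<alpha> by (auto simp: geodesic_from_to_def geodesic_def)
  moreover have "4 * (d p ?m)\<^sup>2 \<le> 2 * (d p x)\<^sup>2 + 2 * (d p y)\<^sup>2 - (d x y)\<^sup>2" if p: "p \<in> X" for p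
  proof -
    have "d x y * (4 * (d p ?m)\<^sup>2) \<le> d x y * (2 * (d p x)\<^sup>2 + 2 * (d p y)\<^sup>2 - (d x y)\<^sup>2)"
      using stewart[OF p assms \<alpha>, of "d x y / 2"] by (simp add: algebra_simps power2_eq_square)
    then show ?thesis using pos by simp
  qed
  ultimately show ?thesis using that by blast
qed

text \<open>The pairs \<open>x\<close>, \<open>q\<close> and \<open>y\<close>, \<open>p\<close> are
  the diagonals. The CN inequality for the midpoint \<open>m\<close> of the first diagonal is
  applied at \<open>y\<close> and at \<open>p\<close>, and \<open>d y p\<close> is bounded by the
  path through \<open>m\<close>.\<close>

lemma quadrilateral_inequality:
  assumes "x \<in> X" "y \<in> X" "p \<in> X" "q \<in> X"
  shows "(d x q)\<^sup>2 + (d y p)\<^sup>2 \<le> (d x p)\<^sup>2 + (d y q)\<^sup>2 + (d x y)\<^sup>2 + (d p q)\<^sup>2"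
proof -
  obtain m where m: "m \<in> X"
      "\<And>z. z \<in> X \<Longrightarrow> 4 * (d z m)\<^sup>2 \<le> 2 * (d z x)\<^sup>2 + 2 * (d z q)\<^sup>2 - (d x q)\<^sup>2"
    using midpoint_inequality[OF assms(1,4)] by blast
  have "(d y p)\<^sup>2 \<le> (d y m + d p m)\<^sup>2"
    using triangle[of y m p] assms m(1) by (intro power_mono) (auto simp: commute)
  also have "\<dots> \<le> 2 * (d y m)\<^sup>2 + 2 * (d p m)\<^sup>2"
    using sum_squares_bound[of "d y m" "d p m"] by (simp add: power2_sum)
  finally show ?thesis
    using m(2)[OF assms(2)] m(2)[OF assms(3)] by (simp add: commute)
qed

text \<open>The two points and their feet form a quadrilateral. The Pythagorean inequalities bound
  its diagonals from below, the quadrilateral inequality bounds them from above.\<close>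

lemma nearest_Lipschitz:
  assumes \<alpha>: "geodesic X d I \<alpha>" and I: "I \<noteq> {}" and x: "x \<in> X" and y: "y \<in> X"
  shows "\<bar>nearest I \<alpha> x - nearest I \<alpha> y\<bar> \<le> d x y"
proof -
  let ?s = "nearest I \<alpha> x" and ?t = "nearest I \<alpha> y"
  note s = nearest_in[OF \<alpha> x I] and t = nearest_in[OF \<alpha> y I]
  have "(d x (\<alpha> ?s))\<^sup>2 + (?t - ?s)\<^sup>2 \<le> (d x (\<alpha> ?t))\<^sup>2"
    by (rule nearest_pythagoras[OF \<alpha> x s t nearest_le[OF \<alpha> x I]])
  moreover have "(d y (\<alpha> ?t))\<^sup>2 + (?s - ?t)\<^sup>2 \<le> (d y (\<alpha> ?s))\<^sup>2"
    by (rule nearest_pythagoras[OF \<alpha> y t s nearest_le[OF \<alpha> y I]])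
  moreover have "(d (\<alpha> ?s) (\<alpha> ?t))\<^sup>2 = (?s - ?t)\<^sup>2"
    using geodesic_dist[OF \<alpha> s t] by simp
  ultimately have "(?s - ?t)\<^sup>2 \<le> (d x y)\<^sup>2"
    using quadrilateral_inequality[OF x y geodesic_in_space[OF \<alpha> s] geodesic_in_space[OF \<alpha> t]]
    by (simp add: power2_commute[of ?t ?s])
  then show ?thesis using abs_le_square_iff[of "?s - ?t" "d x y"] by simp
qed

text \<open>Convexity of the squared distance along the geodesic, combined with the foot being
  strictly nearer than \<open>\<alpha> s\<close>.\<close>

lemma dist_decreasing_towards_nearest:
  assumes \<alpha>: "geodesic X d I \<alpha>" and x: "x \<in> X" and s: "s \<in> I" and t: "s < t" "t \<le> nearest I \<alpha> x"
  shows "d x (\<alpha> t) < d x (\<alpha> s)"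
proof -
  let ?u = "nearest I \<alpha> x"
  have I: "I \<noteq> {}" using s by blast
  note u = nearest_in[OF \<alpha> x I]
  have "(d x (\<alpha> ?u))\<^sup>2 + (s - ?u)\<^sup>2 \<le> (d x (\<alpha> s))\<^sup>2"
    by (rule nearest_pythagoras[OF \<alpha> x u s nearest_le[OF \<alpha> x I]])
  moreover have "(s - ?u)\<^sup>2 > 0" using t by simp
  ultimately have "(d x (\<alpha> ?u))\<^sup>2 < (d x (\<alpha> s))\<^sup>2" by linarith
  then have "(t - s) * (d x (\<alpha> ?u))\<^sup>2 < (t - s) * (d x (\<alpha> s))\<^sup>2"
    using t by simp
  moreover have "(t - s) * (?u - t) * (?u - s) \<ge> 0" using t by simp
  moreover have "(?u - s) * (d x (\<alpha> t))\<^sup>2 \<le>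
      (?u - t) * (d x (\<alpha> s))\<^sup>2 + (t - s) * (d x (\<alpha> ?u))\<^sup>2 - (t - s) * (?u - t) * (?u - s)"
    using geodesic_stewart[OF \<alpha> x s u] t by simp
  ultimately have "(?u - s) * (d x (\<alpha> t))\<^sup>2 < (?u - s) * (d x (\<alpha> s))\<^sup>2"
    by (simp add: algebra_simps)
  then have "(d x (\<alpha> t))\<^sup>2 < (d x (\<alpha> s))\<^sup>2" using t by (simp add: mult_less_cancel_left_pos)
  then show ?thesis by (simp add: power2_less_imp_less)
qed

end

section \<open>Curtains and their halfspaces\<close>

context CAT0 begin

definition Lip1 :: "('a \<Rightarrow> real) \<Rightarrow> bool" where
  "Lip1 E \<longleftrightarrow> (\<forall>x\<in>X. \<forall>y\<in>X. \<bar>E x - E y\<bar> \<le> d x y)"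

text \<open>A substitute for connectedness: it is inherited by star-shaped sets, and the only continuous
  functions that matter below are the projections onto geodesics, which are 1-Lipschitz.\<close>
definition Lip_connected :: "'a set \<Rightarrow> bool" where
  "Lip_connected S \<longleftrightarrow> (\<forall>E. Lip1 E \<longrightarrow> connected (E ` S))"

lemma Lip1_uminus: "Lip1 E \<Longrightarrow> Lip1 (\<lambda>x. - E x)"
  unfolding Lip1_def by (simp add: abs_minus_commute)

lemma Lip1D: "Lip1 E \<Longrightarrow> x \<in> X \<Longrightarrow> y \<in> X \<Longrightarrow> \<bar>E x - E y\<bar> \<le> d x y"
  by (simp add: Lip1_def)

lemma Lip_connected_geodesic:
  assumes \<alpha>: "geodesic X d I \<alpha>" and J: "J \<subseteq> I" "is_interval J"
  shows "Lip_connected (\<alpha> ` J)"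
  unfolding Lip_connected_def
proof (intro allI impI)
  fix E assume E: "Lip1 E"
  have "\<bar>E (\<alpha> s) - E (\<alpha> t)\<bar> \<le> \<bar>s - t\<bar>" if "s \<in> J" "t \<in> J" for s t
  proof -
    have "s \<in> I" "t \<in> I" using that J by auto
    then show ?thesis
      using Lip1D[OF E geodesic_in_space[OF \<alpha>] geodesic_in_space[OF \<alpha>]] geodesic_dist[OF \<alpha>] by metis
  qed
  then have "1-lipschitz_on J (\<lambda>t. E (\<alpha> t))"
    by (auto simp: lipschitz_on_def dist_real_def)
  then have "continuous_on J (\<lambda>t. E (\<alpha> t))"
    by (rule lipschitz_on_continuous_on)
  moreover have "connected J" using J is_interval_connected by blast
  ultimately have "connected ((\<lambda>t. E (\<alpha> t)) ` J)"
    by (rule connected_continuous_image)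
  then show "connected (E ` \<alpha> ` J)" by (simp add: image_image)
qed

lemma Lip_connected_star:
  assumes P: "P \<subseteq> S" "Lip_connected P"
    and T: "\<And>x. x \<in> S \<Longrightarrow> x \<in> T x" "\<And>x. x \<in> S \<Longrightarrow> T x \<subseteq> S" "\<And>x. x \<in> S \<Longrightarrow> Lip_connected (T x)"
      "\<And>x. x \<in> S \<Longrightarrow> T x \<inter> P \<noteq> {}"
  shows "Lip_connected S"
  unfolding Lip_connected_def
proof (intro allI impI)
  fix E assume E: "Lip1 E"
  show "connected (E ` S)"
  proof (cases "S = {}")
    case False
    then obtain x where "x \<in> S" by blast
    with T(4) obtain p where p: "p \<in> P" by blast
    have eq: "E ` S = \<Union> ((\<lambda>x. E ` T x \<union> E ` P) ` S)"
      using P(1) T(1,2) by blast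
    show ?thesis unfolding eq
    proof (rule connected_Union)
      fix s assume "s \<in> (\<lambda>x. E ` T x \<union> E ` P) ` S"
      then obtain x where x: "x \<in> S" "s = E ` T x \<union> E ` P" by blast
      have "connected (E ` T x)" "connected (E ` P)"
        using P(2) T(3)[OF x(1)] E by (auto simp: Lip_connected_def)
      then show "connected s" unfolding x(2)
        by (rule connected_Un) (use T(4)[OF x(1)] in blast)
    next
      show "\<Inter> ((\<lambda>x. E ` T x \<union> E ` P) ` S) \<noteq> {}"
        using p by blast
    qed
  qed simp
qed

lemma nearest_on_geodesic:
  assumes \<alpha>: "geodesic X d I \<alpha>" and t: "t \<in> I"
  shows "nearest I \<alpha> (\<alpha> t) = t"
  by (rule nearest_unique[OF \<alpha> geodesic_in_space[OF \<alpha> t] t]) (use geodesic_in_space[OF \<alpha>] t in auto)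

text \<open>If another point of the geodesic were nearer to \<open>z\<close>, the path through
  \<open>z\<close> would bring it nearer to \<open>x\<close> than the foot. This makes the fibres of
  the projection star-shaped.\<close>

lemma nearest_between:
  assumes \<alpha>: "geodesic X d I \<alpha>" and I: "I \<noteq> {}" and x: "x \<in> X" and z: "z \<in> X"
    and btw: "d x z + d z (\<alpha> (nearest I \<alpha> x)) = d x (\<alpha> (nearest I \<alpha> x))"
  shows "nearest I \<alpha> z = nearest I \<alpha> x"
proof (rule nearest_unique[OF \<alpha> z nearest_in[OF \<alpha> x I]])
  fix s assume s: "s \<in> I"
  then have "d x (\<alpha> (nearest I \<alpha> x)) \<le> d x (\<alpha> s)" using nearest_le[OF \<alpha> x I] by blast
  also have "\<dots> \<le> d x z + d z (\<alpha> s)" using triangle[OF x z geodesic_in_space[OF \<alpha> s]] .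
  finally show "d z (\<alpha> (nearest I \<alpha> x)) \<le> d z (\<alpha> s)" using btw by simp
qed

lemma geodesic_from_to_between:
  assumes "geodesic_from_to X d x y \<gamma>" "s \<in> {0..d x y}"
  shows "\<gamma> s \<in> X" "d x (\<gamma> s) = s" "d (\<gamma> s) y = d x y - s"
proof -
  have \<gamma>: "geodesic X d {0..d x y} \<gamma>" "\<gamma> 0 = x" "\<gamma> (d x y) = y"
    using assms(1) by (auto simp: geodesic_from_to_def)
  then show "\<gamma> s \<in> X" "d x (\<gamma> s) = s" "d (\<gamma> s) y = d x y - s"
    using geodesic_in_space[OF \<gamma>(1) assms(2)] geodesic_dist[OF \<gamma>(1), of 0 s]
      geodesic_dist[OF \<gamma>(1), of s "d x y"] assms(2) by auto
qed

lemma geodesic_from_to_Lip_connected: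
  assumes "geodesic_from_to X d x y \<gamma>"
  shows "Lip_connected (\<gamma> ` {0..d x y})"
  using assms Lip_connected_geodesic[of "{0..d x y}" \<gamma> "{0..d x y}"]
  by (simp add: geodesic_from_to_def is_interval_cc)

text \<open>Every point is joined to its foot inside its own fibre, by
  \<open>nearest_between\<close>, so the set is star-shaped over the image of
  \<open>J\<close>.\<close>

lemma Lip_connected_nearest:
  assumes \<alpha>: "geodesic X d I \<alpha>" and I: "I \<noteq> {}" and J: "J \<subseteq> I" "is_interval J"
  shows "Lip_connected {x \<in> X. nearest I \<alpha> x \<in> J}"
proof -
  have "\<forall>x\<in>X. \<exists>\<gamma>. geodesic_from_to X d x (\<alpha> (nearest I \<alpha> x)) \<gamma>"
    using geodesic_from_to_exists geodesic_in_space[OF \<alpha> nearest_in[OF \<alpha> _ I]] by meson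
  then obtain \<gamma> where \<gamma>: "\<And>x. x \<in> X \<Longrightarrow> geodesic_from_to X d x (\<alpha> (nearest I \<alpha> x)) (\<gamma> x)"
    by metis
  define T where "T x = \<gamma> x ` {0..d x (\<alpha> (nearest I \<alpha> x))}" for x
  show ?thesis
  proof (rule Lip_connected_star[where P = "\<alpha> ` J" and T = T])
    show "\<alpha> ` J \<subseteq> {x \<in> X. nearest I \<alpha> x \<in> J}"
      using J nearest_on_geodesic[OF \<alpha>] geodesic_in_space[OF \<alpha>] by auto
    show "Lip_connected (\<alpha> ` J)" by (rule Lip_connected_geodesic[OF \<alpha> J])
  next
    fix x assume "x \<in> {x \<in> X. nearest I \<alpha> x \<in> J}"
    then have x: "x \<in> X" "nearest I \<alpha> x \<in> J" by auto
    note g = \<gamma>[OF x(1)]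
    have 0: "\<gamma> x 0 = x" "\<gamma> x (d x (\<alpha> (nearest I \<alpha> x))) = \<alpha> (nearest I \<alpha> x)"
      using g by (auto simp: geodesic_from_to_def)
    show "x \<in> T x" unfolding T_def using 0 by (intro image_eqI[of _ _ 0]) auto
    have "\<alpha> (nearest I \<alpha> x) \<in> T x" unfolding T_def
      using 0 by (intro image_eqI[of _ _ "d x (\<alpha> (nearest I \<alpha> x))"]) auto
    then show "T x \<inter> \<alpha> ` J \<noteq> {}" using x(2) by blast
    show "Lip_connected (T x)" unfolding T_def by (rule geodesic_from_to_Lip_connected[OF g])
    show "T x \<subseteq> {x \<in> X. nearest I \<alpha> x \<in> J}"
    proof
      fix z assume "z \<in> T x"
      then obtain s where s: "s \<in> {0..d x (\<alpha> (nearest I \<alpha> x))}" "z = \<gamma> x s"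
        by (auto simp: T_def)
      note b = geodesic_from_to_between[OF g s(1), folded s(2)]
      then have "nearest I \<alpha> z = nearest I \<alpha> x"
        by (intro nearest_between[OF \<alpha> I x(1)]) auto
      then show "z \<in> {x \<in> X. nearest I \<alpha> x \<in> J}" using x b by simp
    qed
  qed
qed

lemma Lip_connected_IVT:
  assumes "Lip_connected S" "Lip1 E" "x \<in> S" "y \<in> S" "E x \<le> v" "v \<le> E y"
  obtains z where "z \<in> S" "E z = v"
proof -
  have "connected (E ` S)" using assms by (simp add: Lip_connected_def)
  then have "v \<in> E ` S"
    using assms(3-6) connected_contains_Icc[of "E ` S" "E x" "E y"] by auto
  then show ?thesis using that by blast
qed

text \<open>Lying on a geodesic is recorded as equality in the triangle inequality, so that no
  parametrisation has to be carried along.\<close>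

lemma Lip1_IVT:
  assumes "Lip1 E" "x \<in> X" "y \<in> X" "E x \<le> v" "v \<le> E y"
  obtains z where "z \<in> X" "d x z + d z y = d x y" "E z = v"
proof -
  obtain \<gamma> where \<gamma>: "geodesic_from_to X d x y \<gamma>" using geodesic_from_to_exists assms by blast
  have 0: "\<gamma> 0 = x" "\<gamma> (d x y) = y" using \<gamma> by (auto simp: geodesic_from_to_def)
  have "x \<in> \<gamma> ` {0..d x y}" using 0 by (intro image_eqI[of _ _ 0]) auto
  moreover have "y \<in> \<gamma> ` {0..d x y}" using 0 by (intro image_eqI[of _ _ "d x y"]) auto
  ultimately obtain z where z: "z \<in> \<gamma> ` {0..d x y}" "E z = v"
    using Lip_connected_IVT[OF geodesic_from_to_Lip_connected[OF \<gamma>] assms(1) _ _ assms(4,5)] by blast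
  then obtain s where "s \<in> {0..d x y}" "z = \<gamma> s" by blast
  with geodesic_from_to_between[OF \<gamma>] show ?thesis using that[OF _ _ z(2)] by auto
qed

definition halves :: "'a set \<Rightarrow> 'a set \<Rightarrow> 'a set \<Rightarrow> bool" where
  "halves h M P \<longleftrightarrow> (\<exists>I \<alpha> r. dual_curtain X d I \<alpha> r h \<and>
     (M = minus_halfspace X d I \<alpha> r \<and> P = plus_halfspace X d I \<alpha> r \<or>
      M = plus_halfspace X d I \<alpha> r \<and> P = minus_halfspace X d I \<alpha> r))"

lemma halves_swap: "halves h M P \<Longrightarrow> halves h P M"
  unfolding halves_def by blast

lemma is_curtain_iff: "is_curtain X d h \<longleftrightarrow> (\<exists>M P. halves h M P)"
  unfolding is_curtain_def halves_def by blast

lemma separates_iff: "separates X d h A B \<longleftrightarrow> (\<exists>M P. halves h M P \<and> A \<subseteq> M \<and> B \<subseteq> P)"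
  unfolding separates_def halves_def by blast

lemma dual_curtain_interval:
  assumes "dual_curtain X d I \<alpha> r h"
  shows "geodesic X d I \<alpha>" "{r - 1/2..r + 1/2} \<subseteq> I" "is_interval I" "I \<noteq> {}"
proof -
  show "geodesic X d I \<alpha>" "is_interval I" using assms by (auto simp: dual_curtain_def geodesic_def)
  show sub: "{r - 1/2..r + 1/2} \<subseteq> I"
    using assms interior_subset[of I] by (auto simp: dual_curtain_def)
  then have "r \<in> I" by auto
  then show "I \<noteq> {}" by blast
qed

lemma dual_curtain_sets:
  assumes h: "dual_curtain X d I \<alpha> r h"
  shows "h = {x \<in> X. nearest I \<alpha> x \<in> {r - 1/2..r + 1/2}}"
    and "minus_halfspace X d I \<alpha> r = {x \<in> X. nearest I \<alpha> x \<in> I \<inter> {..<r - 1/2}}"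
    and "plus_halfspace X d I \<alpha> r = {x \<in> X. nearest I \<alpha> x \<in> I \<inter> {r + 1/2<..}}"
proof -
  note I = dual_curtain_interval[OF h]
  have "h = curtain X d I \<alpha> r" using h by (simp add: dual_curtain_def)
  then show "h = {x \<in> X. nearest I \<alpha> x \<in> {r - 1/2..r + 1/2}}"
    unfolding curtain_def using geodesic_proj_in_image_iff[OF I(1) _ I(4)] I(2) by blast
  show "minus_halfspace X d I \<alpha> r = {x \<in> X. nearest I \<alpha> x \<in> I \<inter> {..<r - 1/2}}"
    unfolding minus_halfspace_def using geodesic_proj_in_image_iff[OF I(1) _ I(4)] by blast
  show "plus_halfspace X d I \<alpha> r = {x \<in> X. nearest I \<alpha> x \<in> I \<inter> {r + 1/2<..}}"
    unfolding plus_halfspace_def using geodesic_proj_in_image_iff[OF I(1) _ I(4)] by blast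
qed

text \<open>\<open>F\<close> is the parameter of the projection minus \<open>r\<close>, with the
  sign reversed for the other labelling. It turns a curtain into a band of width 1 of a 1-Lipschitz
  function.\<close>

lemma halves_function:
  assumes "halves h M P"
  obtains F where "Lip1 F" "h = {x \<in> X. \<bar>F x\<bar> \<le> 1/2}" "M = {x \<in> X. F x < - 1/2}" "P = {x \<in> X. F x > 1/2}"
proof -
  obtain I \<alpha> r where h: "dual_curtain X d I \<alpha> r h"
    and MP: "M = minus_halfspace X d I \<alpha> r \<and> P = plus_halfspace X d I \<alpha> r \<or>
      M = plus_halfspace X d I \<alpha> r \<and> P = minus_halfspace X d I \<alpha> r"
    using assms unfolding halves_def by blast
  note I = dual_curtain_interval[OF h]
  note n = nearest_in[OF I(1) _ I(4)]
  define F where "F x = nearest I \<alpha> x - r" for x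
  have F: "Lip1 F" unfolding Lip1_def F_def using nearest_Lipschitz[OF I(1,4)] by simp
  have h': "h = {x \<in> X. \<bar>F x\<bar> \<le> 1/2}"
    unfolding dual_curtain_sets(1)[OF h] F_def by (simp only: atLeastAtMost_iff abs_diff_le_iff)
  have m: "minus_halfspace X d I \<alpha> r = {x \<in> X. F x < - 1/2}"
    unfolding dual_curtain_sets(2)[OF h] F_def using n by auto
  have p: "plus_halfspace X d I \<alpha> r = {x \<in> X. F x > 1/2}"
    unfolding dual_curtain_sets(3)[OF h] F_def using n by auto
  from MP show ?thesis
  proof
    assume "M = minus_halfspace X d I \<alpha> r \<and> P = plus_halfspace X d I \<alpha> r"
    then show ?thesis using that[OF F h'] m p by simp
  next
    assume MP: "M = plus_halfspace X d I \<alpha> r \<and> P = minus_halfspace X d I \<alpha> r"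
    have "h = {x \<in> X. \<bar>- F x\<bar> \<le> 1/2}" using h' by simp
    moreover have "M = {x \<in> X. - F x < - 1/2}" "P = {x \<in> X. - F x > 1/2}"
      unfolding conjunct1[OF MP] conjunct2[OF MP] m p by auto
    ultimately show ?thesis using that[OF Lip1_uminus[OF F]] by simp
  qed
qed

lemma halves_partition:
  assumes "halves h M P"
  shows "M \<union> h \<union> P = X" "M \<inter> h = {}" "M \<inter> P = {}" "P \<inter> h = {}" "h \<subseteq> X" "M \<subseteq> X" "P \<subseteq> X"
proof -
  obtain F where "Lip1 F" and F: "h = {x \<in> X. \<bar>F x\<bar> \<le> 1/2}" "M = {x \<in> X. F x < - 1/2}" "P = {x \<in> X. F x > 1/2}"
    by (rule halves_function[OF assms])
  show "M \<union> h \<union> P = X" "M \<inter> h = {}" "M \<inter> P = {}" "P \<inter> h = {}" "h \<subseteq> X" "M \<subseteq> X" "P \<subseteq> X"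
    unfolding F by auto
qed

lemma dual_curtain_connected:
  assumes h: "dual_curtain X d I \<alpha> r h"
  shows "Lip_connected h"
    and "Lip_connected (minus_halfspace X d I \<alpha> r)" "Lip_connected (plus_halfspace X d I \<alpha> r)"
    and "Lip_connected (minus_halfspace X d I \<alpha> r \<union> h)" "Lip_connected (plus_halfspace X d I \<alpha> r \<union> h)"
    and "h \<noteq> {}" "minus_halfspace X d I \<alpha> r \<noteq> {}" "plus_halfspace X d I \<alpha> r \<noteq> {}"
proof -
  note I = dual_curtain_interval[OF h]
  note n = nearest_in[OF I(1) _ I(4)]
  note c = Lip_connected_nearest[OF I(1,4)]
  note s = dual_curtain_sets[OF h]
  have J: "is_interval (I \<inter> J)" if "is_interval J" for J :: "real set"
    using I(3) that by (rule is_interval_Int)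
  show "Lip_connected h" unfolding s(1) by (rule c[OF I(2) is_interval_cc])
  show "Lip_connected (minus_halfspace X d I \<alpha> r)"
    unfolding s(2) by (rule c) (auto intro: J is_interval_io)
  show "Lip_connected (plus_halfspace X d I \<alpha> r)"
    unfolding s(3) by (rule c) (auto intro: J is_interval_oi)
  have "minus_halfspace X d I \<alpha> r \<union> h = {x \<in> X. nearest I \<alpha> x \<in> I \<inter> {..r + 1/2}}"
    unfolding s(2) unfolding s(1) using n by fastforce
  then show "Lip_connected (minus_halfspace X d I \<alpha> r \<union> h)"
    by (metis c J is_interval_ic inf_le1)
  have "plus_halfspace X d I \<alpha> r \<union> h = {x \<in> X. nearest I \<alpha> x \<in> I \<inter> {r - 1/2..}}"
    unfolding s(3) unfolding s(1) using n by fastforce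
  then show "Lip_connected (plus_halfspace X d I \<alpha> r \<union> h)"
    by (metis c J is_interval_ci inf_le1)
  have r: "r \<in> I" using I(2) by auto
  then show "h \<noteq> {}" unfolding s(1) using nearest_on_geodesic[OF I(1) r] geodesic_in_space[OF I(1) r] by force
  \<comment> \<open>The interior condition on curtains leaves points of the geodesic beyond either
    edge.\<close>
  have *: "r - 1/2 \<in> interior I" "r + 1/2 \<in> interior I" using h by (auto simp: dual_curtain_def)
  from *(1) obtain e where e: "e > 0" "cball (r - 1/2) e \<subseteq> I" by (auto simp: mem_interior_cball)
  have t: "r - 1/2 - e \<in> I" using e by (auto simp: dist_real_def subset_iff)
  have "\<alpha> (r - 1/2 - e) \<in> minus_halfspace X d I \<alpha> r"
    unfolding s(2) using e nearest_on_geodesic[OF I(1) t] geodesic_in_space[OF I(1) t] t by simp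
  then show "minus_halfspace X d I \<alpha> r \<noteq> {}" by blast
  from *(2) obtain e where e: "e > 0" "cball (r + 1/2) e \<subseteq> I" by (auto simp: mem_interior_cball)
  have t: "r + 1/2 + e \<in> I" using e by (auto simp: dist_real_def subset_iff)
  have "\<alpha> (r + 1/2 + e) \<in> plus_halfspace X d I \<alpha> r"
    unfolding s(3) using e nearest_on_geodesic[OF I(1) t] geodesic_in_space[OF I(1) t] t by simp
  then show "plus_halfspace X d I \<alpha> r \<noteq> {}" by blast
qed

lemma halves_connected:
  assumes "halves h M P"
  shows "Lip_connected h" "Lip_connected M" "Lip_connected P" "Lip_connected (M \<union> h)" "Lip_connected (P \<union> h)"
    and "h \<noteq> {}" "M \<noteq> {}" "P \<noteq> {}"
proof -
  obtain I \<alpha> r where h: "dual_curtain X d I \<alpha> r h"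
    and MP: "M = minus_halfspace X d I \<alpha> r \<and> P = plus_halfspace X d I \<alpha> r \<or>
      M = plus_halfspace X d I \<alpha> r \<and> P = minus_halfspace X d I \<alpha> r"
    using assms unfolding halves_def by blast
  from MP show "Lip_connected h" "Lip_connected M" "Lip_connected P" "Lip_connected (M \<union> h)"
    "Lip_connected (P \<union> h)" "h \<noteq> {}" "M \<noteq> {}" "P \<noteq> {}"
    using dual_curtain_connected[OF h] by auto
qed

text \<open>With points on both sides, a connected set would attain \<open>F = 0\<close> and so meet
  \<open>h\<close>.\<close>

lemma halves_avoid:
  assumes h: "halves h M P" and S: "Lip_connected S" "S \<subseteq> X" "S \<inter> h = {}"
  shows "S \<subseteq> M \<or> S \<subseteq> P"
proof (rule ccontr)
  obtain F where F: "Lip1 F" "h = {x \<in> X. \<bar>F x\<bar> \<le> 1/2}" "M = {x \<in> X. F x < - 1/2}" "P = {x \<in> X. F x > 1/2}"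
    by (rule halves_function[OF h])
  assume "\<not> ?thesis"
  then obtain x y where xy: "x \<in> S" "x \<notin> M" "y \<in> S" "y \<notin> P" by blast
  then have X: "x \<in> X" "y \<in> X" and "x \<notin> h" "y \<notin> h" using S by auto
  then have "\<not> \<bar>F x\<bar> \<le> 1/2" "\<not> \<bar>F y\<bar> \<le> 1/2" "\<not> F x < - 1/2" "\<not> F y > 1/2"
    using F(2-4) xy by simp_all
  then have "F y \<le> 0" "0 \<le> F x" by linarith+
  from Lip_connected_IVT[OF S(1) F(1) xy(3,1) this] obtain z where "z \<in> S" "F z = 0" by blast
  then have "z \<in> S \<inter> h" using F(2) S(2) by auto
  with S(3) show False by blast
qed

lemma halves_avoid':
  assumes "halves h M P" "Lip_connected S" "S \<subseteq> X" "S \<inter> h = {}" "x \<in> S" "x \<in> M"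
  shows "S \<subseteq> M"
  using halves_avoid[OF assms(1-4)] halves_partition(3)[OF assms(1)] assms(5,6) by blast

lemma halves_meet:
  assumes "halves h M P" "Lip_connected S" "S \<subseteq> X" "x \<in> S" "x \<in> M" "y \<in> S" "y \<in> P"
  shows "S \<inter> h \<noteq> {}"
  using halves_avoid[OF assms(1-3)] halves_partition(3)[OF assms(1)] assms(4-7) by blast

text \<open>\<open>M'\<close> and \<open>P'\<close> are connected and avoid \<open>h\<close>, so
  each lies in \<open>M\<close> or in \<open>P\<close>, and together they fill the complement of
  \<open>h\<close>. This justifies representing a curtain by its underlying set.\<close>

lemma halves_unique:
  assumes h: "halves h M P" and h': "halves h M' P'"
  shows "M' = M \<and> P' = P \<or> M' = P \<and> P' = M"
proof -
  note p = halves_partition[OF h] and p' = halves_partition[OF h']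
  have "M' \<subseteq> M \<or> M' \<subseteq> P" "P' \<subseteq> M \<or> P' \<subseteq> P"
    using halves_avoid[OF h halves_connected(2)[OF h']] halves_avoid[OF h halves_connected(3)[OF h']] p' by auto
  moreover have "M' \<union> P' = X - h" "M \<union> P = X - h" using p(1-4) p'(1-4) by blast+
  moreover have "M \<noteq> {}" "P \<noteq> {}" using halves_connected[OF h] by auto
  ultimately show ?thesis using p(3) p'(3) by blast
qed

lemma halves_crossing:
  assumes h: "halves h M P" and x: "x \<in> M" and y: "y \<in> P"
  obtains z where "z \<in> h" "d x z + d z y = d x y" "1 \<le> d z y"
proof -
  obtain F where F: "Lip1 F" "h = {x \<in> X. \<bar>F x\<bar> \<le> 1/2}" "M = {x \<in> X. F x < - 1/2}" "P = {x \<in> X. F x > 1/2}"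
    by (rule halves_function[OF h])
  have X: "x \<in> X" "y \<in> X" using x y F by auto
  \<comment> \<open>The near edge of the band: its full width 1 still lies between \<open>z\<close>
    and \<open>y\<close>.\<close>
  obtain z where z: "z \<in> X" "d x z + d z y = d x y" "F z = - 1/2"
    using Lip1_IVT[OF F(1) X, of "- 1/2"] x y F by auto
  moreover have "1 \<le> d z y" using Lip1D[OF F(1) z(1) X(2)] z(3) y F(4) by auto
  moreover have "z \<in> h" unfolding F(2) using z by simp
  ultimately show ?thesis using that by blast
qed

section \<open>Isometries carry curtains, chains and separation along\<close>

definition isometry :: "('a \<Rightarrow> 'a) \<Rightarrow> bool" where
  "isometry g \<longleftrightarrow> bij_betw g X X \<and> (\<forall>x\<in>X. \<forall>y\<in>X. d (g x) (g y) = d x y)"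

lemma isometryD:
  assumes "isometry g"
  shows "x \<in> X \<Longrightarrow> g x \<in> X" "x \<in> X \<Longrightarrow> y \<in> X \<Longrightarrow> d (g x) (g y) = d x y" "g ` X = X" "inj_on g X"
  using assms unfolding isometry_def bij_betw_def by auto

lemma isometry_inv:
  assumes "isometry g"
  shows "isometry (inv_into X g)"
proof -
  note g = isometryD[OF assms]
  have "bij_betw (inv_into X g) X X" using assms unfolding isometry_def by (blast intro: bij_betw_inv_into)
  moreover have "d (inv_into X g x) (inv_into X g y) = d x y" if "x \<in> X" "y \<in> X" for x y
    using g(2)[of "inv_into X g x" "inv_into X g y"] g(3) that
    by (metis f_inv_into_f inv_into_into)
  ultimately show ?thesis unfolding isometry_def by blast
qed

lemma dual_curtain_isometry:
  assumes g: "isometry g" and h: "dual_curtain X d I \<alpha> r h"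
  shows "dual_curtain X d I (g \<circ> \<alpha>) r (g ` h)"
    and "minus_halfspace X d I (g \<circ> \<alpha>) r = g ` minus_halfspace X d I \<alpha> r"
    and "plus_halfspace X d I (g \<circ> \<alpha>) r = g ` plus_halfspace X d I \<alpha> r"
proof -
  note g' = isometryD[OF g]
  note I = dual_curtain_interval[OF h]
  have geo: "geodesic X d I (g \<circ> \<alpha>)"
    using I(1) g' unfolding geodesic_def by (auto simp: Pi_iff)
  have near: "nearest I (g \<circ> \<alpha>) (g x) = nearest I \<alpha> x" if x: "x \<in> X" for x
  proof (rule nearest_unique[OF geo g'(1)[OF x] nearest_in[OF I(1) x I(4)]])
    fix s assume s: "s \<in> I"
    then show "d (g x) ((g \<circ> \<alpha>) (nearest I \<alpha> x)) \<le> d (g x) ((g \<circ> \<alpha>) s)"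
      using nearest_le[OF I(1) x I(4) s] g'(2) x geodesic_in_space[OF I(1)] nearest_in[OF I(1) x I(4)]
      by simp
  qed
  have img: "g ` {x \<in> X. nearest I \<alpha> x \<in> J} = {x \<in> X. nearest I (g \<circ> \<alpha>) x \<in> J}" for J
  proof (intro equalityI subsetI)
    fix y assume y: "y \<in> {x \<in> X. nearest I (g \<circ> \<alpha>) x \<in> J}"
    then obtain x where "x \<in> X" "y = g x" using g'(3) by blast
    with y near show "y \<in> g ` {x \<in> X. nearest I \<alpha> x \<in> J}" by auto
  qed (use near g'(1) in auto)
  let ?c = "curtain X d I (g \<circ> \<alpha>) r"
  have c: "dual_curtain X d I (g \<circ> \<alpha>) r ?c" using h geo by (simp add: dual_curtain_def)
  have "g ` h = ?c" unfolding dual_curtain_sets(1)[OF c] unfolding dual_curtain_sets(1)[OF h] by (rule img)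
  then show "dual_curtain X d I (g \<circ> \<alpha>) r (g ` h)" using c by simp
  show "minus_halfspace X d I (g \<circ> \<alpha>) r = g ` minus_halfspace X d I \<alpha> r"
    unfolding dual_curtain_sets[OF c] dual_curtain_sets[OF h] img ..
  show "plus_halfspace X d I (g \<circ> \<alpha>) r = g ` plus_halfspace X d I \<alpha> r"
    unfolding dual_curtain_sets[OF c] dual_curtain_sets[OF h] img ..
qed

lemma halves_isometry:
  assumes "isometry g" "halves h M P"
  shows "halves (g ` h) (g ` M) (g ` P)"
  using assms(2) dual_curtain_isometry[OF assms(1)] unfolding halves_def by metis

lemma separates_isometry:
  assumes "isometry g" "separates X d h A B"
  shows "separates X d (g ` h) (g ` A) (g ` B)"
  using assms halves_isometry unfolding separates_iff by (meson image_mono)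

lemma curtain_chain_subset: "curtain_chain X d c \<Longrightarrow> k \<in> c \<Longrightarrow> k \<subseteq> X"
  unfolding curtain_chain_def is_curtain_iff using halves_partition(5) by blast

lemma inj_on_isometry_image:
  assumes "isometry g" "\<And>k. k \<in> c \<Longrightarrow> k \<subseteq> X"
  shows "inj_on ((`) g) c"
  using assms(2) isometryD(4)[OF assms(1)] by (intro inj_onI) (metis inj_on_image_eq_iff)

lemma curtain_chain_isometry:
  assumes g: "isometry g" and c: "curtain_chain X d c"
  shows "curtain_chain X d ((`) g ` c)"
proof -
  obtain J h where J: "\<forall>i\<in>J. \<forall>j\<in>J. {i..j} \<subseteq> J" "bij_betw h (J :: int set) c"
      "\<forall>i. {i - 1, i, i + 1} \<subseteq> J \<longrightarrow> separates X d (h i) (h (i - 1)) (h (i + 1))"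
    using c unfolding curtain_chain_def by blast
  have "inj_on ((`) g) c" by (rule inj_on_isometry_image[OF g curtain_chain_subset[OF c]])
  then have "bij_betw ((`) g \<circ> h) J ((`) g ` c)"
    using J(2) by (intro bij_betw_trans) (auto simp: bij_betw_def)
  moreover have "\<forall>i. {i - 1, i, i + 1} \<subseteq> J \<longrightarrow>
      separates X d (((`) g \<circ> h) i) (((`) g \<circ> h) (i - 1)) (((`) g \<circ> h) (i + 1))"
    using J(3) separates_isometry[OF g] by auto
  moreover have "\<forall>k\<in>(`) g ` c. is_curtain X d k"
    using c halves_isometry[OF g] unfolding curtain_chain_def is_curtain_iff by blast
  ultimately show ?thesis using J(1) unfolding curtain_chain_def by blast
qed

text \<open>A chain meeting both images is pulled back by the inverse isometry.\<close>

lemma L_separated_isometry: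
  assumes g: "isometry g" and h: "L_separated X d L h h'"
  shows "L_separated X d L (g ` h) (g ` h')"
  unfolding L_separated_def
proof (intro conjI allI impI)
  note g' = isometryD[OF g]
  have sub: "h \<subseteq> X" "h' \<subseteq> X" and disj: "h \<inter> h' = {}"
    using h unfolding L_separated_def is_curtain_iff using halves_partition(5) by blast+
  show "is_curtain X d (g ` h)" "is_curtain X d (g ` h')"
    using h halves_isometry[OF g] unfolding L_separated_def is_curtain_iff by blast+
  show "g ` h \<inter> g ` h' = {}"
    using inj_on_image_Int[OF g'(4) sub] disj by simp
  fix c assume c: "curtain_chain X d c" "\<forall>k\<in>c. k \<inter> g ` h \<noteq> {} \<and> k \<inter> g ` h' \<noteq> {}"
  let ?g = "inv_into X g"
  have meet: "?g ` k \<inter> A \<noteq> {}" if "k \<inter> g ` A \<noteq> {}" "A \<subseteq> X" for k A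
    using that inv_into_f_f[OF g'(4)] by fastforce
  have "\<forall>k\<in>(`) ?g ` c. k \<inter> h \<noteq> {} \<and> k \<inter> h' \<noteq> {}"
    using meet[OF _ sub(1)] meet[OF _ sub(2)] c(2) by simp
  with curtain_chain_isometry[OF isometry_inv[OF g] c(1)] h
  have "finite ((`) ?g ` c)" "card ((`) ?g ` c) \<le> L" unfolding L_separated_def by blast+
  moreover have "inj_on ((`) ?g) c"
    by (rule inj_on_isometry_image[OF isometry_inv[OF g] curtain_chain_subset[OF c(1)]])
  ultimately show "finite c" "card c \<le> L" by (auto simp: finite_image_iff card_image)
qed

end

section \<open>Chains\<close>

context CAT0 begin

text \<open>The working form of a chain, with consistently oriented sides. For two members it is
  stronger than \<open>curtain_chain\<close>, which then demands nothing; hence the three members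
  required in \<open>chain_nested\<close>.\<close>

definition nested :: "nat \<Rightarrow> (nat \<Rightarrow> 'a set) \<Rightarrow> (nat \<Rightarrow> 'a set) \<Rightarrow> (nat \<Rightarrow> 'a set) \<Rightarrow> bool" where
  "nested n h M P \<longleftrightarrow> (\<forall>i<n. halves (h i) (M i) (P i)) \<and> (\<forall>i. Suc i < n \<longrightarrow> M i \<union> h i \<subseteq> M (Suc i))"

lemma nested_halves: "nested n h M P \<Longrightarrow> i < n \<Longrightarrow> halves (h i) (M i) (P i)"
  by (simp add: nested_def)

lemma halves_compl:
  assumes "halves h M P"
  shows "M \<union> h = X - P" "P \<union> h = X - M"
  using halves_partition[OF assms] by auto

lemma nested_minus:
  assumes n: "nested n h M P" and ij: "i < j" "j < n"
  shows "M i \<union> h i \<subseteq> M j"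
  using ij
proof (induction j)
  case (Suc j)
  have step: "M j \<union> h j \<subseteq> M (Suc j)" using n Suc.prems by (simp add: nested_def)
  show ?case
  proof (cases "i = j")
    case False
    then have "M i \<union> h i \<subseteq> M j" using Suc by simp
    then show ?thesis using step by blast
  qed (use step in simp)
qed simp

lemma nested_plus:
  assumes n: "nested n h M P" and ij: "i < j" "j < n"
  shows "P j \<union> h j \<subseteq> P i"
proof
  have hi: "halves (h i) (M i) (P i)" and hj: "halves (h j) (M j) (P j)"
    using nested_halves[OF n] ij by auto
  note pj = halves_partition[OF hj]
  fix x assume x: "x \<in> P j \<union> h j"
  then have "x \<notin> M j" "x \<in> X" using pj(2,3,5,7) by blast+
  then show "x \<in> P i" using nested_minus[OF assms] halves_partition(1)[OF hi] by blast
qed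

lemma nested_disjoint:
  assumes n: "nested n h M P" and ij: "i < j" "j < n"
  shows "h i \<inter> h j = {}"
  using nested_minus[OF assms] halves_partition(2)[OF nested_halves[OF n ij(2)]] by blast

lemma nested_inj: "nested n h M P \<Longrightarrow> inj_on h {..<n}"
proof (rule linorder_inj_onI')
  fix i j assume n: "nested n h M P" and ij: "i \<in> {..<n}" "j \<in> {..<n}" "i < j"
  then have "h i \<inter> h j = {}" "h i \<noteq> {}"
    using nested_disjoint[OF n] halves_connected(6)[OF nested_halves[OF n]] by auto
  then show "h i \<noteq> h j" by blast
qed

text \<open>Every curtain that is crossed adds its width 1: \<open>halves_crossing\<close> leaves
  distance 1 between the crossing point and \<open>y\<close>.\<close>

lemma nested_dist:
  assumes n: "nested n h M P" and ij: "i \<le> j" "j < n" and x: "x \<in> M i" and y: "y \<in> P j"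
  shows "real (j - i) + 1 \<le> d x y"
  using ij y
proof (induction j arbitrary: y rule: dec_induct)
  case base
  have h: "halves (h i) (M i) (P i)" using nested_halves[OF n] base by simp
  have X: "x \<in> X" "y \<in> X" using halves_partition[OF h] x base by auto
  obtain z where z: "z \<in> h i" "d x z + d z y = d x y" "1 \<le> d z y"
    using halves_crossing[OF h x base(2)] by blast
  then have "1 \<le> d x y" using nonneg[of x z] by linarith
  then show ?case by simp
next
  case (step j)
  have h: "halves (h (Suc j)) (M (Suc j)) (P (Suc j))" using nested_halves[OF n] step by simp
  have "x \<in> M (Suc j)" using nested_minus[OF n, of i "Suc j"] step x by auto
  from halves_crossing[OF h this step.prems(2)]
  obtain z where z: "z \<in> h (Suc j)" "d x z + d z y = d x y" "1 \<le> d z y" by blast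
  have "z \<in> P j" using nested_plus[OF n, of j "Suc j"] z step.prems by auto
  then have "real (j - i) + 1 \<le> d x z" using step by auto
  then show ?case using z step.hyps by (simp add: of_nat_diff)
qed

lemma nested_mono: "nested n h M P \<Longrightarrow> m \<le> n \<Longrightarrow> nested m h M P"
  by (simp add: nested_def)

lemma nested_shift: "nested n h M P \<Longrightarrow> nested (n - m) (\<lambda>i. h (i + m)) (\<lambda>i. M (i + m)) (\<lambda>i. P (i + m))"
  by (simp add: nested_def)

lemma nested_chain:
  assumes n: "nested n h M P"
  shows "curtain_chain X d (h ` {..<n})"
  unfolding curtain_chain_def
proof (intro conjI exI allI impI)
  show "\<forall>k\<in>h ` {..<n}. is_curtain X d k"
    using nested_halves[OF n] unfolding is_curtain_iff by blast
  show "\<forall>i\<in>{0..<int n}. \<forall>j\<in>{0..<int n}. {i..j} \<subseteq> {0..<int n}" by auto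
  have "bij_betw nat {0..<int n} {..<n}"
    by (rule bij_betw_byWitness[of _ int]) auto
  then have "bij_betw (h \<circ> nat) {0..<int n} (h ` {..<n})"
    using nested_inj[OF n] by (intro bij_betw_trans) (auto simp: bij_betw_def)
  then show "bij_betw (h \<circ> nat) {0..<int n} (h ` {..<n})" .
next
  fix i :: int assume "{i - 1, i, i + 1} \<subseteq> {0..<int n}"
  then have i: "nat (i - 1) < nat i" "nat i < nat (i + 1)" "nat i < n" "nat (i + 1) < n" by auto
  then have "h (nat (i - 1)) \<subseteq> M (nat i)" "h (nat (i + 1)) \<subseteq> P (nat i)"
    using nested_minus[OF n i(1,3)] nested_plus[OF n i(2,4)] by auto
  then show "separates X d ((h \<circ> nat) i) ((h \<circ> nat) (i - 1)) ((h \<circ> nat) (i + 1))"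
    unfolding separates_iff using nested_halves[OF n i(3)] by auto
qed

lemma small_chain:
  assumes "finite c" "card c \<le> 2" "\<forall>k\<in>c. is_curtain X d k"
  shows "curtain_chain X d c"
proof -
  obtain f where f: "bij_betw f {0..<card c} c"
    using ex_bij_betw_nat_finite[OF assms(1)] by blast
  show ?thesis unfolding curtain_chain_def
  proof (intro conjI exI allI impI)
    show "\<forall>k\<in>c. is_curtain X d k" by fact
    show "\<forall>i\<in>{0..<int (card c)}. \<forall>j\<in>{0..<int (card c)}. {i..j} \<subseteq> {0..<int (card c)}" by auto
    have "bij_betw nat {0..<int (card c)} {0..<card c}"
      by (rule bij_betw_byWitness[of _ int]) auto
    then show "bij_betw (f \<circ> nat) {0..<int (card c)} c"
      using f by (rule bij_betw_trans)
    fix i :: int assume "{i - 1, i, i + 1} \<subseteq> {0..<int (card c)}"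
    then show "separates X d ((f \<circ> nat) i) ((f \<circ> nat) (i - 1)) ((f \<circ> nat) (i + 1))"
      using assms(2) by simp
  qed
qed

text \<open>A chain says something only about its interior members. For \<open>i = 0\<close> the
  inclusion is therefore obtained from member 1, whose closed side towards \<open>v\<close> avoids
  \<open>h 0\<close>; for later \<open>i\<close> the closed side of member \<open>i\<close> towards
  \<open>u\<close> avoids the next curtain.\<close>

lemma nested_of_upwards:
  assumes n: "3 \<le> n" and h: "\<And>i. i < n \<Longrightarrow> halves (h i) (M i) (P i)"
    and u: "\<And>i. i < n \<Longrightarrow> u \<in> M i" and v: "\<And>i. i < n \<Longrightarrow> v \<in> P i"
    and up: "\<And>i. i + 2 < n \<Longrightarrow> h i \<subseteq> M (i + 1) \<and> h (i + 2) \<subseteq> P (i + 1)"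
  shows "nested n h M P"
  unfolding nested_def
proof (intro conjI allI impI)
  fix i assume i: "Suc i < n"
  have hi: "halves (h i) (M i) (P i)" and hs: "halves (h (Suc i)) (M (Suc i)) (P (Suc i))"
    using h i by auto
  note p = halves_partition[OF hi] and ps = halves_partition[OF hs]
  show "M i \<union> h i \<subseteq> M (Suc i)"
  proof (cases i)
    case 0
    then have "h i \<subseteq> M (Suc i)" using up[of 0] n by auto
    then have "(P (Suc i) \<union> h (Suc i)) \<inter> h i = {}" using ps(2,3) by blast
    then have "P (Suc i) \<union> h (Suc i) \<subseteq> P i"
      using halves_avoid'[OF halves_swap[OF hi] halves_connected(5)[OF hs], of v] ps v i by auto
    then show ?thesis using halves_compl[OF hi] halves_compl[OF hs] by blast
  next
    case (Suc j)
    then have "h (Suc i) \<subseteq> P i" using up[of j] i by auto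
    then have "(M i \<union> h i) \<inter> h (Suc i) = {}" using p(3,4) by blast
    then show ?thesis
      using halves_avoid'[OF hs halves_connected(4)[OF hi], of u] p u i by auto
  qed
qed (use h in auto)

text \<open>\<open>separates\<close> is symmetric, so each interior member may read upwards or
  downwards relative to the sides facing \<open>u\<close> and \<open>v\<close>. Neighbours cannot
  disagree: each would lie on the \<open>v\<close> side of the other, or each on the
  \<open>u\<close> side, although both separate \<open>u\<close> from \<open>v\<close>.\<close>

lemma nested_or_reverse:
  assumes n: "3 \<le> n" and h: "\<And>i. i < n \<Longrightarrow> halves (h i) (M i) (P i)"
    and u: "\<And>i. i < n \<Longrightarrow> u \<in> M i" and v: "\<And>i. i < n \<Longrightarrow> v \<in> P i"
    and sep: "\<And>i. i + 2 < n \<Longrightarrow> separates X d (h (i + 1)) (h i) (h (i + 2))"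
  shows "nested n h M P \<or> nested n (\<lambda>i. h (n - 1 - i)) (\<lambda>i. M (n - 1 - i)) (\<lambda>i. P (n - 1 - i))"
proof -
  define up where "up i \<longleftrightarrow> h i \<subseteq> M (i + 1) \<and> h (i + 2) \<subseteq> P (i + 1)" for i
  define down where "down i \<longleftrightarrow> h i \<subseteq> P (i + 1) \<and> h (i + 2) \<subseteq> M (i + 1)" for i
  have alt: "up i \<or> down i" if i: "i + 2 < n" for i
  proof -
    obtain M' P' where "halves (h (i + 1)) M' P'" "h i \<subseteq> M'" "h (i + 2) \<subseteq> P'"
      using sep[OF i] unfolding separates_iff by blast
    then show ?thesis
      using halves_unique[of "h (i + 1)" "M (i + 1)" "P (i + 1)" M' P'] h[of "i + 1"] i
      unfolding up_def down_def by auto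
  qed
  have consistent: "\<not> (up i \<and> down (Suc i)) \<and> \<not> (down i \<and> up (Suc i))" if i: "i + 3 < n" for i
  proof -
    have h1: "halves (h (i + 1)) (M (i + 1)) (P (i + 1))" and h2: "halves (h (i + 2)) (M (i + 2)) (P (i + 2))"
      using h i by auto
    note p1 = halves_partition[OF h1] and p2 = halves_partition[OF h2]
    have uv: "u \<in> M (i + 1)" "u \<in> M (i + 2)" "v \<in> P (i + 1)" "v \<in> P (i + 2)" using u v i by auto
    have ne: "h (i + 1) \<noteq> {}" using halves_connected(6)[OF h1] .
    have "\<not> (up i \<and> down (Suc i))"
    proof
      assume "up i \<and> down (Suc i)"
      then have *: "h (i + 2) \<subseteq> P (i + 1)" "h (i + 1) \<subseteq> P (i + 2)" by (auto simp: up_def down_def)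
      have "(M (i + 1) \<union> h (i + 1)) \<inter> h (i + 2) = {}" using *(1) p1(2-4) by blast
      then have "M (i + 1) \<union> h (i + 1) \<subseteq> M (i + 2)"
        using halves_avoid'[OF h2 halves_connected(4)[OF h1], of u] p1 uv by auto
      then show False using *(2) p2(3) ne by blast
    qed
    moreover have "\<not> (down i \<and> up (Suc i))"
    proof
      assume "down i \<and> up (Suc i)"
      then have *: "h (i + 2) \<subseteq> M (i + 1)" "h (i + 1) \<subseteq> M (i + 2)" by (auto simp: up_def down_def)
      have "(P (i + 1) \<union> h (i + 1)) \<inter> h (i + 2) = {}" using *(1) p1(2-4) by blast
      then have "P (i + 1) \<union> h (i + 1) \<subseteq> P (i + 2)"
        using halves_avoid'[OF halves_swap[OF h2] halves_connected(5)[OF h1], of v] p1 uv by auto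
      then show False using *(2) p2(3) ne by blast
    qed
    ultimately show ?thesis by blast
  qed
  have all: "up i = up 0" if "i + 2 < n" for i
    using that
  proof (induction i)
    case (Suc i)
    then have "i + 3 < n" "i + 2 < n" by auto
    then show ?case using Suc consistent[of i] alt[of i] alt[of "Suc i"] by auto
  qed simp
  show ?thesis
  proof (cases "up 0")
    case True
    then have "nested n h M P"
      by (intro nested_of_upwards[OF n h u v]) (use all in \<open>auto simp: up_def\<close>)
    then show ?thesis ..
  next
    case False
    have "nested n (\<lambda>i. h (n - 1 - i)) (\<lambda>i. M (n - 1 - i)) (\<lambda>i. P (n - 1 - i))"
    proof (rule nested_of_upwards[OF n, where u = u and v = v])
      fix i assume i: "i + 2 < n"
      define k where "k = n - 3 - i"
      have k: "k + 2 < n" "n - 1 - i = k + 2" "n - 1 - (i + 1) = k + 1" "n - 1 - (i + 2) = k"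
        using i by (auto simp: k_def)
      have "down k" using False alt[OF k(1)] all[OF k(1)] by blast
      then show "h (n - 1 - i) \<subseteq> M (n - 1 - (i + 1)) \<and> h (n - 1 - (i + 2)) \<subseteq> P (n - 1 - (i + 1))"
        unfolding k by (simp add: down_def)
    qed (use h u v in auto)
    then show ?thesis ..
  qed
qed

lemma chain_nested:
  assumes c: "curtain_chain X d c" and n: "3 \<le> card c" and sep: "chain_separates X d c {u} {v}"
  obtains h M P where "nested (card c) h M P" "h ` {..<card c} = c"
    "\<forall>i<card c. u \<in> M i \<and> v \<in> P i"
proof -
  let ?n = "card c"
  obtain J h where J: "\<forall>i\<in>J. \<forall>j\<in>J. {i..j} \<subseteq> J" and h: "bij_betw h (J :: int set) c"
      and hs: "\<forall>i. {i - 1, i, i + 1} \<subseteq> J \<longrightarrow> separates X d (h i) (h (i - 1)) (h (i + 1))"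
    using c unfolding curtain_chain_def by blast
  have cJ: "card J = ?n" using bij_betw_same_card[OF h] .
  \<comment> \<open>An infinite set has \<open>card\<close> equal to 0, so three members also give
    finiteness.\<close>
  then have fin: "finite J" "J \<noteq> {}" using n by (auto intro: card_ge_0_finite)
  define a where "a = Min J"
  have Jeq: "J = {a..Max J}"
  proof
    show "J \<subseteq> {a..Max J}" using fin by (auto simp: a_def)
    show "{a..Max J} \<subseteq> J" using J Min_in[OF fin] Max_in[OF fin] unfolding a_def by blast
  qed
  have "a \<le> Max J" using fin unfolding a_def by simp
  moreover have "card J = nat (Max J - a + 1)" by (subst Jeq) simp
  ultimately have Max: "Max J = a + int ?n - 1" using cJ by simp
  define g where "g i = h (a + int i)" for i :: nat
  have gJ: "a + int i \<in> J" if "i < ?n" for i using that Jeq Max by simp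
  have img: "g ` {..<?n} = c"
  proof -
    have "(\<lambda>i. a + int i) ` {..<?n} = J"
    proof
      show "J \<subseteq> (\<lambda>i. a + int i) ` {..<?n}"
      proof
        fix x assume "x \<in> J"
        then have "a \<le> x" "x \<le> a + int ?n - 1" using Jeq Max by auto
        then show "x \<in> (\<lambda>i. a + int i) ` {..<?n}" by (intro image_eqI[of _ _ "nat (x - a)"]) auto
      qed
    qed (use gJ in auto)
    then have "h ` (\<lambda>i. a + int i) ` {..<?n} = c" using h by (simp add: bij_betw_def)
    then show ?thesis by (simp add: g_def image_image)
  qed
  have "\<exists>M P. i < ?n \<longrightarrow> halves (g i) M P \<and> u \<in> M \<and> v \<in> P" for i
  proof (cases "i < ?n")
    case True
    then have "g i \<in> c" using img by blast
    then show ?thesis using sep unfolding chain_separates_def separates_iff by blast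
  qed simp
  then obtain M P where MP: "\<And>i. i < ?n \<Longrightarrow> halves (g i) (M i) (P i) \<and> u \<in> M i \<and> v \<in> P i"
    by metis
  have "separates X d (g (i + 1)) (g i) (g (i + 2))" if i: "i + 2 < ?n" for i
  proof -
    have "{a + int (i + 1) - 1, a + int (i + 1), a + int (i + 1) + 1} \<subseteq> J"
      using gJ[of i] gJ[of "i + 1"] gJ[of "i + 2"] i by (auto simp: algebra_simps)
    with hs have "separates X d (h (a + int (i + 1))) (h (a + int (i + 1) - 1)) (h (a + int (i + 1) + 1))" by blast
    then show ?thesis by (simp add: g_def algebra_simps)
  qed
  from nested_or_reverse[OF n, of g M P u v, OF _ _ _ this] MP
  have "nested ?n g M P \<or> nested ?n (\<lambda>i. g (?n - 1 - i)) (\<lambda>i. M (?n - 1 - i)) (\<lambda>i. P (?n - 1 - i))"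
    by blast
  then show ?thesis
  proof
    assume "nested ?n g M P"
    then show ?thesis using that img MP by blast
  next
    assume r: "nested ?n (\<lambda>i. g (?n - 1 - i)) (\<lambda>i. M (?n - 1 - i)) (\<lambda>i. P (?n - 1 - i))"
    have "(\<lambda>i. ?n - 1 - i) ` {..<?n} = {..<?n}"
    proof
      show "{..<?n} \<subseteq> (\<lambda>i. ?n - 1 - i) ` {..<?n}"
      proof
        fix i assume "i \<in> {..<?n}"
        then show "i \<in> (\<lambda>i. ?n - 1 - i) ` {..<?n}" by (intro image_eqI[of _ _ "?n - 1 - i"]) auto
      qed
    qed auto
    then have "(\<lambda>i. g (?n - 1 - i)) ` {..<?n} = c" using img by (metis image_image)
    then show ?thesis using that[OF r] MP by auto
  qed
qed

text \<open>The slack 2 pays for chains of at most two members, on which no separation condition is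
  imposed; infinite chains have \<open>card\<close> 0.\<close>

lemma chain_card_le:
  assumes c: "curtain_chain X d c" and sep: "chain_separates X d c {u} {v}"
  shows "real (card c) \<le> d u v + 2"
proof (cases "3 \<le> card c")
  case True
  obtain h M P where n: "nested (card c) h M P" and "h ` {..<card c} = c"
    and uv: "\<forall>i<card c. u \<in> M i \<and> v \<in> P i"
    by (rule chain_nested[OF c True sep])
  have "real (card c - 1 - 0) + 1 \<le> d u v"
    by (rule nested_dist[OF n]) (use uv True in auto)
  then show ?thesis using True by simp
next
  case False
  then have "real (card c) \<le> 2" by simp
  then show ?thesis using nonneg[of u v] by linarith
qed

section \<open>The functions \<open>d_L\<close>: attained maxima and the triangle inequality\<close>

lemma finite_chain_cards:
  "finite {card c | c. L_chain X d L c \<and> chain_separates X d c {u} {v}}"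
proof (rule finite_subset)
  show "{card c | c. L_chain X d L c \<and> chain_separates X d c {u} {v}} \<subseteq> {..nat \<lfloor>d u v + 2\<rfloor>}"
  proof
    fix k assume "k \<in> {card c | c. L_chain X d L c \<and> chain_separates X d c {u} {v}}"
    then have "real k \<le> d u v + 2" using chain_card_le unfolding L_chain_def by blast
    then show "k \<in> {..nat \<lfloor>d u v + 2\<rfloor>}" unfolding atMost_iff by (rule le_nat_floor)
  qed
qed simp

lemma d_L_ge:
  assumes "L_chain X d L c" "chain_separates X d c {u} {v}" "u \<noteq> v"
  shows "card c + 1 \<le> d_L X d L u v"
proof -
  have "card c \<le> Max {card c | c. L_chain X d L c \<and> chain_separates X d c {u} {v}}"
    by (rule Max_ge[OF finite_chain_cards]) (use assms in blast)
  then show ?thesis using assms(3) by (simp add: d_L_def)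
qed

lemma L_chain_empty: "L_chain X d L {}"
  unfolding L_chain_def by (auto intro: small_chain)

lemma d_L_attained:
  assumes "u \<noteq> v"
  obtains c where "L_chain X d L c" "chain_separates X d c {u} {v}" "d_L X d L u v = card c + 1"
proof -
  let ?S = "{card c | c. L_chain X d L c \<and> chain_separates X d c {u} {v}}"
  have "card {} \<in> ?S" using L_chain_empty by (auto simp: chain_separates_def intro!: exI[of _ "{}"])
  then have "Max ?S \<in> ?S" using Max_in[OF finite_chain_cards] by blast
  then show ?thesis using that assms by (auto simp: d_L_def)
qed

lemma d_L_le: "real (d_L X d L u v) \<le> d u v + 3"
proof (cases "u = v")
  case True
  then show ?thesis using nonneg[of u v] by (simp add: d_L_def)
next
  case False
  then obtain c where "L_chain X d L c" "chain_separates X d c {u} {v}" "d_L X d L u v = card c + 1"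
    by (rule d_L_attained)
  then show ?thesis using chain_card_le[of c u v] by (simp add: L_chain_def)
qed

lemma d_L_commute: "d_L X d L u v = d_L X d L v u"
proof -
  have "separates X d h A B \<longleftrightarrow> separates X d h B A" for h A B
    unfolding separates_def by blast
  then show ?thesis unfolding d_L_def chain_separates_def by auto
qed

text \<open>In nested order, the curtains with \<open>v\<close> beyond them form an initial run and
  those with \<open>v\<close> before them a final run, so both are chains. Below three members every
  subset is a chain.\<close>

lemma L_chain_part:
  assumes c: "L_chain X d L c" "finite c" and sep: "chain_separates X d c {u} {w}"
    and c1: "c1 = {k \<in> c. separates X d k {u} {v}}" and c2: "c2 = {k \<in> c. separates X d k {v} {w}}"
  shows "L_chain X d L c1 \<and> L_chain X d L c2"
proof -
  have cc: "curtain_chain X d c" using c by (simp add: L_chain_def)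
  have "curtain_chain X d c1 \<and> curtain_chain X d c2"
  proof (cases "3 \<le> card c")
    case True
    obtain h M P where n: "nested (card c) h M P" and hc: "h ` {..<card c} = c"
      and uw: "\<forall>i<card c. u \<in> M i \<and> w \<in> P i"
      by (rule chain_nested[OF cc True sep])
    have h: "halves (h i) (M i) (P i)" if "i < card c" for i using nested_halves[OF n that] .
    have s1: "separates X d (h i) {u} {v} \<longleftrightarrow> v \<in> P i" if i: "i < card c" for i
      unfolding separates_iff using h[OF i] uw[rule_format, OF i] halves_unique[OF h[OF i]] halves_partition(3)[OF h[OF i]]
      by blast
    have s2: "separates X d (h i) {v} {w} \<longleftrightarrow> v \<in> M i" if i: "i < card c" for i
      unfolding separates_iff using h[OF i] uw[rule_format, OF i] halves_unique[OF h[OF i]] halves_partition(3)[OF h[OF i]]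
      by blast
    have down: "v \<in> P i" if "i < j" "j < card c" "v \<in> P j" for i j
      using nested_plus[OF n that(1,2)] that(3) by blast
    have up: "v \<in> M j" if "i < j" "j < card c" "v \<in> M i" for i j
      using nested_minus[OF n that(1,2)] that(3) by blast
    \<comment> \<open>The length of the initial run; the alternative \<open>i = card c\<close> makes
      the minimum exist when the run is all of \<open>c\<close>.\<close>
    define a where "a = (LEAST i. i = card c \<or> v \<notin> P i)"
    have a: "a = card c \<or> v \<notin> P a" unfolding a_def by (rule LeastI[of _ "card c"]) simp
    have a_le: "a \<le> i" if "i = card c \<or> v \<notin> P i" for i unfolding a_def by (rule Least_le) (rule that)
    have ac: "a \<le> card c" using a_le by blast
    have "c1 = h ` {..<a}"
    proof -
      have "i < card c \<and> v \<in> P i \<longleftrightarrow> i < a" for i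
      proof
        assume i: "i < card c \<and> v \<in> P i"
        show "i < a"
        proof (rule ccontr)
          assume "\<not> i < a"
          then have "a < card c" using i by simp
          then have "v \<notin> P a" using a by simp
          then show False using down[of a i] i \<open>\<not> i < a\<close> by (cases "a = i") auto
        qed
      next
        assume i: "i < a"
        then have "\<not> (i = card c \<or> v \<notin> P i)" using a_le[of i] by linarith
        then show "i < card c \<and> v \<in> P i" using i ac by simp
      qed
      then have "{..<a} = {i. i < card c \<and> v \<in> P i}" by auto
      moreover have "c1 = {k \<in> h ` {..<card c}. separates X d k {u} {v}}" unfolding c1 hc ..
      ultimately show ?thesis using s1 by auto
    qed
    moreover have "curtain_chain X d (h ` {..<a})" by (rule nested_chain[OF nested_mono[OF n ac]])
    moreover
    define b where "b = (LEAST i. i = card c \<or> v \<in> M i)"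
    have b: "b = card c \<or> v \<in> M b" unfolding b_def by (rule LeastI[of _ "card c"]) simp
    have b_le: "b \<le> i" if "i = card c \<or> v \<in> M i" for i unfolding b_def by (rule Least_le) (rule that)
    have bc: "b \<le> card c" using b_le by blast
    have "c2 = (\<lambda>i. h (i + b)) ` {..<card c - b}"
    proof -
      have *: "i < card c \<and> v \<in> M i \<longleftrightarrow> b \<le> i \<and> i < card c" for i
        using b b_le[of i] up[of b i] by (cases "i = b") auto
      have "c2 = {k \<in> h ` {..<card c}. separates X d k {v} {w}}" unfolding c2 hc ..
      also have "\<dots> = h ` {i. i < card c \<and> v \<in> M i}" using s2 by auto
      also have "{i. i < card c \<and> v \<in> M i} = (\<lambda>i. i + b) ` {..<card c - b}"
      proof (intro equalityI subsetI)
        fix i assume "i \<in> {i. i < card c \<and> v \<in> M i}"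
        then show "i \<in> (\<lambda>i. i + b) ` {..<card c - b}"
          using *[of i] by (intro image_eqI[of _ _ "i - b"]) auto
      next
        fix j assume "j \<in> (\<lambda>i. i + b) ` {..<card c - b}"
        then have "b \<le> j" "j < card c" by auto
        then show "j \<in> {i. i < card c \<and> v \<in> M i}" using *[of j] by blast
      qed
      finally show ?thesis unfolding image_image .
    qed
    moreover have "curtain_chain X d ((\<lambda>i. h (i + b)) ` {..<card c - b})"
      by (rule nested_chain[OF nested_shift[OF n]])
    ultimately show ?thesis by simp
  next
    case False
    have "finite c1" "card c1 \<le> card c" "finite c2" "card c2 \<le> card c"
      using c(2) unfolding c1 c2 by (auto intro: card_mono)
    moreover have "\<forall>k\<in>c1. is_curtain X d k" "\<forall>k\<in>c2. is_curtain X d k"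
      using cc by (auto simp: c1 c2 curtain_chain_def)
    ultimately show ?thesis using False by (auto intro!: small_chain)
  qed
  moreover have "c1 \<subseteq> c" "c2 \<subseteq> c" unfolding c1 c2 by auto
  ultimately show ?thesis using c(1) unfolding L_chain_def by (meson subsetD)
qed

text \<open>A member of an optimal chain from \<open>u\<close> to \<open>w\<close> has
  \<open>v\<close> beyond it, before it or on it. Members are disjoint, so at most one contains
  \<open>v\<close>, and the second \<open>1\<close> on the right-hand side pays for it.\<close>

lemma d_L_triangle:
  assumes X: "u \<in> X" "v \<in> X" "w \<in> X"
  shows "d_L X d L u w \<le> d_L X d L u v + d_L X d L v w"
proof (cases "u = v \<or> v = w \<or> u = w")
  case True
  then show ?thesis by (auto simp: d_L_def)
next
  case False
  then have ne: "u \<noteq> w" "u \<noteq> v" "v \<noteq> w" by auto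
  obtain c where c: "L_chain X d L c" "chain_separates X d c {u} {w}" "d_L X d L u w = card c + 1"
    by (rule d_L_attained[OF ne(1)])
  show ?thesis
  proof (cases "finite c")
    case True
    define c1 c2 c3 where "c1 = {k \<in> c. separates X d k {u} {v}}"
      and "c2 = {k \<in> c. separates X d k {v} {w}}" and "c3 = {k \<in> c. v \<in> k}"
    have parts: "L_chain X d L c1" "L_chain X d L c2"
      using L_chain_part[OF c(1) True c(2) c1_def c2_def] by auto
    have "k \<in> c1 \<union> c2 \<union> c3" if k: "k \<in> c" for k
    proof -
      obtain M P where h: "halves k M P" "u \<in> M" "w \<in> P"
        using bspec[OF c(2)[unfolded chain_separates_def] k] unfolding separates_iff by blast
      then have "v \<in> M \<or> v \<in> k \<or> v \<in> P" using halves_partition(1)[OF h(1)] X(2) by blast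
      moreover have "v \<in> P \<Longrightarrow> separates X d k {u} {v}" "v \<in> M \<Longrightarrow> separates X d k {v} {w}"
        unfolding separates_iff using h by blast+
      ultimately show ?thesis using k by (auto simp: c1_def c2_def c3_def)
    qed
    then have "c \<subseteq> c1 \<union> c2 \<union> c3" by blast
    moreover have fin: "finite c1" "finite c2" "finite c3" using True by (auto simp: c1_def c2_def c3_def)
    ultimately have "card c \<le> card (c1 \<union> c2 \<union> c3)" by (intro card_mono) auto
    also have "\<dots> \<le> card c1 + card c2 + card c3"
      by (meson add_le_mono card_Un_le le_refl order_trans)
    finally have "card c \<le> card c1 + card c2 + card c3" .
    moreover have "card c3 \<le> 1"
    proof -
      have "k = k'" if "k \<in> c3" "k' \<in> c3" for k k'
        using that c(1) unfolding c3_def L_chain_def L_separated_def by blast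
      then show ?thesis using card_le_Suc0_iff_eq[OF fin(3)] by auto
    qed
    moreover have "card c1 + 1 \<le> d_L X d L u v"
      by (rule d_L_ge[OF parts(1) _ ne(2)]) (simp add: chain_separates_def c1_def)
    moreover have "card c2 + 1 \<le> d_L X d L v w"
      by (rule d_L_ge[OF parts(2) _ ne(3)]) (simp add: chain_separates_def c2_def)
    ultimately show ?thesis using c(3) by simp
  next
    case False
    \<comment> \<open>An infinite \<open>c\<close> has \<open>card\<close> 0: the left side is 1,
      and each summand on the right is at least 1.\<close>
    then show ?thesis using c(3) ne by (simp add: d_L_def)
  qed
qed

end

section \<open>Bottlenecks\<close>

context CAT0 begin

text \<open>The angle at \<open>p\<close> between \<open>x\<close> and \<open>y\<close> is straight,
  so they cannot both make an acute angle with \<open>\<eta>\<close>: otherwise a step along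
  \<open>\<eta>\<close> would shorten the path from \<open>x\<close> to \<open>y\<close> through
  \<open>p\<close>.\<close>

lemma nearest_vertex_of_straight_angle:
  assumes \<eta>: "geodesic_from_to X d p q \<eta>" and X: "x \<in> X" "y \<in> X" "p \<in> X" and btw: "d x p + d p y = d x y"
  shows "nearest {0..d p q} \<eta> x = 0 \<or> nearest {0..d p q} \<eta> y = 0"
proof (rule ccontr)
  let ?J = "{0..d p q}"
  have g: "geodesic X d ?J \<eta>" and \<eta>0: "\<eta> 0 = p" using \<eta> by (auto simp: geodesic_from_to_def)
  have J: "?J \<noteq> {}" and J0: "0 \<in> ?J" by auto
  assume "\<not> ?thesis"
  then have pos: "nearest ?J \<eta> x > 0" "nearest ?J \<eta> y > 0"
    using nearest_in[OF g X(1) J] nearest_in[OF g X(2) J] by auto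
  define t where "t = min (nearest ?J \<eta> x) (nearest ?J \<eta> y)"
  have t: "0 < t" "t \<le> nearest ?J \<eta> x" "t \<le> nearest ?J \<eta> y" using pos by (auto simp: t_def)
  have "t \<in> ?J" using t nearest_in[OF g X(1) J] by auto
  then have tX: "\<eta> t \<in> X" using geodesic_in_space[OF g] by blast
  have "d x (\<eta> t) < d x p" "d y (\<eta> t) < d y p"
    using dist_decreasing_towards_nearest[OF g X(1) J0 t(1,2)]
      dist_decreasing_towards_nearest[OF g X(2) J0 t(1,3)] \<eta>0 by auto
  then show False using triangle[OF X(1) tX X(2)] btw by (simp add: commute)
qed

text \<open>\<open>\<eta>\<close> meets \<open>\<beta>\<close> at an angle that is at least right.
  The Pythagorean inequalities for the foot on \<open>\<beta>\<close> and for the foot on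
  \<open>\<eta>\<close> together leave no foot other than the end of \<open>\<eta>\<close>.\<close>

lemma nearest_foot_of_perpendicular:
  assumes \<beta>: "geodesic X d I \<beta>" and p: "p \<in> X" and t: "t \<in> I"
    and \<eta>: "geodesic_from_to X d p (\<beta> (nearest I \<beta> p)) \<eta>"
  shows "nearest {0..d p (\<beta> (nearest I \<beta> p))} \<eta> (\<beta> t) = d p (\<beta> (nearest I \<beta> p))"
proof -
  define t0 where "t0 = nearest I \<beta> p"
  define e where "e = d p (\<beta> t0)"
  have I: "I \<noteq> {}" using t by blast
  have t0: "t0 \<in> I" unfolding t0_def by (rule nearest_in[OF \<beta> p I])
  have X: "\<beta> t \<in> X" "\<beta> t0 \<in> X" using geodesic_in_space[OF \<beta>] t t0 by auto
  have g: "geodesic X d {0..e} \<eta>" and \<eta>e: "\<eta> e = \<beta> t0"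
    using \<eta> by (auto simp: geodesic_from_to_def e_def t0_def)
  have J: "{0..e} \<noteq> {}" "e \<in> {0..e}" by (auto simp: e_def)
  define s where "s = nearest {0..e} \<eta> (\<beta> t)"
  have s: "s \<in> {0..e}" unfolding s_def by (rule nearest_in[OF g X(1) J(1)])
  have btw: "\<eta> s \<in> X" "d p (\<eta> s) = s" "d (\<eta> s) (\<beta> t0) = e - s"
    using geodesic_from_to_between[OF \<eta>, folded t0_def, folded e_def, OF s] by auto
  have near: "nearest I \<beta> (\<eta> s) = t0"
    using nearest_between[OF \<beta> I p btw(1)] btw(2,3) by (simp add: t0_def e_def)
  have "(d (\<eta> s) (\<beta> t0))\<^sup>2 + (t - t0)\<^sup>2 \<le> (d (\<eta> s) (\<beta> t))\<^sup>2"
    using nearest_pythagoras[OF \<beta> btw(1) t0 t] nearest_le[OF \<beta> btw(1) I] near by simp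
  moreover have "(d (\<beta> t) (\<eta> s))\<^sup>2 + (e - s)\<^sup>2 \<le> (d (\<beta> t) (\<eta> e))\<^sup>2"
    using nearest_pythagoras[OF g X(1) s J(2)] nearest_le[OF g X(1) J(1)] s_def by simp
  moreover have "(d (\<beta> t) (\<eta> e))\<^sup>2 = (t - t0)\<^sup>2"
    unfolding \<eta>e using geodesic_dist[OF \<beta> t t0] by simp
  moreover have "(d (\<beta> t) (\<eta> s))\<^sup>2 = (d (\<eta> s) (\<beta> t))\<^sup>2" by (simp add: commute)
  ultimately have "(e - s)\<^sup>2 \<le> 0" unfolding btw(3) by linarith
  then have "s = e" by simp
  then show ?thesis by (simp add: s_def e_def t0_def)
qed

text \<open>More than \<open>L\<close> curtains dual to \<open>\<eta>\<close> fit between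
  \<open>p\<close> and \<open>q\<close>. A connected set whose projection reaches both ends of
  \<open>\<eta>\<close> crosses all of them, so two \<open>L\<close>-separated curtains cannot both
  be such sets.\<close>

lemma transverse_chain:
  assumes \<eta>: "geodesic_from_to X d p q \<eta>" and e: "2 * real L + 2 < d p q"
  obtains c where "curtain_chain X d c" "card c = L + 1"
    "\<forall>k\<in>c. \<forall>S x y. Lip_connected S \<longrightarrow> S \<subseteq> X \<longrightarrow> x \<in> S \<longrightarrow> y \<in> S \<longrightarrow>
       nearest {0..d p q} \<eta> x = 0 \<longrightarrow> nearest {0..d p q} \<eta> y = d p q \<longrightarrow> k \<inter> S \<noteq> {}"
proof -
  let ?J = "{0..d p q}"
  have g: "geodesic X d ?J \<eta>" using \<eta> by (auto simp: geodesic_from_to_def)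
  have J: "?J \<noteq> {}" by auto
  \<comment> \<open>Centres at \<open>1, 3, ..., 2 * L + 1\<close>: the curtains are disjoint and
    the last ends at \<open>2 * L + 3/2\<close>, below the assumed length of
    \<open>\<eta>\<close>.\<close>
  define r where "r j = 2 * real j + 1" for j :: nat
  define k where "k j = curtain X d ?J \<eta> (r j)" for j
  define M where "M j = minus_halfspace X d ?J \<eta> (r j)" for j
  define P where "P j = plus_halfspace X d ?J \<eta> (r j)" for j
  have dual: "dual_curtain X d ?J \<eta> (r j) (k j)" if "j < L + 1" for j
    using that e g by (auto simp: dual_curtain_def k_def r_def)
  note sets = dual_curtain_sets[OF dual]
  have n: "nested (L + 1) k M P"
    unfolding nested_def
  proof (intro conjI allI impI)
    fix j assume "j < L + 1"
    then show "halves (k j) (M j) (P j)" using dual unfolding halves_def M_def P_def by blast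
  next
    fix j assume j: "Suc j < L + 1"
    then have j': "j < L + 1" by simp
    show "M j \<union> k j \<subseteq> M (Suc j)"
      unfolding M_def sets(2)[OF j] sets(2)[OF j'] unfolding sets(1)[OF j']
      using nearest_in[OF g _ J] by (auto simp: r_def)
  qed
  show ?thesis
  proof (rule that)
    show "curtain_chain X d (k ` {..<L + 1})" by (rule nested_chain[OF n])
    show "card (k ` {..<L + 1}) = L + 1" using nested_inj[OF n] by (simp add: card_image)
    show "\<forall>k\<in>k ` {..<L + 1}. \<forall>S x y. Lip_connected S \<longrightarrow> S \<subseteq> X \<longrightarrow> x \<in> S \<longrightarrow> y \<in> S \<longrightarrow>
       nearest ?J \<eta> x = 0 \<longrightarrow> nearest ?J \<eta> y = d p q \<longrightarrow> k \<inter> S \<noteq> {}"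
    proof (intro ballI allI impI)
      fix k' S x y
      assume "k' \<in> k ` {..<L + 1}" and S: "Lip_connected S" "S \<subseteq> X" "x \<in> S" "y \<in> S"
        and xy: "nearest ?J \<eta> x = 0" "nearest ?J \<eta> y = d p q"
      then obtain j where j: "j < L + 1" "k' = k j" by auto
      have "Lip1 (nearest ?J \<eta>)" unfolding Lip1_def using nearest_Lipschitz[OF g J] by blast
      moreover have "nearest ?J \<eta> x \<le> r j" "r j \<le> nearest ?J \<eta> y" using xy j e by (auto simp: r_def)
      ultimately obtain z where z: "z \<in> S" "nearest ?J \<eta> z = r j"
        using Lip_connected_IVT[OF S(1) _ S(3,4)] by blast
      then have "z \<in> k j" unfolding sets(1)[OF j(1)] using S(2) by auto
      then show "k' \<inter> S \<noteq> {}" using z j by blast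
    qed
  qed
qed

text \<open>The segment from \<open>p\<close> to its projection on \<open>[a, b]\<close> is short, because the curtains dual to it
  all meet \<open>h i\<close> and \<open>h (i + 1)\<close>, or all meet \<open>h (i + 3)\<close> and \<open>h (i + 4)\<close>.\<close>
lemma bottleneck:
  assumes n: "nested n h M P" and i: "i + 4 < n"
    and L: "L_separated X d L (h i) (h (i + 1))" "L_separated X d L (h (i + 3)) (h (i + 4))"
    and u: "u \<in> M i" and v: "v \<in> P (i + 4)" and p: "p \<in> h (i + 2)" and btw: "d u p + d p v = d u v"
    and a: "a \<in> M i" and b: "b \<in> P (i + 4)"
  shows "d a p + d p b \<le> d a b + (4 * real L + 8)"
proof -
  have hv: "halves (h j) (M j) (P j)" if "j \<le> i + 4" for j using nested_halves[OF n] that i by auto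
  note part = halves_partition[OF hv]
  have X: "u \<in> X" "v \<in> X" "p \<in> X" "a \<in> X" "b \<in> X"
    using u v p a b part(5-7)[of i] part(5-7)[of "i + 2"] part(5-7)[of "i + 4"] by auto
  obtain \<beta> where \<beta>: "geodesic_from_to X d a b \<beta>" using geodesic_from_to_exists X by blast
  have gb: "geodesic X d {0..d a b} \<beta>" and \<beta>0: "\<beta> 0 = a" "\<beta> (d a b) = b"
    using \<beta> by (auto simp: geodesic_from_to_def)
  have I: "{0..d a b} \<noteq> {}" by auto
  define q where "q = \<beta> (nearest {0..d a b} \<beta> p)"
  have tI: "nearest {0..d a b} \<beta> p \<in> {0..d a b}" by (rule nearest_in[OF gb X(3) I])
  have q: "q \<in> X" "d a q + d q b = d a b"
    unfolding q_def using geodesic_from_to_between[OF \<beta> tI] by auto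
  have "d p q \<le> 2 * real L + 2"
  proof (rule ccontr)
    assume "\<not> ?thesis"
    then have e: "2 * real L + 2 < d p q" by simp
    obtain \<eta> where \<eta>: "geodesic_from_to X d p q \<eta>" using geodesic_from_to_exists X q by blast
    obtain c where c: "curtain_chain X d c" "card c = L + 1"
      and meet: "\<forall>k\<in>c. \<forall>S x y. Lip_connected S \<longrightarrow> S \<subseteq> X \<longrightarrow> x \<in> S \<longrightarrow> y \<in> S \<longrightarrow>
       nearest {0..d p q} \<eta> x = 0 \<longrightarrow> nearest {0..d p q} \<eta> y = d p q \<longrightarrow> k \<inter> S \<noteq> {}"
      by (rule transverse_chain[OF \<eta> e])
    have far: "nearest {0..d p q} \<eta> (\<beta> t) = d p q" if "t \<in> {0..d a b}" for t
      using nearest_foot_of_perpendicular[OF gb X(3) that] \<eta> unfolding q_def by blast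
    \<comment> \<open>The geodesic from \<open>a\<close> to \<open>b\<close> runs from one side of
      \<open>h j\<close> to the other, and all of it projects to the end \<open>q\<close> of
      \<open>\<eta>\<close>.\<close>
    have end_b: "\<exists>y\<in>h j. nearest {0..d p q} \<eta> y = d p q" if j: "i \<le> j" "j \<le> i + 4" for j
    proof -
      have "a \<in> M j" using a nested_minus[OF n, of i j] j i by (cases "i = j") auto
      moreover have "b \<in> P j" using b nested_plus[OF n, of j "i + 4"] j i by (cases "j = i + 4") auto
      moreover have "a \<in> \<beta> ` {0..d a b}" using \<beta>0 by (intro image_eqI[of _ _ 0]) auto
      moreover have "b \<in> \<beta> ` {0..d a b}" using \<beta>0 by (intro image_eqI[of _ _ "d a b"]) auto
      moreover have "\<beta> ` {0..d a b} \<subseteq> X" using geodesic_in_space[OF gb] by blast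
      ultimately have "\<beta> ` {0..d a b} \<inter> h j \<noteq> {}"
        using halves_meet[OF hv[OF j(2)] geodesic_from_to_Lip_connected[OF \<beta>]] by blast
      then show ?thesis using far by blast
    qed
    have hit: "k \<inter> h j \<noteq> {}" if k: "k \<in> c" and j: "i \<le> j" "j \<le> i + 4"
        and x: "x \<in> h j" "nearest {0..d p q} \<eta> x = 0" for k j x
    proof -
      obtain y where "y \<in> h j" "nearest {0..d p q} \<eta> y = d p q" using end_b[OF j] by blast
      then show ?thesis
        using meet k x halves_connected(1)[OF hv[OF j(2)]] part(5)[OF j(2)] by blast
    qed
    have small: False if L': "L_separated X d L h1 h2"
        and all: "\<And>k. k \<in> c \<Longrightarrow> k \<inter> h1 \<noteq> {} \<and> k \<inter> h2 \<noteq> {}" for h1 h2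
    proof -
      have "card c \<le> L" using L' c(1) all unfolding L_separated_def by blast
      then show False using c(2) by simp
    qed
    \<comment> \<open>A point \<open>x\<close> before \<open>p\<close> and a point \<open>y\<close>
      after \<open>p\<close> form a straight angle there. Hence \<open>0\<close> is the foot of all
      such \<open>x\<close> or of all such \<open>y\<close>, which decides which pair of curtains is
      crossed by the transverse chain.\<close>
    have near: "nearest {0..d p q} \<eta> x = 0 \<or> nearest {0..d p q} \<eta> y = 0"
      if x: "x \<in> X" "d u x + d x p = d u p" and y: "y \<in> X" "d p y + d y v = d p v" for x y
    proof (rule nearest_vertex_of_straight_angle[OF \<eta> x(1) y(1) X(3)])
      have "d u v \<le> d u x + (d x y + d y v)"
        using triangle[OF X(1) x(1) X(2)] triangle[OF x(1) y(1) X(2)] by linarith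
      then have "d x p + d p y \<le> d x y" using btw x(2) y(2) by linarith
      then show "d x p + d p y = d x y" using triangle[OF x(1) X(3) y(1)] by linarith
    qed
    show False
    proof (cases "\<forall>x\<in>X. d u x + d x p = d u p \<longrightarrow> nearest {0..d p q} \<eta> x = 0")
      case True
      have "k \<inter> h j \<noteq> {}" if k: "k \<in> c" and j: "j = i \<or> j = i + 1" for k j
      proof -
        have ji: "i \<le> j" "j \<le> i + 4" "j < i + 2" using j by auto
        have "u \<in> M j" using u nested_minus[OF n, of i j] ji i by (cases "i = j") auto
        moreover have "p \<in> P j" using p nested_plus[OF n, of j "i + 2"] ji i by auto
        ultimately obtain z where z: "z \<in> h j" "d u z + d z p = d u p"
          using halves_crossing[OF hv[OF ji(2)]] by blast
        moreover have "z \<in> X" using z(1) part(5)[OF ji(2)] by blast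
        ultimately show ?thesis using hit[OF k ji(1,2) z(1)] True by blast
      qed
      then show False using small[OF L(1)] by blast
    next
      case False
      then have *: "nearest {0..d p q} \<eta> y = 0" if "y \<in> X" "d p y + d y v = d p v" for y
        using near that by blast
      have "k \<inter> h j \<noteq> {}" if k: "k \<in> c" and j: "j = i + 3 \<or> j = i + 4" for k j
      proof -
        have ji: "i \<le> j" "j \<le> i + 4" "i + 2 < j" using j by auto
        have "v \<in> P j" using v nested_plus[OF n, of j "i + 4"] ji i by (cases "j = i + 4") auto
        moreover have "p \<in> M j" using p nested_minus[OF n, of "i + 2" j] ji i by auto
        ultimately obtain z where z: "z \<in> h j" "d p z + d z v = d p v"
          using halves_crossing[OF hv[OF ji(2)]] by blast
        moreover have "z \<in> X" using z(1) part(5)[OF ji(2)] by blast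
        ultimately show ?thesis using hit[OF k ji(1,2) z(1)] * by blast
      qed
      then show False using small[OF L(2)] by blast
    qed
  qed
  \<comment> \<open>The detour over \<open>q\<close> costs \<open>2 * d p q \<le> 4 * L + 4\<close>,
    within the stated error.\<close>
  moreover have "d a p \<le> d a q + d p q" "d p b \<le> d p q + d q b"
    using triangle[OF X(4) q(1) X(3)] triangle[OF X(3) q(1) X(5)] by (auto simp: commute)
  ultimately show ?thesis using q(2) by linarith
qed

text \<open>A level stands for five consecutive curtains: \<open>A i\<close> is the side before the
  first, \<open>B i\<close> the side beyond the fifth, and \<open>p i\<close> lies on the third.
  Only what survives reversal of the order is kept, so that one argument serves both ends of the
  chain.\<close>

definition levels :: "nat \<Rightarrow> real \<Rightarrow> (nat \<Rightarrow> 'a) \<Rightarrow> (nat \<Rightarrow> 'a set) \<Rightarrow> (nat \<Rightarrow> 'a set) \<Rightarrow> bool" where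
  "levels N \<rho> p A B \<longleftrightarrow>
     (\<forall>i<N. A i \<subseteq> X \<and> B i \<subseteq> X \<and> p i \<in> X \<and> (\<forall>a\<in>A i. \<forall>b\<in>B i. d a (p i) + d (p i) b \<le> d a b + \<rho>)) \<and>
     (\<forall>i. Suc i < N \<longrightarrow> A i \<subseteq> A (Suc i) \<and> B (Suc i) \<subseteq> B i \<and> A (Suc i) \<union> B i = X) \<and>
     (\<forall>i j. i < j \<longrightarrow> j < N \<longrightarrow> p j \<in> B i \<and> p i \<in> A j \<and> real (j - i) \<le> d (p i) (p j))"

lemma levelsD:
  assumes "levels N \<rho> p A B"
  shows "i < N \<Longrightarrow> A i \<subseteq> X" "i < N \<Longrightarrow> B i \<subseteq> X" "i < N \<Longrightarrow> p i \<in> X"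
    and "i < N \<Longrightarrow> a \<in> A i \<Longrightarrow> b \<in> B i \<Longrightarrow> d a (p i) + d (p i) b \<le> d a b + \<rho>"
    and "Suc i < N \<Longrightarrow> A i \<subseteq> A (Suc i)" "Suc i < N \<Longrightarrow> B (Suc i) \<subseteq> B i"
    and "Suc i < N \<Longrightarrow> A (Suc i) \<union> B i = X"
    and "i < j \<Longrightarrow> j < N \<Longrightarrow> p j \<in> B i" "i < j \<Longrightarrow> j < N \<Longrightarrow> p i \<in> A j"
    and "i < j \<Longrightarrow> j < N \<Longrightarrow> real (j - i) \<le> d (p i) (p j)"
  using assms unfolding levels_def by auto

lemma nested_levels:
  assumes n: "nested n h M P" and N: "5 * N \<le> n"
    and L: "\<And>i j. i < n \<Longrightarrow> j < n \<Longrightarrow> i \<noteq> j \<Longrightarrow> L_separated X d L (h i) (h j)"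
    and uv: "\<And>i. i < n \<Longrightarrow> u \<in> M i \<and> v \<in> P i"
  obtains p where "levels N (4 * real L + 8) p (\<lambda>i. M (5 * i)) (\<lambda>i. P (5 * i + 4))"
proof -
  have "\<exists>z. i < N \<longrightarrow> z \<in> h (5 * i + 2) \<and> d u z + d z v = d u v" for i
  proof (cases "i < N")
    case True
    then have "5 * i + 2 < n" using N by simp
    then show ?thesis using halves_crossing[OF nested_halves[OF n]] uv by metis
  qed simp
  then obtain p where p: "\<And>i. i < N \<Longrightarrow> p i \<in> h (5 * i + 2) \<and> d u (p i) + d (p i) v = d u v"
    by metis
  have hp: "M i \<union> h i \<union> P i = X" "h i \<subseteq> X" "M i \<subseteq> X" "P i \<subseteq> X" if "i < n" for i
    using halves_partition[OF nested_halves[OF n that]] by auto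
  have "levels N (4 * real L + 8) p (\<lambda>i. M (5 * i)) (\<lambda>i. P (5 * i + 4))"
    unfolding levels_def
  proof (intro conjI allI impI ballI)
    fix i assume i: "i < N"
    then have i': "5 * i + 4 < n" "5 * i + 2 < n" "5 * i < n" using N by auto
    show "M (5 * i) \<subseteq> X" "P (5 * i + 4) \<subseteq> X" using hp(3)[OF i'(3)] hp(4)[OF i'(1)] by auto
    show "p i \<in> X" using hp(2)[OF i'(2)] p[OF i] by blast
    fix a b assume "a \<in> M (5 * i)" "b \<in> P (5 * i + 4)"
    then show "d a (p i) + d (p i) b \<le> d a b + (4 * real L + 8)"
      using p[OF i] uv i' by (intro bottleneck[OF n i'(1), where u = u and v = v] L) auto
  next
    fix i assume i: "Suc i < N"
    then have i': "5 * i + 4 < n" "5 * Suc i < n" "5 * Suc i + 4 < n" using N by auto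
    show "M (5 * i) \<subseteq> M (5 * Suc i)" using nested_minus[OF n, of "5 * i" "5 * Suc i"] i' by auto
    show "P (5 * Suc i + 4) \<subseteq> P (5 * i + 4)" using nested_plus[OF n, of "5 * i + 4" "5 * Suc i + 4"] i' by auto
    have "M (5 * i + 4) \<union> h (5 * i + 4) \<subseteq> M (5 * Suc i)"
      using nested_minus[OF n, of "5 * i + 4" "5 * Suc i"] i' by auto
    then show "M (5 * Suc i) \<union> P (5 * i + 4) = X"
      using hp(1)[OF i'(1)] hp(3)[OF i'(2)] hp(4)[OF i'(1)] by blast
  next
    fix i j assume ij: "i < j" "j < N"
    then have i': "5 * i + 2 < n" "5 * j + 2 < n" "5 * i + 4 < 5 * j + 2" "5 * i + 2 < 5 * j" using N by auto
    have pi: "p i \<in> h (5 * i + 2)" and pj: "p j \<in> h (5 * j + 2)" using p ij by auto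
    show "p j \<in> P (5 * i + 4)" using nested_plus[OF n i'(3,2)] pj by blast
    show "p i \<in> M (5 * j)" using nested_minus[OF n i'(4)] i' pi by auto
    have "p i \<in> M (5 * i + 3)" using nested_minus[OF n, of "5 * i + 2" "5 * i + 3"] i' pi by auto
    moreover have "p j \<in> P (5 * j + 1)" using nested_plus[OF n, of "5 * j + 1" "5 * j + 2"] i' pj by auto
    ultimately have "real (5 * j + 1 - (5 * i + 3)) + 1 \<le> d (p i) (p j)"
      using nested_dist[OF n, of "5 * i + 3" "5 * j + 1"] i' by auto
    then show "real (j - i) \<le> d (p i) (p j)" using ij by (simp add: of_nat_diff)
  qed
  then show ?thesis using that by blast
qed

lemma levels_rev:
  assumes l: "levels N \<rho> p A B"
  shows "levels N \<rho> (\<lambda>i. p (N - 1 - i)) (\<lambda>i. B (N - 1 - i)) (\<lambda>i. A (N - 1 - i))"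
  unfolding levels_def
proof (intro conjI allI impI ballI)
  fix i assume i: "i < N"
  then have k: "N - 1 - i < N" by simp
  note D = levelsD[OF l]
  show "B (N - 1 - i) \<subseteq> X" "A (N - 1 - i) \<subseteq> X" "p (N - 1 - i) \<in> X" using D(1-3) k by auto
  fix a b assume "a \<in> B (N - 1 - i)" "b \<in> A (N - 1 - i)"
  then show "d a (p (N - 1 - i)) + d (p (N - 1 - i)) b \<le> d a b + \<rho>"
    using D(4)[OF k, of b a] by (simp add: commute add.commute)
next
  fix i assume i: "Suc i < N"
  then have k: "Suc (N - 1 - Suc i) < N" "Suc (N - 1 - Suc i) = N - 1 - i" by auto
  note D = levelsD[OF l]
  show "B (N - 1 - i) \<subseteq> B (N - 1 - Suc i)" "A (N - 1 - Suc i) \<subseteq> A (N - 1 - i)"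
    "B (N - 1 - Suc i) \<union> A (N - 1 - i) = X"
    using D(5-7)[OF k(1)] unfolding k(2) by auto
next
  fix i j assume ij: "i < j" "j < N"
  then have k: "N - 1 - j < N - 1 - i" "N - 1 - i < N" "N - 1 - i - (N - 1 - j) = j - i" by auto
  note D = levelsD(8-10)[OF l k(1,2)]
  show "p (N - 1 - j) \<in> A (N - 1 - i)" "p (N - 1 - i) \<in> B (N - 1 - j)"
    "real (j - i) \<le> d (p (N - 1 - i)) (p (N - 1 - j))"
    using D unfolding k(3) by (auto simp: commute)
qed

definition far :: "'a set \<Rightarrow> bool" where
  "far S \<longleftrightarrow> (\<forall>x\<in>X. \<forall>C. \<exists>y\<in>S. C < d x y)"

text \<open>If \<open>B e\<close> were bounded, move \<open>p (e + 1)\<close> next to the deep point \<open>p t\<close> by an isometry \<open>g\<close>. A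
  point \<open>z\<close> of \<open>B (e + 1)\<close> that is nearly farthest from \<open>p (e + 1)\<close> is moved still farther away, hence
  out of \<open>B (e + 1)\<close>; but then \<open>p (e + 2)\<close> is a shortcut between \<open>g z\<close> and the image of a remote point.\<close>
lemma levels_far:
  assumes l: "levels N \<rho> p A B" and X: "far X"
    and R: "\<And>x y. x \<in> X \<Longrightarrow> y \<in> X \<Longrightarrow> \<exists>g. isometry g \<and> d (g x) y \<le> R"
    and t: "t < N" "e + 2 < t" "2 * \<rho> + 3 * R + 1 < real (t - (e + 2))" and pos: "0 \<le> \<rho>" "0 \<le> R"
  shows "far (B e)"
proof (rule ccontr)
  note D = levelsD[OF l]
  define p1 where "p1 = p (e + 1)"
  define p2 where "p2 = p (e + 2)"
  define pt where "pt = p t"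
  have pX: "p1 \<in> X" "p2 \<in> X" "pt \<in> X" using D(3) t by (auto simp: p1_def p2_def pt_def)
  assume "\<not> far (B e)"
  then obtain x0 C0 where x0: "x0 \<in> X" "\<And>y. y \<in> B e \<Longrightarrow> d x0 y \<le> C0"
    unfolding far_def by (meson not_less)
  have BX: "B e \<subseteq> X" "B (e + 1) \<subseteq> B e" using D(2)[of e] D(6)[of e] t by auto
  define C where "C = d p1 x0 + C0"
  have bd: "d p1 y \<le> C" if "y \<in> B e" for y
    using x0 that BX triangle[OF pX(1) x0(1), of y] by (force simp: C_def)
  define S where "S = d p1 ` B (e + 1)"
  have "p2 \<in> B (e + 1)" using D(8)[of "e + 1" "e + 2"] t by (simp add: p2_def)
  then have S: "S \<noteq> {}" "bdd_above S"
    using bd BX by (auto simp: S_def intro!: bdd_aboveI[of _ C])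
  then obtain z where z: "z \<in> B (e + 1)" "Sup S - 1 < d p1 z"
    using less_cSup_iff[OF S, of "Sup S - 1"] by (auto simp: S_def)
  have zX: "z \<in> X" using z BX by blast
  obtain g where g: "isometry g" "d (g p1) pt \<le> R" using R pX by blast
  note g' = isometryD[OF g(1)]
  have gX: "g p1 \<in> X" "g z \<in> X" using g' pX zX by auto
  \<comment> \<open>The margin \<open>d p1 (g p1)\<close> keeps \<open>g y\<close> as well as
    \<open>y\<close> out of \<open>B e\<close>.\<close>
  obtain y where y: "y \<in> X" "C + d p1 (g p1) < d p1 y" using X pX unfolding far_def by blast
  have gy: "g y \<in> X" using g' y by blast
  have "C < d p1 (g y)"
    using triangle[OF gX(1) pX(1) gy] g'(2)[OF pX(1) y(1)] y(2) by (simp add: commute)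
  then have ny: "g y \<notin> B e" using bd by force
  have "C < d p1 y" using y(2) nonneg[of p1 "g p1"] by linarith
  then have "y \<notin> B e" using bd by force
  then have yA: "y \<in> A (e + 1)" "g y \<in> A (e + 1)" using D(7)[of e] t y(1) gy ny by auto
  then have gyA: "g y \<in> A (e + 2)" using D(5)[of "e + 1"] t by auto
  have d1: "d y p1 + d p1 z \<le> d y z + \<rho>"
    unfolding p1_def using D(4)[of "e + 1"] yA z t by auto
  have d1': "d (g y) pt + d pt (g z) \<le> d (g y) (g z) + \<rho> + 2 * R"
    using d1 g'(2)[OF y(1) pX(1)] g'(2)[OF pX(1) zX] g'(2)[OF y(1) zX] g(2)
      triangle[OF gy gX(1) pX(3)] triangle[OF pX(3) gX(1) gX(2)] by (simp add: commute)
  have "pt \<in> B (e + 1)" "pt \<in> B (e + 2)" using D(8) t by (auto simp: pt_def)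
  then have d2: "d (g y) p1 + d p1 pt \<le> d (g y) pt + \<rho>" and d3: "d (g y) p2 + d p2 pt \<le> d (g y) pt + \<rho>"
    unfolding p1_def p2_def using D(4)[of "e + 1"] D(4)[of "e + 2"] yA gyA t by auto
  have S1: "real (t - (e + 1)) \<le> d p1 pt" and S2: "real (t - (e + 2)) \<le> d p2 pt"
    unfolding p1_def p2_def pt_def by (rule D(10); use t(1,2) in simp)+
  have "real (t - (e + 2)) \<le> real (t - (e + 1))" by simp
  then have big: "2 * \<rho> + 3 * R + 1 < d p1 pt" "2 * \<rho> + 3 * R + 1 < d p2 pt" using S1 S2 t(3) by linarith+
  have "d p1 z - R \<le> d pt (g z)"
    using g'(2)[OF pX(1) zX] g(2) triangle[OF gX(1) pX(3) gX(2)] by linarith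
  \<comment> \<open>The errors are \<open>2 * \<rho>\<close> from two bottleneck inequalities,
    \<open>3 * R\<close> from the distance between \<open>pt\<close> and \<open>g p1\<close>, and
    \<open>1\<close> from the choice of \<open>z\<close>; the depth of \<open>pt\<close> exceeds
    their sum.\<close>
  then have "Sup S < d p1 (g z)"
    using d1' d2 z(2) big(1) triangle[OF gy pX(1) gX(2)] by linarith
  then have "g z \<notin> B (e + 1)" using cSup_upper[OF _ S(2)] by (force simp: S_def)
  then have "g z \<in> A (e + 2)" using D(7)[of "e + 1"] gX(2) t by auto
  then have "d (g z) p2 + d p2 pt \<le> d (g z) pt + \<rho>"
    unfolding p2_def using D(4)[of "e + 2"] \<open>pt \<in> B (e + 2)\<close> t by auto
  then show False
    using d3 d1' big(2) triangle[OF gy pX(2) gX(2)] pos by (simp add: commute)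
qed

text \<open>Eight consecutive levels are cut from the middle of a chain, deep enough for
  \<open>levels_far\<close> to apply on both sides, and their bottleneck points are replaced by a
  single one.\<close>

lemma bottleneck_exists:
  assumes X: "far X" and R: "\<And>x y. x \<in> X \<Longrightarrow> y \<in> X \<Longrightarrow> \<exists>g. isometry g \<and> d (g x) y \<le> R"
    and big: "\<And>C. \<exists>L\<ge>1. \<exists>u\<in>X. \<exists>v\<in>X. C * real L < real (d_L X d L u v)"
  obtains L h M P p \<rho> where "1 \<le> L" "nested 40 h M P" "p \<in> X" "0 \<le> \<rho>"
    "\<forall>i<40. \<forall>j<40. i \<noteq> j \<longrightarrow> L_separated X d L (h i) (h j)"
    "\<forall>i<8. \<forall>a\<in>M (5 * i). \<forall>b\<in>P (5 * i + 4). d a p + d p b \<le> d a b + \<rho>"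
    "far (M 0)" "far (P 39)"
proof -
  define R' where "R' = max R 0"
  have R': "\<exists>g. isometry g \<and> d (g x) y \<le> R'" if "x \<in> X" "y \<in> X" for x y
    using R[OF that] by (auto simp: R'_def)
  have R0: "0 \<le> R'" by (simp add: R'_def)
  \<comment> \<open>The chain needs \<open>5 * N\<close> members. With
    \<open>N = 2 * K + 20\<close>, \<open>K \<le> 2 * \<rho> + 3 * R' + 2\<close> and
    \<open>\<rho> = 4 * L + 8\<close>, this is at most
    \<open>80 * L + 30 * R' + 290\<close>.\<close>
  obtain L u v where L: "1 \<le> L" and uvX: "u \<in> X" "v \<in> X"
      and LR: "(30 * R' + 400) * real L < real (d_L X d L u v)"
    using big[of "30 * R' + 400"] by blast
  define \<rho> where "\<rho> = 4 * real L + 8"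
  define K where "K = nat \<lceil>2 * \<rho> + 3 * R' + 1\<rceil>"
  \<comment> \<open>Levels \<open>K + 5\<close> to \<open>K + 12\<close> are kept; more than
    \<open>K\<close> levels remain on either side, the depth that \<open>levels_far\<close> asks
    for.\<close>
  define N where "N = 2 * K + 20"
  have \<rho>0: "0 \<le> \<rho>" by (simp add: \<rho>_def)
  have K: "2 * \<rho> + 3 * R' + 1 \<le> real K" "real K \<le> 2 * \<rho> + 3 * R' + 2"
    unfolding K_def using \<rho>0 R0 by linarith+
  have "0 \<le> (30 * R' + 400) * real L" using R0 by simp
  then have ne: "u \<noteq> v" using LR by (auto simp: d_L_def)
  obtain c where c: "L_chain X d L c" "chain_separates X d c {u} {v}" "d_L X d L u v = card c + 1"
    by (rule d_L_attained[OF ne])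
  have "real (5 * N) + 1 \<le> 10 * (8 * real L + 16 + 3 * R' + 3) + 101"
    using K by (simp add: N_def \<rho>_def)
  also have "\<dots> = 80 * real L + 30 * R' + 291" by simp
  also have "\<dots> \<le> 80 * real L + 30 * R' * real L + 291 * real L"
    using L R0 mult_left_mono[of 1 "real L" "30 * R'"] by simp
  also have "\<dots> \<le> (30 * R' + 400) * real L" using L by (simp add: algebra_simps)
  finally have "real (5 * N) + 1 < real (card c) + 1" using LR c(3) by simp
  then have cN: "5 * N \<le> card c" by simp
  have cc: "curtain_chain X d c" and c3: "3 \<le> card c" using c(1) cN by (auto simp: L_chain_def N_def)
  obtain h M P where n: "nested (card c) h M P" and hc: "h ` {..<card c} = c"
    and uv: "\<forall>i<card c. u \<in> M i \<and> v \<in> P i"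
    by (rule chain_nested[OF cc c3 c(2)])
  have sep: "L_separated X d L (h i) (h j)" if "i < card c" "j < card c" "i \<noteq> j" for i j
  proof -
    have "h i \<in> c" "h j \<in> c" using hc that by auto
    moreover have "h i \<noteq> h j" using inj_onD[OF nested_inj[OF n], of i j] that by auto
    ultimately show ?thesis using c(1) unfolding L_chain_def by blast
  qed
  obtain p where l: "levels N (4 * real L + 8) p (\<lambda>i. M (5 * i)) (\<lambda>i. P (5 * i + 4))"
    using nested_levels[OF n cN sep] uv by blast
  note l = l[folded \<rho>_def]
  have "far (P (5 * (K + 12) + 4))"
    by (rule levels_far[OF l X R', of "2 * K + 19"]) (use K \<rho>0 R0 in \<open>auto simp: N_def\<close>)
  have "far (M (5 * (N - 1 - (K + 14))))"
    by (rule levels_far[OF levels_rev[OF l] X R', of "2 * K + 19"]) (use K \<rho>0 R0 in \<open>auto simp: N_def\<close>)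
  then have farM: "far (M (5 * (K + 5)))" by (simp add: N_def)
  define s where "s = 5 * (K + 5)"
  define q where "q = p (K + 5)"
  \<comment> \<open>Moving a bottleneck point to \<open>q\<close> costs twice its distance from
    \<open>q\<close>; the sum covers all eight levels at once.\<close>
  define \<rho>' where "\<rho>' = \<rho> + 2 * (\<Sum>i<8. d q (p (K + 5 + i)))"
  have qX: "q \<in> X" using levelsD(3)[OF l] by (simp add: q_def N_def)
  show ?thesis
  proof (rule that[of L "\<lambda>i. h (i + s)" "\<lambda>i. M (i + s)" "\<lambda>i. P (i + s)" q \<rho>'])
    show "1 \<le> L" by fact
    show "nested 40 (\<lambda>i. h (i + s)) (\<lambda>i. M (i + s)) (\<lambda>i. P (i + s))"
      by (rule nested_mono[OF nested_shift[OF n]]) (use cN in \<open>simp add: s_def N_def\<close>)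
    show "q \<in> X" by fact
    show "0 \<le> \<rho>'" using \<rho>0 by (simp add: \<rho>'_def sum_nonneg)
    show "\<forall>i<40. \<forall>j<40. i \<noteq> j \<longrightarrow> L_separated X d L (h (i + s)) (h (j + s))"
      using sep cN by (auto simp: s_def N_def)
    show "far (M (0 + s))" using farM by (simp add: s_def)
    have "s + 39 = 5 * (K + 12) + 4" by (simp add: s_def)
    then show "far (P (39 + s))" using \<open>far (P (5 * (K + 12) + 4))\<close> by (simp add: add.commute)
    show "\<forall>i<8. \<forall>a\<in>M (5 * i + s). \<forall>b\<in>P (5 * i + 4 + s). d a q + d q b \<le> d a b + \<rho>'"
    proof (intro allI impI ballI)
      fix i a b assume i: "i < (8::nat)" and ab: "a \<in> M (5 * i + s)" "b \<in> P (5 * i + 4 + s)"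
      have j: "K + 5 + i < N" using i by (simp add: N_def)
      have e: "5 * (K + 5 + i) = 5 * i + s" "5 * (K + 5 + i) + 4 = 5 * i + 4 + s" by (auto simp: s_def)
      have ab': "a \<in> M (5 * (K + 5 + i))" "b \<in> P (5 * (K + 5 + i) + 4)"
        using ab unfolding e(1)[symmetric] e(2)[symmetric] .
      then have X: "a \<in> X" "b \<in> X" "p (K + 5 + i) \<in> X"
        using levelsD(1-3)[OF l j] by blast+
      have "d a (p (K + 5 + i)) + d (p (K + 5 + i)) b \<le> d a b + \<rho>"
        by (rule levelsD(4)[OF l j ab'])
      moreover have "d q (p (K + 5 + i)) \<le> (\<Sum>i<8. d q (p (K + 5 + i)))"
        by (rule member_le_sum) (use i in auto)
      moreover have "d a q \<le> d a (p (K + 5 + i)) + d q (p (K + 5 + i))"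
        using triangle[OF X(1,3) qX] by (simp add: commute)
      moreover have "d q b \<le> d q (p (K + 5 + i)) + d (p (K + 5 + i)) b"
        using triangle[OF qX X(3,2)] .
      ultimately show "d a q + d q b \<le> d a b + \<rho>'" by (simp add: \<rho>'_def)
    qed
  qed
qed

end

section \<open>The coarse kernel\<close>

lemma discrete_IVT:
  fixes f :: "nat \<Rightarrow> real"
  assumes "f 0 \<le> \<tau>" "\<tau> \<le> f m" and step: "\<And>j. j < m \<Longrightarrow> \<bar>f (Suc j) - f j\<bar> \<le> l" and "0 \<le> l"
  shows "\<exists>j\<le>m. \<bar>f j - \<tau>\<bar> \<le> l"
proof -
  define j where "j = (LEAST j. \<tau> \<le> f j)"
  have j: "\<tau> \<le> f j" "j \<le> m" unfolding j_def using assms(2) by (auto intro: LeastI Least_le)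
  show ?thesis
  proof (cases j)
    case 0
    then have "\<bar>f j - \<tau>\<bar> \<le> l" using j assms by simp
    then show ?thesis using j by blast
  next
    case (Suc i)
    then have "\<not> \<tau> \<le> f i" unfolding j_def using not_less_Least lessI by metis
    moreover have "\<bar>f j - f i\<bar> \<le> l" using step[of i] Suc j by simp
    ultimately have "\<bar>f j - \<tau>\<bar> \<le> l" using j by linarith
    then show ?thesis using j by blast
  qed
qed

locale CAT0_action = CAT0 X d + group_action G X \<phi>
  for X :: "'a set" and d :: "'a \<Rightarrow> 'a \<Rightarrow> real" and G :: "('g, 'm) monoid_scheme" (structure)
    and \<phi> :: "'g \<Rightarrow> 'a \<Rightarrow> 'a" +
  assumes act_dist: "\<And>g x y. g \<in> carrier G \<Longrightarrow> x \<in> X \<Longrightarrow> y \<in> X \<Longrightarrow> d (\<phi> g x) (\<phi> g y) = d x y"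
begin

sublocale group G
  using group_hom by (rule group_hom.axioms(1))

abbreviation K :: "'g set" where "K \<equiv> coarse_kernel G X d \<phi>"

lemma act_in: "g \<in> carrier G \<Longrightarrow> x \<in> X \<Longrightarrow> \<phi> g x \<in> X"
  using element_image by blast

lemma act_mult: "g \<in> carrier G \<Longrightarrow> h \<in> carrier G \<Longrightarrow> x \<in> X \<Longrightarrow> \<phi> (g \<otimes> h) x = \<phi> g (\<phi> h x)"
  by (rule composition_rule)

lemma act_one: "x \<in> X \<Longrightarrow> \<phi> \<one> x = x"
  by (simp add: id_eq_one[symmetric])

lemma act_inv: "g \<in> carrier G \<Longrightarrow> x \<in> X \<Longrightarrow> \<phi> (inv g) (\<phi> g x) = x" "g \<in> carrier G \<Longrightarrow> x \<in> X \<Longrightarrow> \<phi> g (\<phi> (inv g) x) = x"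
  using act_mult[of "inv g" g x] act_mult[of g "inv g" x] by (simp_all add: act_one)

lemma act_dist_inv:
  assumes "g \<in> carrier G" "x \<in> X" "y \<in> X"
  shows "d x (\<phi> g y) = d (\<phi> (inv g) x) y"
  using act_dist[of "inv g" x "\<phi> g y"] assms by (simp add: act_in act_inv)

lemma act_isometry: "g \<in> carrier G \<Longrightarrow> isometry (\<phi> g)"
  using bij_prop0 act_dist by (auto simp: isometry_def Bij_def)

lemma kernel_carrier: "k \<in> K \<Longrightarrow> k \<in> carrier G"
  by (simp add: coarse_kernel_def)

lemma kernel_bound:
  assumes "k \<in> K"
  obtains C where "0 < C" "\<forall>x\<in>X. d (\<phi> k x) x \<le> C"
  using assms by (auto simp: coarse_kernel_def)

lemma kernel_subgroup: "subgroup K G"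
proof (rule subgroupI)
  show "K \<subseteq> carrier G" by (auto simp: coarse_kernel_def)
  have "\<one> \<in> K" by (auto simp: coarse_kernel_def act_one intro!: exI[of _ 1])
  then show "K \<noteq> {}" by blast
next
  fix a assume a: "a \<in> K"
  then have ac: "a \<in> carrier G" by (rule kernel_carrier)
  obtain C where C: "0 < C" "\<forall>x\<in>X. d (\<phi> a x) x \<le> C" by (rule kernel_bound[OF a])
  have "d (\<phi> (inv a) x) x \<le> C" if "x \<in> X" for x
    using act_dist_inv[OF ac that that] bspec[OF C(2) that] by (simp add: commute)
  then show "inv a \<in> K" using C(1) ac by (auto simp: coarse_kernel_def)
next
  fix a b assume a: "a \<in> K" and b: "b \<in> K"
  then have c: "a \<in> carrier G" "b \<in> carrier G" by (auto intro: kernel_carrier)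
  obtain C where C: "0 < C" "\<forall>x\<in>X. d (\<phi> a x) x \<le> C" by (rule kernel_bound[OF a])
  obtain D where D: "0 < D" "\<forall>x\<in>X. d (\<phi> b x) x \<le> D" by (rule kernel_bound[OF b])
  have "d (\<phi> (a \<otimes> b) x) x \<le> C + D" if "x \<in> X" for x
    using bspec[OF C(2), of "\<phi> b x"] bspec[OF D(2) that] triangle[of "\<phi> a (\<phi> b x)" "\<phi> b x" x] that c
    by (simp add: act_mult act_in)
  then show "a \<otimes> b \<in> K" using C(1) D(1) c by (auto simp: coarse_kernel_def intro!: exI[of _ "C + D"])
qed

lemma kernel_mult: "a \<in> K \<Longrightarrow> b \<in> K \<Longrightarrow> a \<otimes> b \<in> K"
  using subgroup.m_closed[OF kernel_subgroup] .

lemma kernel_inv: "a \<in> K \<Longrightarrow> inv a \<in> K"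
  using subgroup.m_inv_closed[OF kernel_subgroup] .

lemma kernel_one: "\<one> \<in> K"
  using subgroup.one_closed[OF kernel_subgroup] .

lemma kernel_pow: "a \<in> K \<Longrightarrow> a [^] (i::int) \<in> K"
  using subgroup_int_pow_closed[OF kernel_subgroup] .

end

text \<open>The eight levels now share the point \<open>p\<close>. Levels 0 and 7 supply remote
  points, 1 and 6 are where kernel elements keep them, and 2 to 5 serve the case distinctions, as
  \<open>cover\<close> loses a level each time.\<close>

locale bottleneck_action = CAT0_action X d G \<phi>
  for X :: "'a set" and d :: "'a \<Rightarrow> 'a \<Rightarrow> real" and G :: "('g, 'm) monoid_scheme" (structure)
    and \<phi> :: "'g \<Rightarrow> 'a \<Rightarrow> 'a" +
  fixes A B :: "nat \<Rightarrow> 'a set" and p :: 'a and \<rho> :: real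
  assumes p: "p \<in> X" and \<rho>: "0 \<le> \<rho>"
    and levels_subset: "\<And>i. i < 8 \<Longrightarrow> A i \<subseteq> X" "\<And>i. i < 8 \<Longrightarrow> B i \<subseteq> X"
    and A_mono: "\<And>i j. i \<le> j \<Longrightarrow> j < 8 \<Longrightarrow> A i \<subseteq> A j"
    and B_mono: "\<And>i j. i \<le> j \<Longrightarrow> j < 8 \<Longrightarrow> B j \<subseteq> B i"
    and cover: "\<And>i x. Suc i < 8 \<Longrightarrow> x \<in> X \<Longrightarrow> x \<notin> A (Suc i) \<Longrightarrow> x \<in> B i"
    and bottle: "\<And>i a b. i < 8 \<Longrightarrow> a \<in> A i \<Longrightarrow> b \<in> B i \<Longrightarrow> d a p + d p b \<le> d a b + \<rho>"
    and far_A: "far (A 0)" and far_B: "far (B 7)"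
begin

text \<open>\<open>w\<close> and \<open>z\<close> lie on opposite sides of the bottleneck translated
  by \<open>f\<close>; membership is tested after pulling back by \<open>inv f\<close>.\<close>

definition good :: "'a \<Rightarrow> 'a \<Rightarrow> 'g \<Rightarrow> bool" where
  "good w z f \<longleftrightarrow> f \<in> K \<and> w \<in> X \<and> z \<in> X \<and> \<phi> (inv f) w \<in> A 1 \<and> \<phi> (inv f) z \<in> B 6"

text \<open>An element of the kernel cannot move a remote point of \<open>A 0\<close> across the bottleneck.\<close>
lemma good_exists:
  assumes F: "finite F" "F \<subseteq> K"
  obtains w z where "\<And>f. f \<in> F \<Longrightarrow> good w z f"
proof -
  have "\<forall>f\<in>F. \<exists>C. \<forall>x\<in>X. d (\<phi> (inv f) x) x \<le> C"
    using F(2) kernel_inv by (meson kernel_bound subsetD)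
  then obtain c where c: "\<And>f x. f \<in> F \<Longrightarrow> x \<in> X \<Longrightarrow> d (\<phi> (inv f) x) x \<le> c f"
    by (auto dest!: bchoice)
  obtain C where C: "\<And>f. f \<in> F \<Longrightarrow> c f \<le> C"
    using F(1) by (metis Max_ge finite_imageI imageI)
  obtain w where w: "w \<in> A 0" "C + \<rho> < d p w" using far_A p unfolding far_def by blast
  obtain z where z: "z \<in> B 7" "C + \<rho> < d p z" using far_B p unfolding far_def by blast
  have X: "w \<in> X" "z \<in> X" using w z levels_subset(1)[of 0] levels_subset(2)[of 7] by auto
  have "good w z f" if f: "f \<in> F" for f
  proof -
    have fK: "f \<in> K" "f \<in> carrier G" using F f kernel_carrier by auto
    have fX: "\<phi> (inv f) w \<in> X" "\<phi> (inv f) z \<in> X" using act_in fK X by auto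
    have "\<phi> (inv f) w \<notin> B 0"
    proof
      assume "\<phi> (inv f) w \<in> B 0"
      then have "d w p + d p (\<phi> (inv f) w) \<le> d w (\<phi> (inv f) w) + \<rho>" using bottle[of 0] w by auto
      moreover have "d w (\<phi> (inv f) w) \<le> C"
        using c[OF f X(1)] C[OF f] by (simp add: commute)
      ultimately show False using w(2) nonneg[of p "\<phi> (inv f) w"] commute[of w p] by linarith
    qed
    moreover have "\<phi> (inv f) z \<notin> A 7"
    proof
      assume "\<phi> (inv f) z \<in> A 7"
      then have "d (\<phi> (inv f) z) p + d p z \<le> d (\<phi> (inv f) z) z + \<rho>" using bottle[of 7] z by auto
      moreover have "d (\<phi> (inv f) z) z \<le> C"
        using c[OF f X(2)] C[OF f] by simp
      ultimately show False using z(2) nonneg[of "\<phi> (inv f) z" p] by linarith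
    qed
    ultimately have "\<phi> (inv f) w \<in> A 1" "\<phi> (inv f) z \<in> B 6"
      using cover[of 0] cover[of 6] fX by auto
    then show ?thesis using fK X by (simp add: good_def)
  qed
  then show ?thesis using that by blast
qed

lemma right:
  assumes f: "f \<in> carrier G" and w: "w \<in> X" "\<phi> (inv f) w \<in> A 1"
    and x: "x \<in> X" "\<phi> (inv f) x \<in> B j" "1 \<le> j" "j < 8"
  shows "d w (\<phi> f p) + d (\<phi> f p) x \<le> d w x + \<rho>"
proof -
  have "\<phi> (inv f) w \<in> A j" using A_mono[OF x(3,4)] w by blast
  from bottle[OF x(4) this x(2)] show ?thesis
    using act_dist_inv[OF f w(1) p] act_dist_inv[OF f x(1) p] act_dist[of "inv f" w x] f w x
    by (simp add: commute)
qed

lemma left: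
  assumes f: "f \<in> carrier G" and z: "z \<in> X" "\<phi> (inv f) z \<in> B 6"
    and x: "x \<in> X" "\<phi> (inv f) x \<in> A j" "j \<le> 6"
  shows "d x (\<phi> f p) + d (\<phi> f p) z \<le> d x z + \<rho>"
proof -
  have "\<phi> (inv f) z \<in> B j" using B_mono[OF x(3)] z by auto
  from bottle[OF _ x(2) this] x(3) show ?thesis
    using act_dist_inv[OF f z(1) p] act_dist_inv[OF f x(1) p] act_dist[of "inv f" x z] f z x
    by (simp add: commute)
qed

lemma goodD:
  assumes "good w z f"
  shows "f \<in> carrier G" "w \<in> X" "\<phi> (inv f) w \<in> A 1" "z \<in> X" "\<phi> (inv f) z \<in> B 6" "f \<in> K" "\<phi> f p \<in> X"
  using assms kernel_carrier act_in p by (auto simp: good_def)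

lemma middle: "good w z f \<Longrightarrow> d w (\<phi> f p) + d (\<phi> f p) z \<le> d w z + \<rho>"
  using right[OF goodD(1-3) goodD(4,5)] by auto

lemma right_or_left:
  assumes f: "good w z f" and x: "x \<in> X"
  shows "d w (\<phi> f p) + d (\<phi> f p) x \<le> d w x + \<rho> \<or> d x (\<phi> f p) + d (\<phi> f p) z \<le> d x z + \<rho>"
proof (cases "\<phi> (inv f) x \<in> B 2")
  case True
  then show ?thesis using right[OF goodD(1-3)[OF f] x] by auto
next
  case False
  then have "\<phi> (inv f) x \<in> A 3" using cover[of 2 "\<phi> (inv f) x"] act_in goodD(1)[OF f] x by auto
  then show ?thesis using left[OF goodD(1)[OF f] goodD(4,5)[OF f] x] by auto
qed

text \<open>\<open>x\<close> lies almost on a geodesic from \<open>w\<close> to \<open>z\<close>,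
  and \<open>\<phi> f p\<close> comes after it on the way to \<open>z\<close>, so the difference of
  the coordinates recovers the distance.\<close>

lemma left_dist:
  assumes f: "good w z f" and x: "x \<in> X" "d w x + d x z \<le> d w z + \<rho>"
    and l: "d x (\<phi> f p) + d (\<phi> f p) z \<le> d x z + \<rho>"
  shows "d x (\<phi> f p) \<le> d w (\<phi> f p) - d w x + 2 * \<rho>"
  using triangle[OF goodD(2,7,4)[OF f]] x l by linarith

text \<open>If \<open>\<phi> f p\<close> lies between \<open>w\<close> and
  \<open>\<phi> f' p\<close>, the coordinates add up with error \<open>\<rho>\<close>; otherwise it
  lies between \<open>\<phi> f' p\<close> and \<open>z\<close>, and \<open>left_dist\<close>
  applies.\<close>

lemma line:
  assumes f: "good w z f" and f': "good w z f'"
  shows "d (\<phi> f p) (\<phi> f' p) \<le> \<bar>d w (\<phi> f p) - d w (\<phi> f' p)\<bar> + 2 * \<rho>"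
  using right_or_left[OF f goodD(7)[OF f']]
proof
  assume "d w (\<phi> f p) + d (\<phi> f p) (\<phi> f' p) \<le> d w (\<phi> f' p) + \<rho>"
  then show ?thesis using \<rho> by linarith
next
  assume "d (\<phi> f' p) (\<phi> f p) + d (\<phi> f p) z \<le> d (\<phi> f' p) z + \<rho>"
  from left_dist[OF f goodD(7)[OF f'] middle[OF f'] this] show ?thesis
    by (simp add: commute)
qed

text \<open>The distance from \<open>w\<close> to \<open>\<phi> (k \<otimes> f) p\<close> is the
  distance from \<open>w'\<close> to \<open>\<phi> f p\<close>, so the claim compares coordinates
  from two base points. If one orbit point lies between both base points and the other orbit point,
  changing the base point alters both coordinates equally up to \<open>\<rho>\<close>. If neither
  does, the two orbit points are within \<open>2 * \<rho>\<close> of each other.\<close>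

lemma shift:
  assumes k: "k \<in> K" and f: "good w z f" and f': "good w z f'"
    and kf: "good w z (k \<otimes> f)" and kf': "good w z (k \<otimes> f')"
  shows "\<bar>(d w (\<phi> (k \<otimes> f) p) - d w (\<phi> f p)) - (d w (\<phi> (k \<otimes> f') p) - d w (\<phi> f' p))\<bar> \<le> 4 * \<rho>"
proof -
  define w' where "w' = \<phi> (inv k) w"
  have kc: "k \<in> carrier G" using k kernel_carrier by blast
  have w': "w' \<in> X" unfolding w'_def using act_in kc goodD(2)[OF f] by auto
  have eq: "d w (\<phi> (k \<otimes> g) p) = d w' (\<phi> g p)" if "good w z g" for g
    using act_dist_inv[OF kc goodD(2,7)[OF that]] goodD(1)[OF that] kc p by (simp add: w'_def act_mult)
  have A1: "\<phi> (inv g) w' \<in> A 1" if "good w z g" "good w z (k \<otimes> g)" for g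
    using goodD(3)[OF that(2)] goodD(1)[OF that(1)] goodD(2)[OF that(1)] kc
    by (simp add: w'_def inv_mult_group act_mult)
  have one_side: "\<bar>(d w' (\<phi> g p) - d w (\<phi> g p)) - (d w' (\<phi> g' p) - d w (\<phi> g' p))\<bar> \<le> \<rho>"
    if g: "good w z g" and g': "good w z g'" and kg: "good w z (k \<otimes> g)" and B: "\<phi> (inv g) (\<phi> g' p) \<in> B 2" for g g'
  proof -
    have "d w (\<phi> g p) + d (\<phi> g p) (\<phi> g' p) \<le> d w (\<phi> g' p) + \<rho>"
      by (rule right[OF goodD(1-3)[OF g] goodD(7)[OF g'] B]) auto
    moreover have "d w' (\<phi> g p) + d (\<phi> g p) (\<phi> g' p) \<le> d w' (\<phi> g' p) + \<rho>"
      by (rule right[OF goodD(1)[OF g] w' A1[OF g kg] goodD(7)[OF g'] B]) auto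
    moreover have "d w (\<phi> g' p) \<le> d w (\<phi> g p) + d (\<phi> g p) (\<phi> g' p)"
      using triangle goodD(2,7)[OF g] goodD(7)[OF g'] by blast
    moreover have "d w' (\<phi> g' p) \<le> d w' (\<phi> g p) + d (\<phi> g p) (\<phi> g' p)"
      using triangle w' goodD(7)[OF g] goodD(7)[OF g'] by blast
    ultimately show ?thesis by linarith
  qed
  have gX: "\<phi> (inv f) (\<phi> f' p) \<in> X" "\<phi> (inv f') (\<phi> f p) \<in> X"
    using act_in goodD(1,7)[OF f] goodD(1,7)[OF f'] by auto
  show ?thesis unfolding eq[OF f] eq[OF f']
  proof (cases "\<phi> (inv f) (\<phi> f' p) \<in> B 2 \<or> \<phi> (inv f') (\<phi> f p) \<in> B 2")
    case True
    then show "\<bar>(d w' (\<phi> f p) - d w (\<phi> f p)) - (d w' (\<phi> f' p) - d w (\<phi> f' p))\<bar> \<le> 4 * \<rho>"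
      using one_side[OF f f' kf] one_side[OF f' f kf'] \<rho> by linarith
  next
    case False
    then have A: "\<phi> (inv f) (\<phi> f' p) \<in> A 3" "\<phi> (inv f') (\<phi> f p) \<in> A 3"
      using cover[of 2] gX by auto
    have "d (\<phi> f' p) (\<phi> f p) \<le> d w (\<phi> f p) - d w (\<phi> f' p) + 2 * \<rho>"
      by (rule left_dist[OF f goodD(7)[OF f'] middle[OF f'] left[OF goodD(1)[OF f] goodD(4,5)[OF f] goodD(7)[OF f'] A(1)]]) auto
    moreover have "d (\<phi> f p) (\<phi> f' p) \<le> d w (\<phi> f' p) - d w (\<phi> f p) + 2 * \<rho>"
      by (rule left_dist[OF f' goodD(7)[OF f] middle[OF f] left[OF goodD(1)[OF f'] goodD(4,5)[OF f'] goodD(7)[OF f] A(2)]]) auto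
    ultimately have "d (\<phi> f p) (\<phi> f' p) \<le> 2 * \<rho>" by (simp add: commute)
    moreover have "\<bar>d w (\<phi> f p) - d w (\<phi> f' p)\<bar> \<le> d (\<phi> f p) (\<phi> f' p)"
      using dist_Lipschitz[OF goodD(2)[OF f] goodD(7)[OF f] goodD(7)[OF f']] .
    moreover have "\<bar>d w' (\<phi> f p) - d w' (\<phi> f' p)\<bar> \<le> d (\<phi> f p) (\<phi> f' p)"
      using dist_Lipschitz[OF w' goodD(7)[OF f] goodD(7)[OF f']] .
    ultimately show "\<bar>(d w' (\<phi> f p) - d w (\<phi> f p)) - (d w' (\<phi> f' p) - d w (\<phi> f' p))\<bar> \<le> 4 * \<rho>"
      by linarith
  qed
qed

section \<open>Powers of one kernel element\<close>

abbreviation orb :: "'g \<Rightarrow> int \<Rightarrow> 'a" where "orb c i \<equiv> \<phi> (c [^] i) p"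

definition good_upto :: "'a \<Rightarrow> 'a \<Rightarrow> 'g \<Rightarrow> int \<Rightarrow> bool" where
  "good_upto w z c n \<longleftrightarrow> (\<forall>i. \<bar>i\<bar> \<le> n \<longrightarrow> good w z (c [^] i))"

lemma good_upto_exists:
  assumes c: "c \<in> K" and k: "k \<in> K"
  obtains w z where "good_upto w z c n" "good w z k"
proof -
  let ?F = "insert k ((\<lambda>i. c [^] i) ` {-n..n})"
  have "finite ?F" "?F \<subseteq> K" using kernel_pow[OF c] k by auto
  then obtain w z where g: "\<And>f. f \<in> ?F \<Longrightarrow> good w z f" by (rule good_exists) blast
  have "good w z (c [^] i)" if "\<bar>i\<bar> \<le> n" for i
  proof -
    have "i \<in> {-n..n}" using that by auto
    then show ?thesis by (intro g insertI2 imageI)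
  qed
  then show ?thesis using that[of w z] g by (simp add: good_upto_def)
qed

lemma pow_Suc: "c \<in> K \<Longrightarrow> c [^] (i + 1) = c \<otimes> c [^] (i::int)"
  using int_pow_mult[of c 1 i] kernel_carrier by (simp add: add.commute)

lemma orb_in: "c \<in> K \<Longrightarrow> orb c i \<in> X"
  using act_in kernel_carrier kernel_pow p by blast

lemma orb_dist_shift:
  assumes c: "c \<in> K"
  shows "d (orb c (i + j)) (orb c (i + k)) = d (orb c j) (orb c k)"
  using c kernel_carrier[OF c] act_dist[of "c [^] i" "orb c j" "orb c k"] orb_in[OF c] p
  by (simp add: int_pow_mult act_mult)

lemma orb_step:
  assumes c: "c \<in> K"
  shows "d (orb c (i + 1)) (orb c i) = d (\<phi> c p) p"
  using orb_dist_shift[OF c, of i 1 0] kernel_carrier[OF c] p by (simp add: act_one)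

lemma orb_steps:
  assumes c: "c \<in> K"
  shows "d (orb c i) (orb c j) \<le> real_of_int \<bar>i - j\<bar> * d (\<phi> c p) p"
proof -
  have nat: "d (orb c (int n)) (orb c 0) \<le> real n * d (\<phi> c p) p" for n
  proof (induction n)
    case (Suc n)
    have "d (orb c (int n + 1)) (orb c 0) \<le> d (orb c (int n + 1)) (orb c (int n)) + d (orb c (int n)) (orb c 0)"
      using triangle orb_in[OF c] by blast
    then show ?case using Suc orb_step[OF c, of "int n"] by (simp add: algebra_simps)
  qed (use orb_in[OF c, of 0] in simp)
  have "d (orb c i) (orb c j) \<le> real_of_int \<bar>i - j\<bar> * d (\<phi> c p) p" if "j \<le> i" for i j
    using nat[of "nat (i - j)"] orb_dist_shift[OF c, of j "i - j" 0] that by simp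
  from this[of i j] this[of j i] show ?thesis
    by (cases "j \<le> i") (auto simp: commute abs_minus_commute)
qed

lemma step_bounds:
  assumes c: "c \<in> K" and g: "good_upto w z c n" and i: "- n \<le> i" "i < n"
  defines "b \<equiv> \<lambda>i. d w (orb c i)"
  shows "\<bar>(b (i + 1) - b i) - (b 1 - b 0)\<bar> \<le> 4 * \<rho>" "\<bar>b (i + 1) - b i\<bar> \<le> d (\<phi> c p) p"
    "d (\<phi> c p) p - 2 * \<rho> \<le> \<bar>b 1 - b 0\<bar>"
proof -
  have cc: "c \<in> carrier G" using c kernel_carrier by blast
  have G: "good w z (c [^] j)" if "- n \<le> j" "j \<le> n" for j using g that by (simp add: good_upto_def)
  have G0: "good w z (c [^] (0::int))" and G1: "good w z (c [^] (1::int))" using G[of 0] G[of 1] i by auto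
  have Gi: "good w z (c [^] i)" "good w z (c [^] (i + 1))" using G[of i] G[of "i + 1"] i by auto
  have s: "c \<otimes> c [^] (0::int) = c [^] (1::int)" using cc by simp
  show "\<bar>(b (i + 1) - b i) - (b 1 - b 0)\<bar> \<le> 4 * \<rho>"
    using shift[OF c Gi(1) G0 Gi(2)[unfolded pow_Suc[OF c]] G1[folded s]] unfolding b_def pow_Suc[OF c] s .
  show "\<bar>b (i + 1) - b i\<bar> \<le> d (\<phi> c p) p"
    using dist_Lipschitz[OF goodD(2)[OF G0] orb_in[OF c, of "i + 1"] orb_in[OF c, of i]] orb_step[OF c, of i]
    by (simp add: b_def)
  show "d (\<phi> c p) p - 2 * \<rho> \<le> \<bar>b 1 - b 0\<bar>"
    using line[OF G1 G0] cc p by (simp add: b_def act_one)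
qed

text \<open>By \<open>line\<close> the first step has size at least
  \<open>d (\<phi> c p) p - 2 * \<rho>\<close>, and by \<open>shift\<close> every other step differs
  from it by at most \<open>4 * \<rho>\<close>; hence \<open>6 * \<rho>\<close>. The sign
  \<open>s\<close> is the direction of the first step.\<close>

lemma progress:
  assumes c: "c \<in> K" and g: "good_upto w z c n" and up: "0 < s * (d w (orb c 1) - d w (orb c 0))"
    and s: "s = 1 \<or> s = - 1" and ij: "- n \<le> i" "i \<le> j" "j \<le> n"
  shows "real_of_int (j - i) * (d (\<phi> c p) p - 6 * \<rho>) \<le> s * (d w (orb c j) - d w (orb c i))"
  using ij(2,1,3)
proof (induction j rule: int_ge_induct)
  case (step j)
  have *: "- n \<le> j" "j < n" using step by auto
  have "d (\<phi> c p) p - 6 * \<rho> \<le> s * (d w (orb c (j + 1)) - d w (orb c j))"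
    using step_bounds(1)[OF c g *] step_bounds(3)[OF c g *] up s by (auto simp: abs_le_iff)
  moreover have "real_of_int (j - i) * (d (\<phi> c p) p - 6 * \<rho>) \<le> s * (d w (orb c j) - d w (orb c i))"
    using step by simp
  ultimately show ?case by (simp add: algebra_simps)
qed simp

text \<open>The coordinates of the orbit of \<open>c\<close> run past that of
  \<open>\<phi> k p\<close> in steps of at most \<open>d (\<phi> c p) p\<close>, so one of them
  comes that close, and \<open>line\<close> turns close coordinates into close points.\<close>

lemma orbit_dense_in_kernel:
  assumes c: "c \<in> K" and l: "6 * \<rho> + 1 \<le> d (\<phi> c p) p" and k: "k \<in> K"
  shows "\<exists>i. d (orb c i) (\<phi> k p) \<le> d (\<phi> c p) p + 2 * \<rho>"
proof -
  have cc: "c \<in> carrier G" using c kernel_carrier by blast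
  \<comment> \<open>Each step gains at least 1, so \<open>n\<close> steps in either direction reach
    the coordinate of \<open>\<phi> k p\<close>.\<close>
  define n where "n = max 1 \<lceil>d (\<phi> k p) p\<rceil>"
  have n: "1 \<le> n" "d (\<phi> k p) p \<le> real_of_int n" by (auto simp: n_def) linarith
  obtain w z where g: "good_upto w z c n" and gk: "good w z k" by (rule good_upto_exists[OF c k])
  define b where "b i = d w (orb c i)" for i
  define \<tau> where "\<tau> = d w (\<phi> k p)"
  have i0: "- n \<le> 0" "0 < n" using n by auto
  have "2 * \<rho> < d (\<phi> c p) p" using l \<rho> by simp
  then have "b 1 - b 0 \<noteq> 0" using step_bounds(3)[OF c g i0] by (auto simp: b_def)
  then obtain s :: real where s: "s = 1 \<or> s = - 1" and up: "0 < s * (b 1 - b 0)"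
    by (cases "0 < b 1 - b 0") (auto intro: that[of 1] that[of "-1"])
  have ln: "real_of_int n \<le> real_of_int n * (d (\<phi> c p) p - 6 * \<rho>)"
    using n l mult_left_mono[of 1 "d (\<phi> c p) p - 6 * \<rho>" "real_of_int n"] by simp
  have "\<bar>\<tau> - b 0\<bar> \<le> d (\<phi> k p) p"
    using dist_Lipschitz[OF goodD(2)[OF gk] goodD(7)[OF gk] p] p by (simp add: \<tau>_def b_def act_one)
  then have \<tau>: "\<bar>\<tau> - b 0\<bar> \<le> real_of_int n" using n by linarith
  have "real_of_int (n - 0) * (d (\<phi> c p) p - 6 * \<rho>) \<le> s * (b n - b 0)"
    "real_of_int (0 - (- n)) * (d (\<phi> c p) p - 6 * \<rho>) \<le> s * (b 0 - b (- n))"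
    unfolding b_def by (rule progress[OF c g up[unfolded b_def] s]; use n in simp)+
  then have ends: "s * b (- n) \<le> s * \<tau>" "s * \<tau> \<le> s * b n"
    using ln \<tau> s by (auto simp: abs_le_iff)
  define f where "f j = s * b (int j - n)" for j :: nat
  have "\<exists>j\<le>nat (2 * n). \<bar>f j - s * \<tau>\<bar> \<le> d (\<phi> c p) p"
  proof (rule discrete_IVT)
    show "f 0 \<le> s * \<tau>" "s * \<tau> \<le> f (nat (2 * n))" using ends n by (auto simp: f_def)
    show "0 \<le> d (\<phi> c p) p" by simp
    fix j assume "j < nat (2 * n)"
    then have j: "- n \<le> int j - n" "int j - n < n" by auto
    have e: "int (Suc j) - n = int j - n + 1" by simp
    show "\<bar>f (Suc j) - f j\<bar> \<le> d (\<phi> c p) p"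
      unfolding f_def e using step_bounds(2)[OF c g j] s
      by (auto simp: b_def abs_minus_commute)
  qed
  then obtain j where j: "j \<le> nat (2 * n)" "\<bar>f j - s * \<tau>\<bar> \<le> d (\<phi> c p) p" by blast
  define i where "i = int j - n"
  have i: "\<bar>i\<bar> \<le> n" using j n by (auto simp: i_def)
  have "\<bar>b i - \<tau>\<bar> \<le> d (\<phi> c p) p" using j(2) s by (auto simp: f_def i_def abs_minus_commute)
  moreover have "d (orb c i) (\<phi> k p) \<le> \<bar>b i - \<tau>\<bar> + 2 * \<rho>"
    using line[OF _ gk] g i by (simp add: good_upto_def b_def \<tau>_def)
  ultimately show ?thesis by (intro exI[of _ i]) linarith
qed

text \<open>The coset of \<open>k\<close> contains \<open>inv (c [^] i) \<otimes> k\<close>, which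
  moves \<open>p\<close> by at most \<open>r\<close>; so finitely many representatives
  suffice.\<close>

lemma finite_index_criterion:
  assumes c: "c \<in> K" and E: "finite {k \<in> K. d (\<phi> k p) p \<le> r}"
    and dense: "\<And>k. k \<in> K \<Longrightarrow> \<exists>i. d (orb c i) (\<phi> k p) \<le> r"
  shows "virtually_cyclic (G\<lparr>carrier := K\<rparr>)"
proof -
  let ?K = "G\<lparr>carrier := K\<rparr>" and ?H = "range (\<lambda>i::int. c [^] i)"
  have cc: "c \<in> carrier G" using c kernel_carrier by blast
  have "?H = generate G {c}" using generate_pow[OF cc] by auto
  then have HG: "subgroup ?H G" using generate_is_subgroup[of "{c}"] cc by simp
  have HK: "?H \<subseteq> K" using kernel_pow[OF c] by auto
  have H: "subgroup ?H ?K" using subgroup_incl[OF HG kernel_subgroup HK] .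
  have gK: "group ?K" using subgroup_imp_group[OF kernel_subgroup] .
  have gH: "group (G\<lparr>carrier := ?H\<rparr>)" using subgroup_imp_group[OF HG] .
  have "cyclic_group (G\<lparr>carrier := ?H\<rparr>)"
    unfolding group.cyclic_group[OF gH]
  proof (rule bexI)
    have "c \<in> ?H" using int_pow_1[OF cc] by (metis rangeI)
    then show "c \<in> carrier (G\<lparr>carrier := ?H\<rparr>)" by simp
    show "carrier (G\<lparr>carrier := ?H\<rparr>) = range (\<lambda>n::int. c [^]\<^bsub>G\<lparr>carrier := ?H\<rparr>\<^esub> n)"
      unfolding int_pow_consistent[OF HG \<open>c \<in> ?H\<close>, symmetric] by simp
  qed
  moreover have "finite (rcosets\<^bsub>?K\<^esub> ?H)"
  proof (rule finite_subset)
    show "rcosets\<^bsub>?K\<^esub> ?H \<subseteq> (\<lambda>e. ?H #>\<^bsub>?K\<^esub> e) ` {k \<in> K. d (\<phi> k p) p \<le> r}"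
    proof
      fix S assume "S \<in> rcosets\<^bsub>?K\<^esub> ?H"
      then obtain k where k: "k \<in> K" "S = ?H #>\<^bsub>?K\<^esub> k" by (auto simp: RCOSETS_def)
      obtain i where i: "d (orb c i) (\<phi> k p) \<le> r" using dense[OF k(1)] by blast
      define e where "e = inv (c [^] i) \<otimes> k"
      have e: "e \<in> K" unfolding e_def using kernel_mult kernel_inv kernel_pow[OF c] k by blast
      have kc: "k \<in> carrier G" using k kernel_carrier by blast
      have "d (\<phi> e p) p = d (\<phi> k p) (orb c i)"
        using act_dist_inv[of "c [^] i" "\<phi> k p" p] cc kc p by (simp add: e_def act_mult act_in)
      then have "e \<in> {k \<in> K. d (\<phi> k p) p \<le> r}" using e i by (simp add: commute)
      moreover have "S = ?H #>\<^bsub>?K\<^esub> e"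
      proof -
        have "e \<in> ?H #>\<^bsub>?K\<^esub> k"
          using int_pow_neg[OF cc, of i] by (auto simp: r_coset_def e_def intro!: exI[of _ "- i"])
        then show ?thesis using group.repr_independence[OF gK _ _ H] k by simp
      qed
      ultimately show "S \<in> (\<lambda>e. ?H #>\<^bsub>?K\<^esub> e) ` {k \<in> K. d (\<phi> k p) p \<le> r}" by blast
    qed
  qed (use E in simp)
  ultimately show ?thesis unfolding virtually_cyclic_def using gK H by auto
qed

end

section \<open>Choosing the direction of a translation\<close>

context bottleneck_action begin

lemma good_upto_0:
  assumes c: "c \<in> K" and g: "good_upto w z c n" and n: "1 \<le> n"
  shows "good w z \<one>" "orb c 0 = p" "orb c 1 = \<phi> c p" "good w z c"
proof -
  have "good w z (c [^] (0::int))" "good w z (c [^] (1::int))" using g[unfolded good_upto_def, rule_format, of 0] g[unfolded good_upto_def, rule_format, of 1] n by simp_all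
  then show "good w z \<one>" "orb c 0 = p" "orb c 1 = \<phi> c p" "good w z c"
    using kernel_carrier[OF c] p by (simp_all add: act_one)
qed

lemma moves_up:
  assumes c: "c \<in> K" and g: "good_upto w z c n" and n: "1 \<le> n" and B: "\<phi> c p \<in> B 2"
  shows "d (\<phi> c p) p - \<rho> \<le> d w (orb c 1) - d w (orb c 0)"
proof -
  note g0 = good_upto_0[OF c g n]
  have X: "\<phi> c p \<in> X" using act_in kernel_carrier[OF c] p by blast
  have "d w (\<phi> \<one> p) + d (\<phi> \<one> p) (\<phi> c p) \<le> d w (\<phi> c p) + \<rho>"
    by (rule right[OF goodD(1-3)[OF g0(1)] X, of 2]) (use B X in \<open>simp_all add: act_one\<close>)
  then show ?thesis unfolding g0(2,3) using p by (simp add: act_one commute)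
qed

lemma moves_down:
  assumes c: "c \<in> K" and g: "good_upto w z c n" and n: "1 \<le> n" and A: "\<phi> c p \<in> A 3"
  shows "d w (orb c 1) - d w (orb c 0) \<le> 2 * \<rho> - d (\<phi> c p) p"
proof -
  note g0 = good_upto_0[OF c g n]
  have X: "\<phi> c p \<in> X" using act_in kernel_carrier[OF c] p by blast
  have l: "d (\<phi> c p) (\<phi> \<one> p) + d (\<phi> \<one> p) z \<le> d (\<phi> c p) z + \<rho>"
    by (rule left[OF goodD(1)[OF g0(1)] goodD(4,5)[OF g0(1)] X, of 3]) (use A X in \<open>simp_all add: act_one\<close>)
  from left_dist[OF g0(1) X middle[OF g0(4)] l] show ?thesis
    unfolding g0(2,3) using p by (simp add: act_one)
qed

text \<open>Either \<open>c\<close> or its inverse moves \<open>p\<close> to the right. If neither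
  did, the steps of the orbit of \<open>c\<close> into and out of \<open>p\<close> would have
  opposite signs, which \<open>shift\<close> forbids for a large displacement.\<close>

lemma translation_exists:
  assumes c: "c \<in> K" and l: "10 * \<rho> + 1 \<le> d (\<phi> c p) p"
  obtains c' where "c' \<in> K" "\<phi> c' p \<in> B 2" "10 * \<rho> + 1 \<le> d (\<phi> c' p) p"
proof (cases "\<phi> c p \<in> B 2")
  case True
  then show ?thesis using that c l by blast
next
  case False
  have cc: "c \<in> carrier G" using kernel_carrier[OF c] .
  have A: "\<phi> c p \<in> A 3" using cover[of 2 "\<phi> c p"] act_in[OF cc p] False by auto
  have dist: "d (\<phi> (inv c) p) p = d (\<phi> c p) p"
    using act_dist_inv[OF cc p p] by (simp add: commute)
  have "\<phi> (inv c) p \<in> B 2"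
  proof (rule ccontr)
    assume "\<phi> (inv c) p \<notin> B 2"
    then have A': "\<phi> (inv c) p \<in> A 3" using cover[of 2 "\<phi> (inv c) p"] act_in[of "inv c" p] cc p by auto
    obtain w z where g: "good_upto w z c 1" and "good w z c" by (rule good_upto_exists[OF c c])
    have g': "good_upto w z (inv c) 1"
      using g cc unfolding good_upto_def by (metis abs_minus_cancel int_pow_inv int_pow_neg)
    note ic = kernel_inv[OF c]
    have "d w (orb c 1) - d w (orb c 0) \<le> 2 * \<rho> - d (\<phi> c p) p" by (rule moves_down[OF c g _ A]) simp
    moreover have "d w (orb (inv c) 1) - d w (orb (inv c) 0) \<le> 2 * \<rho> - d (\<phi> c p) p"
      using moves_down[OF ic g' _ A'] dist by simp
    moreover have "\<bar>(d w (orb c (- 1 + 1)) - d w (orb c (- 1))) - (d w (orb c 1) - d w (orb c 0))\<bar> \<le> 4 * \<rho>"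
      using step_bounds(1)[OF c g, of "- 1"] by simp
    moreover have "orb c (- 1) = orb (inv c) 1" "orb (inv c) 0 = orb c 0"
      using cc by (simp_all add: int_pow_neg)
    ultimately show False using l \<rho> by simp
  qed
  then show ?thesis using that[of "inv c"] kernel_inv[OF c] dist l by simp
qed

end

section \<open>Infinite coarse kernels\<close>

text \<open>\<open>long\<close> pays for the \<open>6 * \<rho>\<close> lost per step in
  \<open>progress\<close> and keeps the gain \<open>l\<close> at least 1. The bound \<open>C\<close>
  is the membership of \<open>c\<close> in the coarse kernel, and it later bounds the distance of
  all of \<open>X\<close> from the axis.\<close>

locale translation = bottleneck_action X d G \<phi> A B p \<rho>
  for X :: "'a set" and d :: "'a \<Rightarrow> 'a \<Rightarrow> real" and G :: "('g, 'm) monoid_scheme" (structure)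
    and \<phi> :: "'g \<Rightarrow> 'a \<Rightarrow> 'a" and A B p \<rho> +
  fixes c :: 'g and C :: real
  assumes c: "c \<in> K" and cB: "\<phi> c p \<in> B 2" and long: "10 * \<rho> + 1 \<le> d (\<phi> c p) p"
    and C: "\<And>x. x \<in> X \<Longrightarrow> d (\<phi> c x) x \<le> C"
begin

text \<open>The gain of coordinate per step that \<open>progress\<close> guarantees.\<close>

definition l :: real where "l = d (\<phi> c p) p - 6 * \<rho>"

lemma l: "1 \<le> l"
  using long \<rho> by (simp add: l_def)

abbreviation tr :: "int \<Rightarrow> 'a \<Rightarrow> 'a" where "tr i \<equiv> \<phi> (c [^] i)"

lemma cc: "c \<in> carrier G"
  using c by (rule kernel_carrier)

lemma tr_in: "x \<in> X \<Longrightarrow> tr i x \<in> X"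
  using act_in cc by simp

lemma tr_add: "x \<in> X \<Longrightarrow> tr i (tr j x) = tr (i + j) x"
  using cc by (simp add: int_pow_mult act_mult)

lemma tr_1: "tr 1 x = \<phi> c x"
  using cc by simp

lemma tr_dist: "x \<in> X \<Longrightarrow> y \<in> X \<Longrightarrow> d (tr i x) (tr i y) = d x y"
  using act_dist cc by simp

lemma inv_tr: "inv (c [^] i) = c [^] (- i :: int)"
  using cc by (simp add: int_pow_neg)

text \<open>\<open>cB\<close> fixes the direction: the coordinate increases along positive powers,
  whichever \<open>w\<close> is chosen.\<close>

lemma axis:
  assumes n: "1 \<le> n"
  obtains w z where "good_upto w z c n"
    "\<And>i j. - n \<le> i \<Longrightarrow> i \<le> j \<Longrightarrow> j \<le> n \<Longrightarrow> real_of_int (j - i) * l \<le> d w (tr j p) - d w (tr i p)"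
proof -
  obtain w z where g: "good_upto w z c n" and "good w z c" by (rule good_upto_exists[OF c c])
  have "d (\<phi> c p) p - \<rho> \<le> d w (orb c 1) - d w (orb c 0)" by (rule moves_up[OF c g n cB])
  then have up: "0 < 1 * (d w (orb c 1) - d w (orb c 0))" using long \<rho> by simp
  have "real_of_int (j - i) * l \<le> d w (tr j p) - d w (tr i p)" if "- n \<le> i" "i \<le> j" "j \<le> n" for i j
    using progress[OF c g up _ that] by (simp add: l_def)
  then show ?thesis using that g by blast
qed

lemma orbit_expands: "real_of_int \<bar>i - j\<bar> * l \<le> d (tr i p) (tr j p)"
proof -
  have *: "real_of_int (j - i) * l \<le> d (tr i p) (tr j p)" if "i \<le> j" for i j
  proof -
    define n where "n = max 1 (max \<bar>i\<bar> \<bar>j\<bar>)"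
    have n: "1 \<le> n" "- n \<le> i" "j \<le> n" by (auto simp: n_def)
    obtain w z where g: "good_upto w z c n"
      and b: "\<And>i j. - n \<le> i \<Longrightarrow> i \<le> j \<Longrightarrow> j \<le> n \<Longrightarrow> real_of_int (j - i) * l \<le> d w (tr j p) - d w (tr i p)"
      using axis[OF n(1)] by blast
    have "w \<in> X" using goodD(2)[OF good_upto_0(1)[OF c g n(1)]] .
    then show ?thesis
      using b[OF n(2) that n(3)] dist_Lipschitz[of w "tr j p" "tr i p"] tr_in[OF p]
      by (simp add: commute)
  qed
  from *[of i j] *[of j i] show ?thesis by (cases "i \<le> j") (auto simp: commute)
qed

text \<open>\<open>tr i p\<close> lies between \<open>w\<close> and \<open>x\<close>, and its
  coordinate exceeds that of \<open>p\<close> by at least \<open>i * l\<close>.\<close>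

lemma right_far:
  assumes x: "x \<in> X" and i: "0 \<le> i" and B: "tr (- i) x \<in> B 2"
  shows "real_of_int i * l - \<rho> \<le> d x p"
proof -
  define n where "n = max 1 i"
  have n: "1 \<le> n" "\<bar>i\<bar> \<le> n" using i by (auto simp: n_def)
  obtain w z where g: "good_upto w z c n"
    and b: "\<And>i j. - n \<le> i \<Longrightarrow> i \<le> j \<Longrightarrow> j \<le> n \<Longrightarrow> real_of_int (j - i) * l \<le> d w (tr j p) - d w (tr i p)"
    using axis[OF n(1)] by blast
  have gi: "good w z (c [^] i)" using g n by (simp add: good_upto_def)
  have "d w (tr i p) + d (tr i p) x \<le> d w x + \<rho>"
    by (rule right[OF goodD(1-3)[OF gi] x, of 2]) (use B in \<open>simp_all add: inv_tr\<close>)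
  moreover have "d w x \<le> d w p + d x p"
    using triangle[OF goodD(2)[OF gi] p x] by (simp add: commute)
  moreover have "real_of_int i * l \<le> d w (tr i p) - d w p"
    using b[of 0 i] n i p by (simp add: act_one)
  ultimately show ?thesis using nonneg[of "tr i p" x] by linarith
qed

text \<open>The mirror image of \<open>right_far\<close>, with coordinates still measured from
  \<open>w\<close>; passing from \<open>z\<close> to \<open>w\<close> by \<open>middle\<close> costs
  the second \<open>\<rho>\<close>.\<close>

lemma left_far:
  assumes x: "x \<in> X" and i: "0 \<le> i" and A: "tr i x \<in> A 5"
  shows "real_of_int i * l - 2 * \<rho> \<le> d x p"
proof -
  define n where "n = max 1 i"
  have n: "1 \<le> n" "\<bar>- i\<bar> \<le> n" "i \<le> n" using i by (auto simp: n_def)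
  obtain w z where g: "good_upto w z c n"
    and b: "\<And>i j. - n \<le> i \<Longrightarrow> i \<le> j \<Longrightarrow> j \<le> n \<Longrightarrow> real_of_int (j - i) * l \<le> d w (tr j p) - d w (tr i p)"
    using axis[OF n(1)] by blast
  have gi: "good w z (c [^] (- i))" using g n unfolding good_upto_def by blast
  have g0: "good w z \<one>" by (rule good_upto_0(1)[OF c g n(1)])
  have "d x (tr (- i) p) + d (tr (- i) p) z \<le> d x z + \<rho>"
    by (rule left[OF goodD(1)[OF gi] goodD(4,5)[OF gi] x, of 5]) (use A in \<open>simp_all add: inv_tr\<close>)
  moreover have "d w z \<le> d w (tr (- i) p) + d (tr (- i) p) z"
    using triangle[OF goodD(2,7,4)[OF gi]] .
  moreover have "d w p + d p z \<le> d w z + \<rho>" using middle[OF g0] p by (simp add: act_one)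
  moreover have "d x z \<le> d x p + d p z" using triangle[OF x p goodD(4)[OF gi]] .
  moreover have "real_of_int i * l \<le> d w p - d w (tr (- i) p)"
    using b[of "- i" 0] n i p by (simp add: act_one)
  ultimately show ?thesis using nonneg[of x "tr (- i) p"] by linarith
qed

text \<open>If \<open>y\<close> is to the right of \<open>p\<close>, then \<open>\<phi> c y\<close>
  is to the right of \<open>\<phi> c p\<close>. Were it also to the left of \<open>p\<close>, adding
  up the bottleneck inequalities would make the step from \<open>p\<close> to
  \<open>\<phi> c p\<close> short.\<close>

lemma translate_right:
  assumes y: "y \<in> X" "y \<in> B 2"
  shows "\<phi> c y \<notin> A 5"
proof
  assume A: "\<phi> c y \<in> A 5"
  define x where "x = \<phi> c y"
  have xX: "x \<in> X" using act_in[OF cc y(1)] by (simp add: x_def)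
  obtain w z where g: "good_upto w z c 1" and gc: "good w z c" by (rule good_upto_exists[OF c c])
  have g0: "good w z \<one>" using good_upto_0(1)[OF c g] by simp
  have m: "d (\<phi> c p) p - \<rho> \<le> d w (\<phi> c p) - d w p"
    using moves_up[OF c g _ cB] good_upto_0(2,3)[OF c g] by simp
  have cp: "\<phi> c p \<in> X" by (rule goodD(7)[OF gc])
  have "d w (\<phi> c p) + d (\<phi> c p) x \<le> d w x + \<rho>"
    by (rule right[OF goodD(1-3)[OF gc] xX, of 2]) (use y act_inv(1)[OF cc y(1)] in \<open>simp_all add: x_def\<close>)
  moreover have "d x (\<phi> \<one> p) + d (\<phi> \<one> p) z \<le> d x z + \<rho>"
    by (rule left[OF goodD(1)[OF g0] goodD(4,5)[OF g0] xX, of 5]) (use A xX in \<open>simp_all add: act_one x_def\<close>)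
  then have "d x p + d p z \<le> d x z + \<rho>" using p by (simp add: act_one)
  moreover have "d x z \<le> d (\<phi> c p) x + d (\<phi> c p) z"
    using triangle[OF xX cp goodD(4)[OF gc]] by (simp add: commute)
  moreover have "d w (\<phi> c p) + d (\<phi> c p) z \<le> d w z + \<rho>" by (rule middle[OF gc])
  moreover have "d w z \<le> d w p + d p z" using triangle[OF goodD(2)[OF gc] p goodD(4)[OF gc]] .
  moreover have "d w x \<le> d w p + d x p" using triangle[OF goodD(2)[OF gc] p xX] by (simp add: commute)
  ultimately show False using m long \<rho> by linarith
qed

text \<open>Some power of \<open>c\<close> takes \<open>x\<close> to a point \<open>y\<close> past
  the bottleneck whose predecessor \<open>a\<close> is still before it. Two applications of
  \<open>c\<close> carry \<open>a\<close> across the bottleneck over a distance of at most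
  \<open>2 * C\<close>, so \<open>p\<close> is near.\<close>

lemma orbit_coarsely_dense:
  assumes x: "x \<in> X"
  shows "\<exists>i. d x (tr i p) \<le> 3 * C + \<rho>"
proof -
  define k where "k = \<lceil>(d x p + 2 * \<rho>) / l\<rceil> + 1"
  have l0: "0 < l" using l by simp
  have "0 \<le> (d x p + 2 * \<rho>) / l" using l0 \<rho> by simp
  then have k: "0 \<le> k" "(d x p + 2 * \<rho>) / l < real_of_int k" unfolding k_def by linarith+
  then have kl: "d x p + 2 * \<rho> < real_of_int k * l" using l0 by (simp add: pos_divide_less_eq)
  have "tr (- k) x \<notin> B 2" using right_far[OF x k(1)] kl \<rho> by linarith
  have "tr k x \<notin> A 5" using left_far[OF x k(1)] kl by linarith
  then have "tr k x \<notin> A 3" using A_mono[of 3 5] by auto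
  then have start: "tr k x \<in> B 2" using cover[of 2 "tr k x"] tr_in[OF x] by auto
  \<comment> \<open>\<open>x\<close> is on the right after a high power of \<open>c\<close> and not
    on the right after a high negative one, so it changes sides at some exponent.\<close>
  have "\<exists>i. tr (- i) x \<in> B 2 \<and> tr (- (i + 1)) x \<notin> B 2"
  proof (rule ccontr)
    assume "\<not> ?thesis"
    then have step: "tr (- (i + 1)) x \<in> B 2" if "tr (- i) x \<in> B 2" for i using that by blast
    have "tr (- j) x \<in> B 2" if "- k \<le> j" for j
      using that by (induction j rule: int_ge_induct) (use start step in auto)
    then show False using \<open>tr (- k) x \<notin> B 2\<close> k(1) by auto
  qed
  then obtain i where i: "tr (- i) x \<in> B 2" "tr (- (i + 1)) x \<notin> B 2" by blast
  define y where "y = tr (- i) x"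
  have y: "y \<in> X" "y \<in> B 2" using i tr_in[OF x] by (auto simp: y_def)
  define a where "a = tr (- (i + 1)) x"
  have aX: "a \<in> X" and aA: "a \<in> A 3"
    using i cover[of 2 a] tr_in[OF x] by (auto simp: a_def)
  have ya: "\<phi> c a = y" using tr_add[OF x, of 1 "- (i + 1)"] by (simp add: a_def y_def tr_1)
  have b: "\<phi> c y \<in> X" "\<phi> c y \<in> B 3"
    using act_in[OF cc y(1)] translate_right[OF y] cover[of 4 "\<phi> c y"] B_mono[of 3 4] by auto
  \<comment> \<open>This sum is at most \<open>2 * C + \<rho>\<close>; one more displacement
    \<open>C\<close>, from \<open>\<phi> c y\<close> back to \<open>y\<close>, gives
    \<open>3 * C + \<rho>\<close>.\<close>
  have "d a p + d p (\<phi> c y) \<le> d a (\<phi> c y) + \<rho>" using bottle[of 3 a "\<phi> c y"] aA b by simp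
  moreover have "d a y \<le> C" using C[OF aX] ya by (simp add: commute)
  moreover have "d (\<phi> c y) y \<le> C" using C[OF y(1)] .
  moreover have "d a (\<phi> c y) \<le> d a y + d y (\<phi> c y)" using triangle[OF aX y(1) b(1)] .
  moreover have "d y p \<le> d y (\<phi> c y) + d (\<phi> c y) p" using triangle[OF y(1) b(1) p] .
  ultimately have "d y p \<le> 3 * C + \<rho>"
    using nonneg[of a p] commute[of p "\<phi> c y"] commute[of y "\<phi> c y"] by linarith
  moreover have "d x (tr i p) = d y p"
    using tr_dist[OF x tr_in[OF p], of "- i" i] p by (simp add: tr_add act_one y_def)
  ultimately show ?thesis by (intro exI[of _ i]) simp
qed

end

section \<open>Translates of one curtain along the axis\<close>

locale curtain_translation =
  translation X d G \<phi> "\<lambda>i. M (5 * i)" "\<lambda>i. P (5 * i + 4)" p \<rho> c C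
  for X :: "'a set" and d :: "'a \<Rightarrow> 'a \<Rightarrow> real" and G :: "('g, 'm) monoid_scheme" (structure)
    and \<phi> :: "'g \<Rightarrow> 'a \<Rightarrow> 'a" and M P :: "nat \<Rightarrow> 'a set" and p \<rho> c C +
  fixes h :: "nat \<Rightarrow> 'a set" and L :: nat
  assumes nested_h: "nested 40 h M P"
    and L_sep: "\<And>i j. i < 40 \<Longrightarrow> j < 40 \<Longrightarrow> i \<noteq> j \<Longrightarrow> L_separated X d L (h i) (h j)"
begin

text \<open>\<open>h 15\<close> is the first curtain of level 3. It lies in \<open>P 14\<close>, the
  set \<open>B 2\<close> from which \<open>translate_right\<close> starts, and \<open>M 25\<close>
  is the set \<open>A 5\<close> that the lemma excludes; so \<open>c\<close> carries
  \<open>h 15\<close> to \<open>h 25\<close> or beyond, past \<open>h 16\<close>.\<close>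

definition H :: "int \<Rightarrow> 'a set" where "H m = tr m ` h 15"
definition HM :: "int \<Rightarrow> 'a set" where "HM m = tr m ` M 15"
definition HP :: "int \<Rightarrow> 'a set" where "HP m = tr m ` P 15"

lemma h_halves: "i < 40 \<Longrightarrow> halves (h i) (M i) (P i)"
  by (rule nested_halves[OF nested_h])

lemma tr_isometry: "isometry (tr m)"
  using act_isometry cc by simp

lemma H_halves: "halves (H m) (HM m) (HP m)"
  unfolding H_def HM_def HP_def by (rule halves_isometry[OF tr_isometry h_halves]) simp

lemma tr_image: "S \<subseteq> X \<Longrightarrow> tr i ` tr j ` S = tr (i + j) ` S"
  by (auto simp: image_image subset_iff tr_add)

lemma translate_h:
  assumes "y \<in> h 15 \<union> P 15"
  shows "\<phi> c y \<in> h 25 \<union> P 25"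
proof -
  have "y \<in> P 14" using assms nested_plus[OF nested_h, of 14 15] by auto
  moreover have "y \<in> X" using assms halves_partition(5,7)[OF h_halves[of 15]] by auto
  ultimately have "\<phi> c y \<notin> M 25" "\<phi> c y \<in> X" using translate_right[of y] act_in cc by auto
  then show ?thesis using halves_partition(1)[OF h_halves[of 25]] by auto
qed

lemma M_h_subset: "M 15 \<union> h 15 \<subseteq> \<phi> c ` M 15"
proof
  fix x assume x: "x \<in> M 15 \<union> h 15"
  then have xX: "x \<in> X" using halves_partition(5,6)[OF h_halves[of 15]] by auto
  define y where "y = \<phi> (inv c) x"
  have y: "y \<in> X" "\<phi> c y = x" using act_in act_inv(2) cc xX by (auto simp: y_def)
  have "x \<in> M 25" using x nested_minus[OF nested_h, of 15 25] by auto
  then have "x \<notin> h 25 \<union> P 25" using halves_partition(2,3)[OF h_halves[of 25]] by auto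
  then have "y \<notin> h 15 \<union> P 15" using translate_h[of y] y by blast
  then have "y \<in> M 15" using y(1) halves_partition(1)[OF h_halves[of 15]] by auto
  then show "x \<in> \<phi> c ` M 15" using y by blast
qed

lemma nested_H: "nested n (\<lambda>i. H (a + int i)) (\<lambda>i. HM (a + int i)) (\<lambda>i. HP (a + int i))"
  unfolding nested_def
proof (intro conjI allI impI H_halves)
  fix i
  have MX: "M 15 \<subseteq> X" using halves_partition(6)[OF h_halves[of 15]] by simp
  have "HM (a + int i) \<union> H (a + int i) = tr (a + int i) ` (M 15 \<union> h 15)"
    by (simp add: HM_def H_def image_Un)
  also have "\<dots> \<subseteq> tr (a + int i) ` tr 1 ` M 15"
    unfolding tr_1 by (rule image_mono[OF M_h_subset])
  also have "\<dots> = HM (a + int (Suc i))"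
    unfolding tr_image[OF MX] HM_def by (simp add: add.commute add.left_commute)
  finally show "HM (a + int i) \<union> H (a + int i) \<subseteq> HM (a + int (Suc i))" .
qed

lemma H_after: "1 \<le> j \<Longrightarrow> H j \<subseteq> P 16"
proof -
  assume j: "1 \<le> j"
  have "H j \<subseteq> H 1 \<union> HP 1"
  proof (cases "j = 1")
    case False
    then have "0 < nat (j - 1)" "nat (j - 1) < nat j" "1 + int (nat (j - 1)) = j" using j by auto
    then show ?thesis using nested_plus[OF nested_H[of "nat j" 1], of 0 "nat (j - 1)"] by auto
  qed simp
  also have "\<dots> \<subseteq> h 25 \<union> P 25" unfolding H_def HP_def tr_1 using translate_h by auto
  also have "\<dots> \<subseteq> P 16" using nested_plus[OF nested_h, of 16 25] by auto
  finally show "H j \<subseteq> P 16" .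
qed

text \<open>A curtain meeting \<open>h 15\<close> and a later translate of it must cross \<open>h 16\<close>.\<close>
lemma L_separated_H_later:
  assumes j: "1 \<le> j"
  shows "L_separated X d L (h 15) (H j)"
  unfolding L_separated_def
proof (intro conjI allI impI)
  note h15 = h_halves[of 15, simplified] and h16 = h_halves[of 16, simplified]
  show "is_curtain X d (h 15)" "is_curtain X d (H j)"
    unfolding is_curtain_iff using h15 H_halves by blast+
  have hM: "h 15 \<subseteq> M 16" using nested_minus[OF nested_h, of 15 16] by auto
  then show "h 15 \<inter> H j = {}"
    using H_after[OF j] halves_partition(3)[OF h16] by blast
  fix ch assume ch: "curtain_chain X d ch" "\<forall>k\<in>ch. k \<inter> h 15 \<noteq> {} \<and> k \<inter> H j \<noteq> {}"
  have "k \<inter> h 15 \<noteq> {} \<and> k \<inter> h 16 \<noteq> {}" if k: "k \<in> ch" for k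
  proof -
    have "is_curtain X d k" using ch(1) k by (simp add: curtain_chain_def)
    then obtain M' P' where k': "halves k M' P'" unfolding is_curtain_iff by blast
    obtain x y where "x \<in> k" "x \<in> M 16" "y \<in> k" "y \<in> P 16"
      using ch(2) k hM H_after[OF j] by blast
    then have "k \<inter> h 16 \<noteq> {}"
      using halves_meet[OF h16 halves_connected(1)[OF k'] halves_partition(5)[OF k']] by blast
    then show ?thesis using ch(2) k by blast
  qed
  then show "finite ch" "card ch \<le> L"
    using L_sep[of 15 16] ch(1) unfolding L_separated_def by auto
qed

lemma L_separated_commute: "L_separated X d L k k' \<Longrightarrow> L_separated X d L k' k"
  unfolding L_separated_def by (simp add: conj_commute Int_commute)

lemma L_separated_H: "i \<noteq> j \<Longrightarrow> L_separated X d L (H i) (H j)"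
proof -
  have *: "L_separated X d L (H i) (H j)" if "i < j" for i j
  proof -
    have "tr i ` H (j - i) = H j"
      unfolding H_def using tr_image[of "h 15" i "j - i"] halves_partition(5)[OF h_halves[of 15]] by simp
    then show ?thesis
      using L_separated_isometry[OF tr_isometry L_separated_H_later[of "j - i"], of i] that by (simp add: H_def)
  qed
  assume "i \<noteq> j"
  then show ?thesis using *[of i j] L_separated_commute[OF *[of j i]] by (cases "i < j") auto
qed

text \<open>The chain consists of the \<open>H m\<close> with
  \<open>a + s \<le> m \<le> b - s\<close>. The margin \<open>s\<close> at both ends makes the gain
  \<open>s * l\<close> exceed the distance of \<open>u\<close> and \<open>v\<close> from their axis
  points plus the errors of \<open>right_far\<close> and \<open>left_far\<close>.\<close>

lemma d_L_along_axis:
  assumes u: "u \<in> X" "d u (tr a p) \<le> r" and v: "v \<in> X" "d v (tr b p) \<le> r"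
    and s: "0 \<le> s" "r + 2 * \<rho> < real_of_int s * l"
  shows "real_of_int (b - a - 2 * s) \<le> real (d_L X d L u v)"
proof (cases "b - a - 2 * s \<le> 0")
  case True
  then have "real_of_int (b - a - 2 * s) \<le> 0" by linarith
  then show ?thesis using of_nat_0_le_iff order_trans by blast
next
  case False
  \<comment> \<open>The number of integers from \<open>a + s\<close> to
    \<open>b - s\<close>.\<close>
  define n where "n = nat (b - a - 2 * s + 1)"
  define ch where "ch = (\<lambda>i. H (a + s + int i)) ` {..<n}"
  have n: "nested n (\<lambda>i. H (a + s + int i)) (\<lambda>i. HM (a + s + int i)) (\<lambda>i. HP (a + s + int i))"
    by (rule nested_H)
  have card: "card ch = n" unfolding ch_def using nested_inj[OF n] by (simp add: card_image)
  have "L_chain X d L ch"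
    unfolding L_chain_def
  proof (intro conjI ballI impI)
    show "curtain_chain X d ch" unfolding ch_def by (rule nested_chain[OF n])
    fix k k' assume k: "k \<in> ch" "k' \<in> ch" "k \<noteq> k'"
    then obtain i i' where kk': "k = H (a + s + int i)" "k' = H (a + s + int i')"
      unfolding ch_def by blast
    then have "a + s + int i \<noteq> a + s + int i'" using k(3) by auto
    with kk' show "L_separated X d L k k'" using L_separated_H by simp
  qed
  moreover have uv: "u \<in> HM m \<and> v \<in> HP m" if m: "a + s \<le> m" "m \<le> b - s" for m
  proof
    have "real_of_int s * l \<le> real_of_int (m - a) * l" "real_of_int s * l \<le> real_of_int (b - m) * l"
      using m l by (auto intro!: mult_right_mono)
    then have big: "r + 2 * \<rho> < real_of_int (m - a) * l" "r + 2 * \<rho> < real_of_int (b - m) * l"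
      using s(2) by linarith+
    have "tr (- m) u \<notin> P 14"
    proof
      assume B: "tr (- m) u \<in> P 14"
      have "real_of_int (m - a) * l - \<rho> \<le> d (tr (- a) u) p"
        by (rule right_far) (use u m s B in \<open>simp_all add: tr_in tr_add\<close>)
      moreover have "d (tr (- a) u) p = d u (tr a p)"
        using tr_dist[of u "tr a p" "- a"] u p by (simp add: tr_in tr_add act_one)
      ultimately show False using u(2) big(1) \<rho> by linarith
    qed
    then have "tr (- m) u \<in> M 15" using cover[of 2 "tr (- m) u"] tr_in[OF u(1)] by auto
    then have "tr m (tr (- m) u) \<in> HM m" unfolding HM_def by blast
    then show "u \<in> HM m" using u(1) by (simp add: tr_add act_one)
    have "tr (- m) v \<notin> M 25"
    proof
      assume A: "tr (- m) v \<in> M 25"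
      have "real_of_int (b - m) * l - 2 * \<rho> \<le> d (tr (- b) v) p"
        by (rule left_far) (use v m s A in \<open>simp_all add: tr_in tr_add\<close>)
      moreover have "d (tr (- b) v) p = d v (tr b p)"
        using tr_dist[of v "tr b p" "- b"] v p by (simp add: tr_in tr_add act_one)
      ultimately show False using v(2) big(2) \<rho> by linarith
    qed
    then have "tr (- m) v \<in> h 25 \<union> P 25"
      using halves_partition(1)[OF h_halves[of 25]] tr_in[OF v(1)] by auto
    then have "tr (- m) v \<in> P 15" using nested_plus[OF nested_h, of 15 25] by auto
    then have "tr m (tr (- m) v) \<in> HP m" unfolding HP_def by blast
    then show "v \<in> HP m" using v(1) by (simp add: tr_add act_one)
  qed
  have "chain_separates X d ch {u} {v}"
    unfolding chain_separates_def
  proof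
    fix k assume "k \<in> ch"
    then obtain i where i: "i < n" "k = H (a + s + int i)" by (auto simp: ch_def)
    then have "u \<in> HM (a + s + int i)" "v \<in> HP (a + s + int i)"
      using uv[of "a + s + int i"] False by (auto simp: n_def)
    then show "separates X d k {u} {v}"
      unfolding separates_iff i(2) using H_halves by blast
  qed
  moreover have "u \<noteq> v"
    using uv[of "a + s"] halves_partition(3)[OF H_halves[of "a + s"]] False by auto
  ultimately have "card ch + 1 \<le> d_L X d L u v" by (rule d_L_ge)
  then show ?thesis unfolding card using False by (simp add: n_def)
qed

end

section \<open>The curtain model\<close>

context CAT0 begin

context
  fixes lam :: "nat \<Rightarrow> real"
  assumes lam: "curtain_weights lam"
begin

lemma lam_pos: "1 \<le> L \<Longrightarrow> 0 < lam L"
  using lam by (simp add: curtain_weights_def)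

lemma summable_lam: "summable (\<lambda>n. lam (Suc n))" "summable (\<lambda>n. real (Suc n) * lam (Suc n))"
  using lam by (simp_all add: curtain_weights_def)

lemma summable_curtain_dist: "summable (\<lambda>n. lam (Suc n) * real (d_L X d (Suc n) u v))"
proof (rule summable_comparison_test')
  show "summable (\<lambda>n. lam (Suc n) * (d u v + 3))" by (rule summable_mult2[OF summable_lam(1)])
  show "norm (lam (Suc n) * real (d_L X d (Suc n) u v)) \<le> lam (Suc n) * (d u v + 3)" for n
    using lam_pos[of "Suc n"] d_L_le[of "Suc n" u v] by (simp add: abs_mult mult_left_mono)
qed

lemma curtain_dist_le: "curtain_dist X d lam u v \<le> (\<Sum>n. lam (Suc n)) * (d u v + 3)"
proof -
  have "curtain_dist X d lam u v \<le> (\<Sum>n. lam (Suc n) * (d u v + 3))"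
    unfolding curtain_dist_def
    using less_imp_le[OF lam_pos] d_L_le
    by (intro suminf_le summable_curtain_dist summable_mult2[OF summable_lam(1)] mult_left_mono) auto
  then show ?thesis by (simp add: suminf_mult2[OF summable_lam(1)])
qed

lemma curtain_dist_ge:
  assumes "1 \<le> L"
  shows "lam L * real (d_L X d L u v) \<le> curtain_dist X d lam u v"
proof -
  have "(\<Sum>n\<in>{L - 1}. lam (Suc n) * real (d_L X d (Suc n) u v)) \<le> curtain_dist X d lam u v"
    unfolding curtain_dist_def
    by (rule sum_le_suminf[OF summable_curtain_dist]) (use lam_pos in \<open>auto simp: less_imp_le\<close>)
  then show ?thesis using assms by simp
qed

text \<open>Puts the model under the library's notion of boundedness. Definiteness comes from the
  single term \<open>L = 1\<close>; the triangle inequality holds term by term.\<close>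

lemma curtain_metric: "Metric_space X (curtain_dist X d lam)"
proof
  fix x y
  show "0 \<le> curtain_dist X d lam x y"
    unfolding curtain_dist_def by (rule suminf_nonneg[OF summable_curtain_dist]) (use lam_pos in \<open>auto simp: less_imp_le\<close>)
  show "curtain_dist X d lam x y = curtain_dist X d lam y x"
    by (simp add: curtain_dist_def d_L_commute[of _ x y])
next
  fix x y
  show "(curtain_dist X d lam x y = 0) = (x = y)"
  proof
    assume "curtain_dist X d lam x y = 0"
    then have "lam 1 * real (d_L X d 1 x y) \<le> 0" using curtain_dist_ge[of 1 x y] by simp
    then have "d_L X d 1 x y = 0" using lam_pos[of 1] by (simp add: mult_le_0_iff)
    then show "x = y" by (simp add: d_L_def split: if_splits)
  qed (simp add: curtain_dist_def d_L_def)
next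
  fix x y z assume X: "x \<in> X" "y \<in> X" "z \<in> X"
  have "curtain_dist X d lam x z \<le>
      (\<Sum>n. lam (Suc n) * real (d_L X d (Suc n) x y) + lam (Suc n) * real (d_L X d (Suc n) y z))"
    unfolding curtain_dist_def
  proof (intro suminf_le summable_add summable_curtain_dist)
    fix n
    have "real (d_L X d (Suc n) x z) \<le> real (d_L X d (Suc n) x y) + real (d_L X d (Suc n) y z)"
      using d_L_triangle[OF X, of "Suc n"] by linarith
    then have "lam (Suc n) * real (d_L X d (Suc n) x z) \<le>
        lam (Suc n) * (real (d_L X d (Suc n) x y) + real (d_L X d (Suc n) y z))"
      using lam_pos[of "Suc n"] by simp
    then show "lam (Suc n) * real (d_L X d (Suc n) x z) \<le>
        lam (Suc n) * real (d_L X d (Suc n) x y) + lam (Suc n) * real (d_L X d (Suc n) y z)"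
      by (simp add: distrib_left)
  qed
  also have "\<dots> = curtain_dist X d lam x y + curtain_dist X d lam y z"
    unfolding curtain_dist_def by (rule suminf_add[symmetric]; rule summable_curtain_dist)
  finally show "curtain_dist X d lam x z \<le> curtain_dist X d lam x y + curtain_dist X d lam y z" .
qed

text \<open>Each \<open>d_L\<close> is at most \<open>d + 3\<close>, so \<open>D\<close> is at most
  a constant times \<open>d + 3\<close>, and a bounded \<open>X\<close> would have bounded
  \<open>D\<close>.\<close>

lemma curtain_unbounded_far:
  assumes S: "S \<subseteq> X" and unb: "\<not> Metric_space.mbounded X (curtain_dist X d lam) S"
  shows "far X"
proof (rule ccontr)
  interpret D: Metric_space X "curtain_dist X d lam" by (rule curtain_metric)
  assume "\<not> far X"
  then obtain x0 C0 where x0: "x0 \<in> X" "\<And>y. y \<in> X \<Longrightarrow> d x0 y \<le> C0"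
    unfolding far_def by (meson not_less)
  have "curtain_dist X d lam x y \<le> (\<Sum>n. lam (Suc n)) * (2 * C0 + 3)" if "x \<in> S" "y \<in> S" for x y
  proof -
    have X: "x \<in> X" "y \<in> X" using that S by auto
    have "d x y \<le> 2 * C0" using x0(2)[OF X(1)] x0(2)[OF X(2)] triangle[OF X(1) x0(1) X(2)] by (simp add: commute)
    moreover have "0 \<le> (\<Sum>n. lam (Suc n))"
      by (rule suminf_nonneg[OF summable_lam(1)]) (use lam_pos in \<open>auto simp: less_imp_le\<close>)
    ultimately have "(\<Sum>n. lam (Suc n)) * (d x y + 3) \<le> (\<Sum>n. lam (Suc n)) * (2 * C0 + 3)"
      by (intro mult_left_mono) auto
    then show ?thesis using curtain_dist_le[of x y] by linarith
  qed
  then have "D.mbounded S" unfolding D.mbounded_alt using S by blast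
  then show False using unb by simp
qed

text \<open>This is where the summability of \<open>L \<lambda>\<^sub>L\<close> enters: a bound \<open>d\<^sub>L \<le> C L\<close> would bound \<open>D\<close>.\<close>
lemma curtain_unbounded_d_L:
  assumes S: "S \<subseteq> X" and unb: "\<not> Metric_space.mbounded X (curtain_dist X d lam) S"
  shows "\<exists>L\<ge>1. \<exists>u\<in>X. \<exists>v\<in>X. C * real L < real (d_L X d L u v)"
proof (rule ccontr)
  interpret D: Metric_space X "curtain_dist X d lam" by (rule curtain_metric)
  assume "\<not> ?thesis"
  then have le: "real (d_L X d L u v) \<le> C * real L" if "1 \<le> L" "u \<in> X" "v \<in> X" for L u v
    using that by (meson not_less)
  have "curtain_dist X d lam x y \<le> (\<Sum>n. C * (real (Suc n) * lam (Suc n)))" if "x \<in> S" "y \<in> S" for x y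
    unfolding curtain_dist_def
  proof (intro suminf_le summable_curtain_dist summable_mult summable_lam(2))
    fix n
    have "real (d_L X d (Suc n) x y) \<le> C * real (Suc n)" using le[of "Suc n" x y] that S by auto
    then have "lam (Suc n) * real (d_L X d (Suc n) x y) \<le> lam (Suc n) * (C * real (Suc n))"
      using lam_pos[of "Suc n"] by (intro mult_left_mono) auto
    then show "lam (Suc n) * real (d_L X d (Suc n) x y) \<le> C * (real (Suc n) * lam (Suc n))"
      by (simp add: algebra_simps)
  qed
  then have "D.mbounded S" unfolding D.mbounded_alt using S by blast
  then show False using unb by simp
qed

end

text \<open>Quasi-density of one orbit becomes transitivity up to a bounded error: go from
  \<open>x\<close> back to near \<open>x0\<close> and out again to near \<open>y\<close>, at a cost
  of \<open>R\<close> for each leg.\<close>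

lemma cobounded_isometries:
  assumes "cobounded_space X d"
  obtains R where "\<And>x y. x \<in> X \<Longrightarrow> y \<in> X \<Longrightarrow> \<exists>g. isometry g \<and> d (g x) y \<le> R"
proof -
  obtain H :: "('a \<Rightarrow> 'a) monoid" and \<psi> where H: "isometric_action H X d \<psi>" "cobounded_action H X d \<psi>"
    using assms unfolding cobounded_space_def by blast
  interpret H: CAT0_action X d H \<psi>
    by (intro CAT0_action.intro CAT0_action_axioms.intro CAT0_axioms)
      (use H(1) in \<open>auto simp: isometric_action_def\<close>)
  obtain x0 R where x0: "x0 \<in> X" and R: "\<And>y. y \<in> X \<Longrightarrow> \<exists>g\<in>carrier H. d (\<psi> g x0) y \<le> R"
    using H(2) unfolding cobounded_action_def by blast
  have "\<exists>g. isometry g \<and> d (g x) y \<le> 2 * R" if X: "x \<in> X" "y \<in> X" for x y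
  proof -
    obtain g g' where g: "g \<in> carrier H" "d (\<psi> g x0) x \<le> R" and g': "g' \<in> carrier H" "d (\<psi> g' x0) y \<le> R"
      using R X by blast
    define k where "k = g' \<otimes>\<^bsub>H\<^esub> inv\<^bsub>H\<^esub> g"
    have k: "k \<in> carrier H" "\<psi> k x = \<psi> g' (\<psi> (inv\<^bsub>H\<^esub> g) x)"
      using g g' X by (simp_all add: k_def H.act_mult)
    have "d (\<psi> k x) (\<psi> g' x0) = d x (\<psi> g x0)"
      unfolding k(2) using H.act_dist[OF g'(1) _ x0, of "\<psi> (inv\<^bsub>H\<^esub> g) x"] H.act_in[of "inv\<^bsub>H\<^esub> g" x]
        H.act_dist_inv[OF g(1) X(1) x0] g X by simp
    then have "d (\<psi> k x) y \<le> 2 * R"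
      using triangle[of "\<psi> k x" "\<psi> g' x0" y] H.act_in k(1) g g' X x0 by (simp add: commute)
    then show ?thesis using H.act_isometry[OF k(1)] by blast
  qed
  then show ?thesis using that by blast
qed

end

section \<open>Orbits as quasi-lines\<close>

context curtain_translation begin

text \<open>The quasi-isometry sends a point to the index of an axis point near it. The upper bound
  for \<open>D\<close> comes from \<open>curtain_dist_le\<close>; the lower bound comes from the
  single term of index \<open>L\<close>, which grows linearly by
  \<open>d_L_along_axis\<close>.\<close>

lemma orbit_quasi_line:
  assumes lam: "curtain_weights lam" and L: "1 \<le> L" and x: "x \<in> X"
  shows "quasi_line (orbit G \<phi> x) (curtain_dist X d lam)"
proof -
  let ?D = "curtain_dist X d lam"
  define r where "r = 3 * C + \<rho>"
  define \<Lambda> where "\<Lambda> = (\<Sum>n. lam (Suc n))"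
  define e where "e = d (\<phi> c p) p"
  have orbX: "orbit G \<phi> x \<subseteq> X" using act_in x by (auto simp: orbit_def)
  have "\<exists>i. u \<in> X \<longrightarrow> d u (tr i p) \<le> r" for u
    using orbit_coarsely_dense[of u] by (auto simp: r_def)
  then obtain i where i: "\<And>u. u \<in> X \<Longrightarrow> d u (tr (i u) p) \<le> r" by metis
  have r0: "0 \<le> r" using i[OF p] nonneg order_trans by blast
  have e0: "0 \<le> e" by (simp add: e_def)
  have \<Lambda>0: "0 \<le> \<Lambda>" unfolding \<Lambda>_def
    by (rule suminf_nonneg[OF summable_lam(1)[OF lam]]) (use lam_pos[OF lam] in \<open>auto simp: less_imp_le\<close>)
  define s where "s = max 0 (\<lceil>(r + 2 * \<rho>) / l\<rceil> + 1)"
  have s: "0 \<le> s" "r + 2 * \<rho> < real_of_int s * l"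
  proof -
    show "0 \<le> s" by (simp add: s_def)
    have "(r + 2 * \<rho>) / l < real_of_int s" unfolding s_def by linarith
    then show "r + 2 * \<rho> < real_of_int s * l" using l by (simp add: pos_divide_less_eq)
  qed
  have lower: "lam L * real_of_int (\<bar>i u - i v\<bar> - 2 * s) \<le> ?D u v" if uv: "u \<in> X" "v \<in> X" for u v
  proof -
    have "real_of_int (\<bar>i u - i v\<bar> - 2 * s) \<le> real (d_L X d L u v)"
      using d_L_along_axis[OF uv(1) i[OF uv(1)] uv(2) i[OF uv(2)] s]
        d_L_along_axis[OF uv(2) i[OF uv(2)] uv(1) i[OF uv(1)] s] d_L_commute[of L u v]
      by (cases "i u \<le> i v") auto
    then show ?thesis
      using curtain_dist_ge[OF lam L, of u v] lam_pos[OF lam L]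
      by (meson less_imp_le mult_left_mono order_trans)
  qed
  have upper: "?D u v \<le> \<Lambda> * (real_of_int \<bar>i u - i v\<bar> * e + 2 * r + 3)" if uv: "u \<in> X" "v \<in> X" for u v
  proof -
    have "d u v \<le> d u (tr (i u) p) + (d (tr (i u) p) (tr (i v) p) + d v (tr (i v) p))"
      using triangle[OF uv(1) tr_in[OF p, of "i u"] uv(2)]
        triangle[OF tr_in[OF p, of "i u"] tr_in[OF p, of "i v"] uv(2)] commute[of v "tr (i v) p"] by linarith
    then have "d u v \<le> real_of_int \<bar>i u - i v\<bar> * e + 2 * r"
      using i[OF uv(1)] i[OF uv(2)] orb_steps[OF c, of "i u" "i v"] unfolding e_def by linarith
    then have "\<Lambda> * (d u v + 3) \<le> \<Lambda> * (real_of_int \<bar>i u - i v\<bar> * e + 2 * r + 3)"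
      using \<Lambda>0 by (intro mult_left_mono) auto
    then show ?thesis using curtain_dist_le[OF lam, of u v] by (simp add: \<Lambda>_def)
  qed
  \<comment> \<open>\<open>Q\<close> dominates the slopes \<open>1 / lam L\<close> and
    \<open>\<Lambda> * e\<close>; \<open>T\<close> collects the additive errors, the last of them
    for coarse surjectivity.\<close>
  define Q where "Q = 1 + 1 / lam L + \<Lambda> * e"
  define T where "T = 2 * real_of_int s + \<Lambda> * (2 * r + 3) + (r + d x p + 1)"
  have lamL: "0 < lam L" using lam_pos[OF lam L] .
  have Q: "1 \<le> Q" "1 / lam L \<le> Q" "\<Lambda> * e \<le> Q" unfolding Q_def using lamL \<Lambda>0 e0 by auto
  have parts: "0 \<le> 2 * real_of_int s" "0 \<le> \<Lambda> * (2 * r + 3)" "0 \<le> r + d x p + 1"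
    using s \<Lambda>0 r0 by auto
  then have T: "0 \<le> T" "2 * real_of_int s \<le> T" "\<Lambda> * (2 * r + 3) \<le> T" "r + d x p + 1 \<le> T"
    unfolding T_def by linarith+
  show ?thesis
    unfolding quasi_line_def quasi_isometric_def
  proof (intro exI conjI ballI)
    show "(\<lambda>u. real_of_int (i u)) \<in> orbit G \<phi> x \<rightarrow> UNIV" by simp
    show "1 \<le> Q" "0 \<le> T" by (rule Q T)+
  next
    fix u v assume "u \<in> orbit G \<phi> x" "v \<in> orbit G \<phi> x"
    then have uv: "u \<in> X" "v \<in> X" using orbX by auto
    define a where "a = real_of_int \<bar>i u - i v\<bar>"
    have a: "dist (real_of_int (i u)) (real_of_int (i v)) = a" "0 \<le> a"
      by (simp_all add: a_def dist_real_def)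
    have D0: "0 \<le> ?D u v" using Metric_space.nonneg[OF curtain_metric[OF lam]] .
    have "?D u v \<le> Q * a + Q * T"
    proof -
      have "?D u v \<le> \<Lambda> * e * a + \<Lambda> * (2 * r + 3)" using upper[OF uv] by (simp add: a_def algebra_simps)
      also have "\<dots> \<le> Q * a + 1 * T" using Q T a(2) by (intro add_mono mult_right_mono) auto
      also have "\<dots> \<le> Q * a + Q * T" using Q T by (intro add_left_mono mult_right_mono) auto
      finally show ?thesis .
    qed
    then have "?D u v \<le> (a + T) * Q" by (simp add: algebra_simps)
    then show "?D u v / Q - T \<le> dist (real_of_int (i u)) (real_of_int (i v))"
      unfolding a using Q(1) by (simp add: pos_divide_le_eq diff_le_eq)
    have "lam L * (a - 2 * real_of_int s) \<le> ?D u v" using lower[OF uv] by (simp add: a_def)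
    then have "a - 2 * real_of_int s \<le> 1 / lam L * ?D u v" using lamL by (simp add: pos_le_divide_eq mult.commute)
    also have "\<dots> \<le> Q * ?D u v" using Q(2) D0 by (rule mult_right_mono)
    finally show "dist (real_of_int (i u)) (real_of_int (i v)) \<le> Q * ?D u v + T"
      unfolding a using T by linarith
  next
    fix t :: real
    \<comment> \<open>Powers of \<open>c\<close> alone reach the whole line coarsely: the index of
      \<open>tr n x\<close> differs from \<open>n\<close> by at most \<open>r + d x p\<close>, and
      rounding \<open>t\<close> adds at most 1.\<close>
    define n where "n = \<lfloor>t\<rfloor>"
    define u where "u = tr n x"
    have u: "u \<in> orbit G \<phi> x" using cc by (auto simp: u_def orbit_def)
    have uX: "u \<in> X" using u orbX by blast
    have "real_of_int \<bar>i u - n\<bar> * 1 \<le> real_of_int \<bar>i u - n\<bar> * l" using l by (intro mult_left_mono) auto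
    also have "\<dots> \<le> d (tr (i u) p) (tr n p)" by (rule orbit_expands)
    also have "\<dots> \<le> d u (tr (i u) p) + d u (tr n p)"
      using triangle[OF tr_in[OF p, of "i u"] uX tr_in[OF p, of n]] by (simp add: commute)
    also have "\<dots> \<le> r + d x p" using i[OF uX] tr_dist[OF x p, of n] by (simp add: u_def)
    finally have "\<bar>real_of_int (i u) - real_of_int n\<bar> \<le> r + d x p" by simp
    then have "dist (real_of_int (i u)) t \<le> r + d x p + 1"
      unfolding dist_real_def n_def by linarith
    then show "\<exists>u\<in>orbit G \<phi> x. dist (real_of_int (i u)) t \<le> T" using u T(4) by force
  qed
qed

end

theorem theorem1p3:
  fixes X :: "'a set" and d :: "'a \<Rightarrow> 'a \<Rightarrow> real"
    and G :: "('g, 'm) monoid_scheme" and \<phi> :: "'g \<Rightarrow> 'a \<Rightarrow> 'a"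
    and lam :: "nat \<Rightarrow> real"
  assumes "CAT0_space X d" and "cobounded_space X d"
    and "isometric_action G X d \<phi>" and "properly_discontinuous G X d \<phi>"
    and "curtain_weights lam"
    and "\<exists>x\<in>X. \<not> Metric_space.mbounded X (curtain_dist X d lam) (orbit G \<phi> x)"
  shows "virtually_cyclic (G\<lparr>carrier := coarse_kernel G X d \<phi>\<rparr>) \<and>
    ((\<exists>x\<in>X. \<not> quasi_line (orbit G \<phi> x) (curtain_dist X d lam)) \<longrightarrow>
      finite (coarse_kernel G X d \<phi>))"
proof -
  interpret CAT0 X d using assms(1) by (rule CAT0.intro)
  interpret CAT0_action X d G \<phi>
    by (intro CAT0_action.intro CAT0_action_axioms.intro CAT0_axioms)
      (use assms(3) in \<open>auto simp: isometric_action_def\<close>)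
  obtain x where x: "x \<in> X" and unb: "\<not> Metric_space.mbounded X (curtain_dist X d lam) (orbit G \<phi> x)"
    using assms(6) by blast
  have orbX: "orbit G \<phi> x \<subseteq> X" using act_in x by (auto simp: orbit_def)
  obtain R where R: "\<And>x y. x \<in> X \<Longrightarrow> y \<in> X \<Longrightarrow> \<exists>g. isometry g \<and> d (g x) y \<le> R"
    using cobounded_isometries[OF assms(2)] by blast
  obtain L h M P p \<rho> where L: "1 \<le> L" and n: "nested 40 h M P" and p: "p \<in> X" and \<rho>: "0 \<le> \<rho>"
    and sep: "\<forall>i<40. \<forall>j<40. i \<noteq> j \<longrightarrow> L_separated X d L (h i) (h j)"
    and bot: "\<forall>i<8. \<forall>a\<in>M (5 * i). \<forall>b\<in>P (5 * i + 4). d a p + d p b \<le> d a b + \<rho>"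
    and ends: "far (M 0)" "far (P 39)"
    by (rule bottleneck_exists[OF curtain_unbounded_far[OF assms(5) orbX unb] R
        curtain_unbounded_d_L[OF assms(5) orbX unb]])
  note part = halves_partition[OF nested_halves[OF n]]
  interpret bottleneck_action X d G \<phi> "\<lambda>i. M (5 * i)" "\<lambda>i. P (5 * i + 4)" p \<rho>
  proof
    fix i x assume i: "Suc i < 8" and x: "x \<in> X" "x \<notin> M (5 * Suc i)"
    have "M (5 * i + 4) \<union> h (5 * i + 4) \<subseteq> M (5 * Suc i)" by (rule nested_minus[OF n]) (use i in auto)
    then show "x \<in> P (5 * i + 4)" using part(1)[of "5 * i + 4"] x i by auto
  next
    fix i j :: nat assume ij: "i \<le> j" "j < 8"
    show "M (5 * i) \<subseteq> M (5 * j)"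
      using nested_minus[OF n, of "5 * i" "5 * j"] ij by (cases "i = j") auto
    show "P (5 * j + 4) \<subseteq> P (5 * i + 4)"
      using nested_plus[OF n, of "5 * i + 4" "5 * j + 4"] ij by (cases "i = j") auto
  next
    fix i :: nat assume "i < 8"
    then show "M (5 * i) \<subseteq> X" "P (5 * i + 4) \<subseteq> X" using part(6)[of "5 * i"] part(7)[of "5 * i + 4"] by auto
  qed (use p \<rho> bot ends in auto)
  have pd: "finite {k \<in> K. d (\<phi> k p) p \<le> r}" for r
  proof (rule finite_subset)
    \<comment> \<open>\<open>properly_discontinuous\<close> speaks of positive radii only, hence
      \<open>max r 1\<close>.\<close>
    show "{k \<in> K. d (\<phi> k p) p \<le> r} \<subseteq> {g \<in> carrier G. d (\<phi> g p) p \<le> max r 1}"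
      by (auto simp: coarse_kernel_def)
    show "finite {g \<in> carrier G. d (\<phi> g p) p \<le> max r 1}"
      using assms(4) p unfolding properly_discontinuous_def by (auto simp: less_max_iff_disj)
  qed
  show ?thesis
  proof (cases "finite K")
    case True
    \<comment> \<open>The criterion is applied to the identity: the cyclic subgroup is trivial, and
      \<open>r\<close> bounds all displacements of \<open>p\<close>.\<close>
    define r where "r = Max ((\<lambda>k. d (\<phi> k p) p) ` K)"
    have "\<exists>i. d (orb \<one>\<^bsub>G\<^esub> i) (\<phi> k p) \<le> r" if "k \<in> K" for k
    proof -
      have "d (\<phi> k p) p \<le> r" unfolding r_def using True that by (intro Max_ge) auto
      then show ?thesis using p by (intro exI[of _ 0]) (simp add: act_one commute)
    qed
    then have "virtually_cyclic (G\<lparr>carrier := K\<rparr>)"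
      by (intro finite_index_criterion[OF kernel_one pd])
    then show ?thesis using True by simp
  next
    case False
    \<comment> \<open>Only finitely many elements move \<open>p\<close> by a bounded amount, so an
      infinite kernel moves it arbitrarily far.\<close>
    have "\<exists>c\<in>K. 10 * \<rho> + 1 < d (\<phi> c p) p"
    proof (rule ccontr)
      assume "\<not> ?thesis"
      then have "K \<subseteq> {k \<in> K. d (\<phi> k p) p \<le> 10 * \<rho> + 1}" by force
      then show False using False pd finite_subset by blast
    qed
    then obtain c0 where c0: "c0 \<in> K" "10 * \<rho> + 1 \<le> d (\<phi> c0 p) p" by (meson less_imp_le)
    obtain c where c: "c \<in> K" "\<phi> c p \<in> P (5 * 2 + 4)" "10 * \<rho> + 1 \<le> d (\<phi> c p) p"
      by (rule translation_exists[OF c0])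
    have "virtually_cyclic (G\<lparr>carrier := K\<rparr>)"
      by (rule finite_index_criterion[OF c(1) pd orbit_dense_in_kernel[OF c(1)]]) (use c(3) \<rho> in auto)
    moreover obtain C where C: "0 < C" "\<forall>x\<in>X. d (\<phi> c x) x \<le> C" by (rule kernel_bound[OF c(1)])
    interpret curtain_translation X d G \<phi> M P p \<rho> c C h L
    proof
      show "c \<in> K" "\<phi> c p \<in> P (5 * 2 + 4)" "10 * \<rho> + 1 \<le> d (\<phi> c p) p" by (rule c)+
      show "d (\<phi> c y) y \<le> C" if "y \<in> X" for y using C(2) that by blast
      show "nested 40 h M P" by (rule n)
      show "L_separated X d L (h i) (h j)" if "i < 40" "j < 40" "i \<noteq> j" for i j using sep that by blast
    qed
    \<comment> \<open>With an infinite kernel every orbit is a quasi-line, so the second claim holds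
      vacuously.\<close>
    have "quasi_line (orbit G \<phi> y) (curtain_dist X d lam)" if "y \<in> X" for y
      by (rule orbit_quasi_line[OF assms(5) L that])
    ultimately show ?thesis by blast
  qed
qed

end
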